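(* Let $F=\{F_\omega\}$ be the random tower map on $\Delta=\{\Delta_\omega\}$ associated with a random tower satisfying (P1)--(P7) (all defined in the context), and let $\{\nu_\omega=h_\omega m\}$ and $K_\omega$ be the exact $F$-equivariant family of absolutely continuous probability measures and the random variable described in the context. Let $\delta>0$. Then there exist a full measure set $\Omega_0\subset\Omega$ and a random variable $C_\omega$ on $\Omega_0$ such that for every $\varphi,\psi\in\mathcal F_\gamma^{K_\omega}$ there exists a constant $C_{\varphi,\psi}$ such that for every $\omega\in\Omega_0$ and every $n\in\mathbb N$: (i) ("future" operational correlations) $$\left|\int(\varphi_{\sigma^n\omega}\circ F_\omega^n)\psi_\omega\,dm-\int\varphi_{\sigma^n\omega}\,d\nu_{\sigma^n\omega}\int\psi_\omega\,dm\right|\le C_\omega C_{\varphi,\psi}\,n^{1+\delta-a};$$ (ii) ("past" operational correlations) $$\left|\int(\varphi_{\omega}\circ F_{\sigma^{-n}\omega}^n)\psi_{\sigma^{-n}\omega}\,dm-\int\varphi_{\omega}\,d\nu_{\omega}\int\psi_{\sigma^{-n}\omega}\,dm\right|\le C_\omega C_{\varphi,\psi}\,n^{1+\delta-a}.$$ Moreover, there exist constants $C>0$, $u'>0$, $v'\in(0,1)$ such that $P\{C_\omega>n\}\le Ce^{-u'n^{v'}}$ for all $n\in\mathbb N$.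
   Context: Setting. Let $(\mathbb A,\mathcal F,p)$ be a Borel probability space, $\Omega=\mathbb A^{\mathbb Z}$, $P=p^{\mathbb Z}$, and $\sigma:\Omega\to\Omega$ the two-sided shift. Let $X$ be a measurable space with a reference measure $m$ (and a metric, used for diameters in (P3)), and let $f_u:X\to X$ ($p$-a.e. $u\in\mathbb A$) be measurable maps, nonsingular with respect to $m$, such that $(x,\omega)\mapsto (f_\omega(x),\sigma\omega)$ is measurable, where $f_\omega:=f_{\omega_0}$ depends only on the zeroth coordinate of $\omega$. Put $f^n_\omega=f_{\sigma^{n-1}\omega}\circ\cdots\circ f_\omega$. Random tower. $\Lambda\subset X$ is measurable with $m(\Lambda)=1$. For a.e. $\omega$ there are a countable partition $\{\Lambda_j(\omega)\}_j$ of $\Lambda$ and a return time $R_\omega:\Lambda\to\mathbb N$, constant on each $\Lambda_j(\omega)$, with $f_\omega^{R_\omega(x)}(x)\in\Lambda$ for a.e. $\omega$ and $m$-a.e. $x\in\Lambda$. Define $\Delta_\omega=\{(x,\ell)\in\Lambda\times\mathbb Z_+: x\in\bigcup_j\Lambda_j(\sigma^{-\ell}\omega),\ 0\le\ell\le R_{\sigma^{-\ell}\omega}(x)-1\}$ and $F_\omega:\Delta_\omega\to\Delta_{\sigma\omega}$ by $F_\omega(x,\ell)=(x,\ell+1)$ if $\ell+1<R_{\sigma^{-\ell}\omega}(x)$ and $F_\omega(x,\ell)=(f^{\ell+1}_{\sigma^{-\ell}\omega}(x),0)$ if $\ell+1=R_{\sigma^{-\ell}\omega}(x)$; $F^n_\omega=F_{\sigma^{n-1}\omega}\circ\cdots\circ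 F_\omega$. The level $\Delta_{\omega,\ell}=\{(x,\ell)\in\Delta_\omega\}$ is a copy of $\{R_{\sigma^{-\ell}\omega}>\ell\}\subset\Lambda$; $\Delta_{\omega,0}=\Lambda$. The measure $m$ and the $\sigma$-algebra of $\Lambda$ lift to $\Delta_\omega$; the lifts are denoted $m$ and $\mathcal B_\omega$. Let $\mathcal P_\omega=\{F^\ell_{\sigma^{-\ell}\omega}(\Lambda_j(\sigma^{-\ell}\omega)): R_{\sigma^{-\ell}\omega}|_{\Lambda_j(\sigma^{-\ell}\omega)}\ge\ell+1,\ \ell\in\mathbb Z_+\}$, a countable partition of $\Delta_\omega$. Separation time: $s(z_1,z_2)=0$ if $z_1,z_2$ lie in different towers; if $z_1,z_2\in\Delta_\omega$, $s(z_1,z_2)$ is the smallest $n\ge0$ such that the points reached by $z_1$ and $z_2$ at their $n$-th return to the base (for $n=0$: $z_1,z_2$ themselves) lie in distinct elements of the partition $\mathcal P$ of the corresponding fibre ($\infty$ if there is none). Assumptions: (P1) For each $\Lambda_j(\omega)$, $F_\omega^{R_\omega}|_{\Lambda_j(\omega)}:\Lambda_j(\omega)\to\Lambda$ is a bijection. (P2) There are $D>0$, $0<\gamma<1$ such that for all $\omega$ and each $\Lambda_j(\omega)$ the map $F_\omega^{R_\omega}|_{\Lambda_j(\omega)}$ and its inverse are nonsingular with respect to $m$, with positive Jacobian $JF_\omega^{R_\omega}$, and for $x,y\in\Lambda_j(\omega)$, $\left|\frac{JF_\omega^{R_\omega}(x)}{JF_\omega^{R_\omega}(y)}-1\right|\le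 D\gamma^{s(F_\omega^{R_\omega}(x,0),F_\omega^{R_\omega}(y,0))}$. (P3) $\mathcal P_\omega$ is generating: the diameters of $\bigvee_{j=0}^nF_\omega^{-j}\mathcal P_{\sigma^j\omega}$ tend to $0$ as $n\to\infty$. (P4) There are $C>0$, $a>1$, $b\ge0$, $u>0$, $v>0$, a full measure set $\Omega_1\subset\Omega$ and a random variable $n_1:\Omega_1\to\mathbb N$ with $m\{x\in\Lambda:R_\omega(x)>n\}\le C\frac{(\log n)^b}{n^a}$ whenever $n\ge n_1(\omega)$, and $P\{n_1(\omega)>n\}\le Ce^{-un^v}$. (P5) There are $N\in\mathbb N$, $t_1,\dots,t_N\in\mathbb Z_+$ with $\gcd\{t_i\}=1$ and $\epsilon_i>0$ such that for a.e. $\omega$ and all $i$, $m\{x\in\Lambda:R_\omega(x)=t_i\}>\epsilon_i$. (P6) There is $M>0$ with $m(\Delta_\omega)\le M$ for all $\omega$. (P7) There are $C>0$, $\hat b\ge0$ such that, with $a>1$ as in (P4), $(P\times m)\{(\omega,x)\in\Omega\times\Lambda:R_\omega(x)=n\}\le C\frac{(\log n)^{\hat b}}{n^{a+1}}$ for $n\ge2$. Function spaces (families $\varphi=\{\varphi_\omega:\Delta_\omega\to\mathbb R\}$; constants independent of $\omega$). $\mathcal F_\gamma^+$: there is $C_\varphi>0$ such that for each $I_\omega\in\mathcal P_\omega$ either $\varphi_\omega|_{I_\omega}\equiv0$, or $\varphi_\omega|_{I_\omega}>0$ and $|\log(\varphi_\omega(x)/\varphi_\omega(y))|\le C_\varphi\gamma^{s(x,y)}$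 for all $x,y\in I_\omega$. $\mathcal L_\infty^{K_\omega}$: there is $C'_\varphi>0$ with $\sup_{x\in\Delta_\omega}|\varphi_\omega(x)|\le C'_\varphi K_\omega$. $\mathcal F_\gamma^{K_\omega}$: those $\varphi\in\mathcal L_\infty^{K_\omega}$ for which there is $C_\varphi>0$ with $|\varphi_\omega(x)-\varphi_\omega(y)|\le C_\varphi K_\omega\gamma^{s(x,y)}$ for all $x,y\in\Delta_\omega$. The measures $\nu_\omega$ and the random variable $K_\omega$: $K_\omega:\Omega\to\mathbb R_+$ is a random variable with $\inf_\Omega K_\omega>0$ and $P\{K_\omega>n\}\le e^{-un^v}$ for all $n\in\mathbb N$ ($u,v$ from (P4)), and $\nu_\omega=h_\omega m$ is a family of probability measures on $\Delta_\omega$ with $(F_\omega)_*\nu_\omega=\nu_{\sigma\omega}$ for a.e. $\omega$ and $h\in\mathcal F_\gamma^{K_\omega}\cap\mathcal F_\gamma^+$, which is exact: for every $B\subset\Delta$ in $\bigcap_{n\ge0}F^{-n}\mathcal B$, $\nu_\omega(B\cap\Delta_\omega)\in\{0,1\}$ for a.e. $\omega$, where $\mathcal B$ is the $\sigma$-algebra of sets $B\subset\Delta$ with $B\cap\Delta_\omega\in\mathcal B_\omega$ for each $\omega$. (The paper proves that such $\nu_\omega$ and $K_\omega$ exist under (P1)--(P7).) *)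

theory Defs
  imports "HOL-Probability.Probability"
begin

text \<open>
  The data of a random tower. Everything that is attached to \<open>\<omega>\<close> is only available almost
  everywhere; \<open>fibres\<close> is the full-measure shift-invariant set of those \<open>\<omega>\<close> for which it
  is (all of \<open>\<Omega>\<close> is allowed). Outside it the data are arbitrary, and ``for all \<open>\<omega>\<close>''
  below always ranges over it.
\<close>

record ('u, 'x) random_tower =
  noise :: "'u measure"
  refm :: "'x measure"
  metr :: "'x \<Rightarrow> 'x \<Rightarrow> real"
  dyn :: "'u \<Rightarrow> 'x \<Rightarrow> 'x"
  base :: "'x set"
  fibres :: "(int \<Rightarrow> 'u) set"
  basecells :: "(int \<Rightarrow> 'u) \<Rightarrow> 'x set set"
  rtime :: "(int \<Rightarrow> 'u) \<Rightarrow> 'x \<Rightarrow> nat"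

definition \<Omega>P :: "('u, 'x) random_tower \<Rightarrow> (int \<Rightarrow> 'u) measure" where
  "\<Omega>P T = PiM UNIV (\<lambda>_. noise T)"

text \<open>The iterate \<open>\<sigma>\<^sup>k\<close> of the two-sided shift, \<open>k\<close> of either sign.\<close>

definition shift :: "int \<Rightarrow> (int \<Rightarrow> 'u) \<Rightarrow> int \<Rightarrow> 'u" where
  "shift k \<omega> = (\<lambda>i. \<omega> (i + k))"

primrec fiter :: "('u, 'x) random_tower \<Rightarrow> nat \<Rightarrow> (int \<Rightarrow> 'u) \<Rightarrow> 'x \<Rightarrow> 'x" where
  "fiter T 0 \<omega> x = x"
| "fiter T (Suc n) \<omega> x = dyn T (shift (int n) \<omega> 0) (fiter T n \<omega> x)"

definition nonsingular :: "'a measure \<Rightarrow> 'b measure \<Rightarrow> ('a \<Rightarrow> 'b) \<Rightarrow> bool" where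
  "nonsingular M N g \<longleftrightarrow>
     g \<in> measurable M N \<and> (\<forall>B\<in>null_sets N. g -` B \<inter> space M \<in> null_sets M)"


subsection \<open>The tower\<close>

definition Tower :: "('u, 'x) random_tower \<Rightarrow> (int \<Rightarrow> 'u) \<Rightarrow> ('x \<times> nat) set" where
  "Tower T \<omega> = {(x, l). x \<in> base T \<and> x \<in> \<Union> (basecells T (shift (- int l) \<omega>)) \<and>
                        l < rtime T (shift (- int l) \<omega>) x}"

definition tmap :: "('u, 'x) random_tower \<Rightarrow> (int \<Rightarrow> 'u) \<Rightarrow> 'x \<times> nat \<Rightarrow> 'x \<times> nat" where
  "tmap T \<omega> = (\<lambda>(x, l). if l + 1 < rtime T (shift (- int l) \<omega>) x then (x, l + 1)
                        else (fiter T (l + 1) (shift (- int l) \<omega>) x, 0))"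

primrec titer :: "('u, 'x) random_tower \<Rightarrow> nat \<Rightarrow> (int \<Rightarrow> 'u) \<Rightarrow> 'x \<times> nat \<Rightarrow> 'x \<times> nat" where
  "titer T 0 \<omega> z = z"
| "titer T (Suc n) \<omega> z = tmap T (shift (int n) \<omega>) (titer T n \<omega> z)"

text \<open>
  The lift of the reference measure: a set is measurable iff each of its levels is, and its
  measure is the sum of the measures of its levels.
\<close>

definition tmeas :: "('u, 'x) random_tower \<Rightarrow> (int \<Rightarrow> 'u) \<Rightarrow> ('x \<times> nat) measure" where
  "tmeas T \<omega> = restrict_space (refm T \<Otimes>\<^sub>M count_space UNIV) (Tower T \<omega>)"

definition tcells :: "('u, 'x) random_tower \<Rightarrow> (int \<Rightarrow> 'u) \<Rightarrow> ('x \<times> nat) set set" where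
  "tcells T \<omega> = {titer T l (shift (- int l) \<omega>) ` (A \<times> {0}) | l A.
      A \<in> basecells T (shift (- int l) \<omega>) \<and> (\<forall>x\<in>A. l + 1 \<le> rtime T (shift (- int l) \<omega>) x)}"

text \<open>Time and place of the first return to the base; a point of the tower is carried together
  with its fibre.\<close>

definition rettime :: "('u, 'x) random_tower \<Rightarrow> (int \<Rightarrow> 'u) \<Rightarrow> 'x \<times> nat \<Rightarrow> nat" where
  "rettime T \<omega> z = (LEAST k. 0 < k \<and> snd (titer T k \<omega> z) = 0)"

definition retmap ::
  "('u, 'x) random_tower \<Rightarrow> (int \<Rightarrow> 'u) \<times> ('x \<times> nat) \<Rightarrow> (int \<Rightarrow> 'u) \<times> ('x \<times> nat)" where
  "retmap T = (\<lambda>(\<omega>, z). (shift (int (rettime T \<omega> z)) \<omega>, titer T (rettime T \<omega> z) \<omega> z))"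

definition same_cell ::
  "('u, 'x) random_tower \<Rightarrow> (int \<Rightarrow> 'u) \<times> ('x \<times> nat) \<Rightarrow> (int \<Rightarrow> 'u) \<times> ('x \<times> nat) \<Rightarrow> bool" where
  "same_cell T = (\<lambda>(\<omega>1, z1) (\<omega>2, z2). \<omega>1 = \<omega>2 \<and> (\<exists>I\<in>tcells T \<omega>1. z1 \<in> I \<and> z2 \<in> I))"

text \<open>Points in a common cell return at the same time. So up to the first separation both
  points stay in a common fibre, and the fibre clause of \<open>same_cell\<close> only matters for
  points that start in different towers. The infimum of the empty set is \<open>\<infinity>\<close>.\<close>

definition sep ::
  "('u, 'x) random_tower \<Rightarrow> (int \<Rightarrow> 'u) \<times> ('x \<times> nat) \<Rightarrow> (int \<Rightarrow> 'u) \<times> ('x \<times> nat) \<Rightarrow> enat" where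
  "sep T q1 q2 =
     (INF n\<in>{n. \<not> same_cell T ((retmap T ^^ n) q1) ((retmap T ^^ n) q2)}. enat n)"

definition epow :: "real \<Rightarrow> enat \<Rightarrow> real" where
  "epow \<gamma> s = (case s of enat n \<Rightarrow> \<gamma> ^ n | \<infinity> \<Rightarrow> 0)"


subsection \<open>Standing assumptions\<close>

definition random_tower_setting :: "('u::topological_space, 'x) random_tower \<Rightarrow> bool" where
  "random_tower_setting T \<longleftrightarrow>
     prob_space (noise T) \<and> sets (noise T) = sets borel \<and>
     Metric_space (space (refm T)) (metr T) \<and>
     (AE u in noise T. nonsingular (refm T) (refm T) (dyn T u)) \<and>
     (\<lambda>(x, \<omega>). (dyn T (\<omega> 0) x, shift 1 \<omega>))
        \<in> measurable (refm T \<Otimes>\<^sub>M \<Omega>P T) (refm T \<Otimes>\<^sub>M \<Omega>P T) \<and>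
     base T \<in> sets (refm T) \<and> emeasure (refm T) (base T) = 1 \<and>
     fibres T \<in> sets (\<Omega>P T) \<and> measure (\<Omega>P T) (fibres T) = 1 \<and>
     (\<forall>\<omega>. shift 1 \<omega> \<in> fibres T \<longleftrightarrow> \<omega> \<in> fibres T) \<and>
     (\<forall>\<omega>\<in>fibres T.
        partition_on (base T) (basecells T \<omega>) \<and> countable (basecells T \<omega>) \<and>
        basecells T \<omega> \<subseteq> sets (refm T) \<and>
        (\<forall>x\<in>base T. 1 \<le> rtime T \<omega> x) \<and>
        (\<forall>A\<in>basecells T \<omega>. \<forall>x\<in>A. \<forall>y\<in>A. rtime T \<omega> x = rtime T \<omega> y)) \<and>
     (\<forall>n. {(\<omega>, x). \<omega> \<in> fibres T \<and> x \<in> base T \<and> rtime T \<omega> x = n}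
            \<in> sets (\<Omega>P T \<Otimes>\<^sub>M restrict_space (refm T) (base T))) \<and>
     (AE \<omega> in \<Omega>P T. AE x in refm T.
        x \<in> base T \<longrightarrow> fiter T (rtime T \<omega> x) \<omega> x \<in> base T)"

definition full_branches :: "('u, 'x) random_tower \<Rightarrow> bool" where
  "full_branches T \<longleftrightarrow>
     (\<forall>\<omega>\<in>fibres T. \<forall>A\<in>basecells T \<omega>.
        bij_betw (\<lambda>x. titer T (rtime T \<omega> x) \<omega> (x, 0)) A (base T \<times> {0}))"

definition jacobian :: "'a measure \<Rightarrow> 'b measure \<Rightarrow> ('a \<Rightarrow> 'b) \<Rightarrow> ('a \<Rightarrow> real) \<Rightarrow> bool" where
  "jacobian M N g J \<longleftrightarrow>
     J \<in> borel_measurable M \<and>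
     (\<forall>B\<in>sets M. emeasure N (g ` B) = (\<integral>\<^sup>+x\<in>B. ennreal (J x) \<partial>M))"

text \<open>A Jacobian is determined almost everywhere only; the distortion estimate, being pointwise,
  refers to a suitable version of it.\<close>

definition bounded_distortion :: "('u, 'x) random_tower \<Rightarrow> real \<Rightarrow> bool" where
  "bounded_distortion T \<gamma> \<longleftrightarrow> 0 < \<gamma> \<and> \<gamma> < 1 \<and>
     (\<exists>D>0. \<forall>\<omega>\<in>fibres T. \<forall>A\<in>basecells T \<omega>.
        let g = (\<lambda>x. fst (titer T (rtime T \<omega> x) \<omega> (x, 0)));
            mA = restrict_space (refm T) A; mB = restrict_space (refm T) (base T)
        in nonsingular mA mB g \<and> nonsingular mB mA (the_inv_into A g) \<and>
           (\<exists>J. jacobian mA mB g J \<and> (\<forall>x\<in>A. 0 < J x) \<and>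
              (\<forall>x\<in>A. \<forall>y\<in>A. \<bar>J x / J y - 1\<bar> \<le>
                 D * epow \<gamma> (sep T
                   (shift (int (rtime T \<omega> x)) \<omega>, titer T (rtime T \<omega> x) \<omega> (x, 0))
                   (shift (int (rtime T \<omega> y)) \<omega>, titer T (rtime T \<omega> y) \<omega> (y, 0))))))"

definition joincells ::
  "('u, 'x) random_tower \<Rightarrow> (int \<Rightarrow> 'u) \<Rightarrow> nat \<Rightarrow> ('x \<times> nat) set set" where
  "joincells T \<omega> n =
     {\<Inter>j\<in>{..n}. {z \<in> Tower T \<omega>. titer T j \<omega> z \<in> I j} | I.
        \<forall>j\<le>n. I j \<in> tcells T (shift (int j) \<omega>)} - {{}}"

text \<open>Only applied to subsets of a single level.\<close>

definition tdiam :: "('u, 'x) random_tower \<Rightarrow> ('x \<times> nat) set \<Rightarrow> ennreal" where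
  "tdiam T B = (SUP z\<in>B. SUP w\<in>B. ennreal (metr T (fst z) (fst w)))"

definition generating :: "('u, 'x) random_tower \<Rightarrow> bool" where
  "generating T \<longleftrightarrow>
     (\<forall>\<omega>\<in>fibres T. (\<lambda>n. SUP B\<in>joincells T \<omega> n. tdiam T B) \<longlonglongrightarrow> 0)"

text \<open>The polynomial bound is required from \<open>n = 2\<close> on, where \<open>(ln n) powr b\<close> is unambiguous
  also for \<open>b = 0\<close>; this amounts to enlarging \<open>n\<^sub>1\<close> to at least 2.\<close>

definition quenched_tail ::
  "('u, 'x) random_tower \<Rightarrow> real \<Rightarrow> real \<Rightarrow> real \<Rightarrow> bool" where
  "quenched_tail T a u v \<longleftrightarrow> 1 < a \<and> 0 < u \<and> 0 < v \<and>
     (\<exists>C>0. \<exists>b\<ge>0. \<exists>\<Omega>1 n1.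
        \<Omega>1 \<in> sets (\<Omega>P T) \<and> \<Omega>1 \<subseteq> fibres T \<and> measure (\<Omega>P T) \<Omega>1 = 1 \<and>
        n1 \<in> measurable (restrict_space (\<Omega>P T) \<Omega>1) (count_space (UNIV :: nat set)) \<and>
        (\<forall>\<omega>\<in>\<Omega>1. \<forall>n\<ge>max 2 (n1 \<omega>).
           measure (refm T) {x \<in> base T. n < rtime T \<omega> x} \<le> C * ln (real n) powr b / real n powr a) \<and>
        (\<forall>n\<ge>1. measure (\<Omega>P T) {\<omega> \<in> \<Omega>1. n < n1 \<omega>} \<le> C * exp (- u * real n powr v)))"

definition aperiodic :: "('u, 'x) random_tower \<Rightarrow> bool" where
  "aperiodic T \<longleftrightarrow>
     (\<exists>(N::nat) (t :: nat \<Rightarrow> nat) (\<epsilon> :: nat \<Rightarrow> real).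
        Gcd (t ` {1..N}) = 1 \<and> (\<forall>i\<in>{1..N}. 0 < \<epsilon> i) \<and>
        (AE \<omega> in \<Omega>P T. \<forall>i\<in>{1..N}. \<epsilon> i < measure (refm T) {x \<in> base T. rtime T \<omega> x = t i}))"

definition bounded_towers :: "('u, 'x) random_tower \<Rightarrow> bool" where
  "bounded_towers T \<longleftrightarrow>
     (\<exists>M>0. \<forall>\<omega>\<in>fibres T. emeasure (tmeas T \<omega>) (Tower T \<omega>) \<le> ennreal M)"

definition annealed_tail :: "('u, 'x) random_tower \<Rightarrow> real \<Rightarrow> bool" where
  "annealed_tail T a \<longleftrightarrow>
     (\<exists>C>0. \<exists>b\<ge>0. \<forall>n\<ge>2.
        measure (\<Omega>P T \<Otimes>\<^sub>M restrict_space (refm T) (base T))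
          {(\<omega>, x). \<omega> \<in> fibres T \<and> x \<in> base T \<and> rtime T \<omega> x = n}
        \<le> C * ln (real n) powr b / real n powr (a + 1))"


subsection \<open>Function spaces\<close>

type_synonym ('u, 'x) family = "(int \<Rightarrow> 'u) \<Rightarrow> 'x \<times> nat \<Rightarrow> real"

definition Fplus :: "('u, 'x) random_tower \<Rightarrow> real \<Rightarrow> ('u, 'x) family set" where
  "Fplus T \<gamma> = {\<phi>. \<exists>C>0. \<forall>\<omega>\<in>fibres T. \<forall>I\<in>tcells T \<omega>.
      (\<forall>x\<in>I. \<phi> \<omega> x = 0) \<or>
      (\<forall>x\<in>I. 0 < \<phi> \<omega> x) \<and>
      (\<forall>x\<in>I. \<forall>y\<in>I. \<bar>ln (\<phi> \<omega> x / \<phi> \<omega> y)\<bar> \<le> C * epow \<gamma> (sep T (\<omega>, x) (\<omega>, y)))}"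

definition LinfK :: "('u, 'x) random_tower \<Rightarrow> ((int \<Rightarrow> 'u) \<Rightarrow> real) \<Rightarrow> ('u, 'x) family set" where
  "LinfK T K = {\<phi>. \<exists>C>0. \<forall>\<omega>\<in>fibres T. \<forall>x\<in>Tower T \<omega>. \<bar>\<phi> \<omega> x\<bar> \<le> C * K \<omega>}"

definition FK ::
  "('u, 'x) random_tower \<Rightarrow> real \<Rightarrow> ((int \<Rightarrow> 'u) \<Rightarrow> real) \<Rightarrow> ('u, 'x) family set" where
  "FK T \<gamma> K = {\<phi> \<in> LinfK T K. \<exists>C>0. \<forall>\<omega>\<in>fibres T. \<forall>x\<in>Tower T \<omega>. \<forall>y\<in>Tower T \<omega>.
      \<bar>\<phi> \<omega> x - \<phi> \<omega> y\<bar> \<le> C * K \<omega> * epow \<gamma> (sep T (\<omega>, x) (\<omega>, y))}"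


subsection \<open>The exact equivariant family\<close>

definition tail_variable ::
  "('u, 'x) random_tower \<Rightarrow> real \<Rightarrow> real \<Rightarrow> ((int \<Rightarrow> 'u) \<Rightarrow> real) \<Rightarrow> bool" where
  "tail_variable T u v K \<longleftrightarrow>
     K \<in> borel_measurable (\<Omega>P T) \<and> (\<forall>\<omega>\<in>space (\<Omega>P T). 0 \<le> K \<omega>) \<and>
     0 < (INF \<omega>\<in>space (\<Omega>P T). K \<omega>) \<and>
     (\<forall>n::nat. 1 \<le> n \<longrightarrow>
        measure (\<Omega>P T) {\<omega> \<in> space (\<Omega>P T). real n < K \<omega>} \<le> exp (- u * real n powr v))"

definition nu :: "('u, 'x) random_tower \<Rightarrow> ('u, 'x) family \<Rightarrow> (int \<Rightarrow> 'u) \<Rightarrow> ('x \<times> nat) measure" where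
  "nu T h \<omega> = density (tmeas T \<omega>) (\<lambda>z. ennreal (h \<omega> z))"

definition equivariant :: "('u, 'x) random_tower \<Rightarrow> ('u, 'x) family \<Rightarrow> bool" where
  "equivariant T h \<longleftrightarrow>
     (AE \<omega> in \<Omega>P T. distr (nu T h \<omega>) (tmeas T (shift 1 \<omega>)) (tmap T \<omega>) = nu T h (shift 1 \<omega>))"

definition Total :: "('u, 'x) random_tower \<Rightarrow> ((int \<Rightarrow> 'u) \<times> ('x \<times> nat)) set" where
  "Total T = (SIGMA \<omega> : fibres T. Tower T \<omega>)"

definition total_map ::
  "('u, 'x) random_tower \<Rightarrow> (int \<Rightarrow> 'u) \<times> ('x \<times> nat) \<Rightarrow> (int \<Rightarrow> 'u) \<times> ('x \<times> nat)" where
  "total_map T = (\<lambda>(\<omega>, z). (shift 1 \<omega>, tmap T \<omega> z))"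

definition fibrewise_sets ::
  "('u, 'x) random_tower \<Rightarrow> ((int \<Rightarrow> 'u) \<times> ('x \<times> nat)) set set" where
  "fibrewise_sets T = {B. B \<subseteq> Total T \<and> (\<forall>\<omega>\<in>fibres T. Pair \<omega> -` B \<in> sets (tmeas T \<omega>))}"

definition exact_family :: "('u, 'x) random_tower \<Rightarrow> ('u, 'x) family \<Rightarrow> bool" where
  "exact_family T h \<longleftrightarrow>
     (\<forall>B \<in> (\<Inter>n. (\<lambda>E. (total_map T ^^ n) -` E \<inter> Total T) ` fibrewise_sets T).
        AE \<omega> in \<Omega>P T. measure (nu T h \<omega>) (Pair \<omega> -` B) \<in> {0, 1})"

definition exact_equivariant_density ::
  "('u, 'x) random_tower \<Rightarrow> real \<Rightarrow> ((int \<Rightarrow> 'u) \<Rightarrow> real) \<Rightarrow> ('u, 'x) family \<Rightarrow> bool" where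
  "exact_equivariant_density T \<gamma> K h \<longleftrightarrow>
     h \<in> FK T \<gamma> K \<inter> Fplus T \<gamma> \<and>
     (\<forall>\<omega>\<in>fibres T. h \<omega> \<in> borel_measurable (tmeas T \<omega>) \<and> prob_space (nu T h \<omega>)) \<and>
     equivariant T h \<and> exact_family T h"

end

theory Submission
  imports Defs "HOL-Real_Asymp.Real_Asymp"
begin

text \<open>
  Along a fixed orbit \<open>\<sigma>\<^sup>k\<omega>\<close> a density on the towers is recorded by densities \<open>b\<^sub>k\<close> on the base: at time
  \<open>t\<close> the level \<open>l\<close> carries \<open>b\<^sub>t\<^sub>-\<^sub>l\<close> restricted to \<open>{R > l}\<close>. These satisfy the renewal equation
  \<open>b\<^sub>t = (\<Sum>k<t. L\<^sub>k\<^sub>,\<^sub>t\<^sub>-\<^sub>k b\<^sub>k)\<close>, where \<open>L\<^sub>k\<^sub>,\<^sub>j\<close> is the transfer operator of the branches with return time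
  \<open>j\<close>, and bounded distortion makes every \<open>b\<^sub>t\<close> with \<open>t \<ge> 1\<close> log-Hoelder on the whole base.

  Mass that returns before time \<open>n\<close> is on the base at time \<open>n\<close> unless it jumps over \<open>n\<close>. The chance
  to jump over \<open>n\<close> from time \<open>n - l\<close> is at most a constant times \<open>m(R > l)\<close> on the fibre at time \<open>n - l\<close>,
  and the sum of these numbers over \<open>l\<close> is at most a constant times the mass of the tower at time
  \<open>n\<close>. So (P5) and (P6) bound from below, uniformly in \<open>\<omega>\<close>, the share of the mass that is on the base
  at time \<open>n\<close>. Consequently, after a block of steps, two densities of mass \<open>\<mu>\<close> have a multiple
  \<open>\<theta>(\<mu> - \<tau>)\<close> of \<open>m\<close> on the base in common, \<open>\<tau>\<close> being a bound for the mass that does not return within the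
  block. Removing it from both, one sees that \<open>q\<close> blocks reduce the distance to \<open>\<tau> + (1 - \<theta>)\<^sup>q \<mu>\<close>.

  At scale \<open>n\<close> one uses about \<open>n\<^sup>\<beta>\<close> blocks of length \<open>n\<^sup>1\<^sup>-\<^sup>\<beta>\<close>, which costs only powers of \<open>n\<^sup>\<beta>\<close> and is paid
  for by \<open>n\<^sup>\<delta>\<close>. The tail bound (P4) and the size of \<open>K\<close> are controlled along the whole orbit by
  \<open>Z(\<omega>) = (SUP k. max (n\<^sub>1(\<sigma>\<^sup>k\<omega>)) (K(\<sigma>\<^sup>k\<omega>)) / (1 + \<bar>k\<bar>)\<^sup>\<beta>)\<close>, whose tail is stretched exponential by a union
  bound; for \<open>n < Z\<^bsup>1/\<beta>\<^esup>\<close> the trivial bound by a power of \<open>Z\<close> suffices.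
\<close>

section \<open>Tails and scales\<close>

text \<open>The densities \<open>h\<close> and \<psi> are bounded only by multiples of
  \<open>K\<close>, so the coupling is done for one fixed orbit, whose state enters only through a
  sup bound \<open>B\<close> and a tail bound \<open>S\<close>. Subtracting a constant from a
  density spoils its regularity. Hence there are two constants: \<open>Hc\<close> inside cells and
  the smaller \<open>H = (1 - e) * Hc\<close> right after a return. Removing at most the share
  \<open>e\<close> of a base density costs no more than the gap between them, and
  \<open>\<gamma> * Hc + D \<le> H\<close> says that one return restores it. Since \<psi> may change
  sign, a constant multiple of \<open>K\<close> and multiples of \<open>h\<close> are added to
  produce two positive regular densities of equal mass whose difference is \<psi> minus its integral
  times \<open>h\<close>. The rate \<theta> depends on \<psi> through \<open>Hc\<close>, but it
  affects only the deterministic constant; the random one is a power of \<open>Z\<close> alone. The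
  supremum defining \<open>Z\<close> is two-sided, so \<open>Z\<close> at \<omega> also controls the
  orbit segment that starts at \<open>shift (- int n) \<omega>\<close>. This is why future and past
  correlations come from the same estimate.\<close>

lemma summable_stretched_exp:
  fixes u p :: real
  assumes "0 < u" "0 < p"
  shows "summable (\<lambda>m::nat. exp (- u * (1 + real m) powr p))"
proof (rule summable_comparison_test_bigo)
  show "summable (\<lambda>m::nat. norm (1 / real m ^ 2))"
    using inverse_power_summable[of 2] by (simp add: divide_inverse)
  show "(\<lambda>m::nat. exp (- u * (1 + real m) powr p)) \<in> O(\<lambda>m. 1 / real m ^ 2)"
    using assms by real_asymp
qed

text \<open>For \<open>x \<ge> 1\<close> the integer part of \<open>x\<close> is at least
  \<open>x / 2\<close>, which costs the factor \<open>2 powr v\<close> in the rate.\<close>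

lemma (in prob_space) stretched_exp_tail_real:
  assumes [measurable]: "W \<in> borel_measurable M" and u: "0 < u" "0 < v" "0 \<le> C"
    and tail: "\<And>n::nat. 1 \<le> n \<Longrightarrow> prob {\<omega> \<in> space M. real n < W \<omega>} \<le> C * exp (- u * real n powr v)"
    and x: "1 \<le> x"
  shows "prob {\<omega> \<in> space M. x < W \<omega>} \<le> C * exp (- (u / 2 powr v) * x powr v)"
proof -
  define n where "n = nat \<lfloor>x\<rfloor>"
  have fl: "real n = of_int \<lfloor>x\<rfloor>" unfolding n_def using x by simp
  have n1: "1 \<le> n" unfolding n_def using x by linarith
  moreover have "real n \<le> x" "x < real n + 1" unfolding fl by linarith+
  moreover have "1 \<le> real n" using n1 by simp
  ultimately have n: "1 \<le> n" "real n \<le> x" "x \<le> 2 * real n" by linarith+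
  have "prob {\<omega> \<in> space M. x < W \<omega>} \<le> prob {\<omega> \<in> space M. real n < W \<omega>}"
    using n by (intro finite_measure_mono) auto
  also have "\<dots> \<le> C * exp (- u * real n powr v)" using tail[OF n(1)] .
  also have "\<dots> \<le> C * exp (- (u / 2 powr v) * x powr v)"
  proof -
    have "x powr v \<le> (2 * real n) powr v" using n x u by (intro powr_mono2) auto
    also have "\<dots> = 2 powr v * real n powr v" by (simp add: powr_mult)
    finally have "u * (x powr v) \<le> u * (2 powr v * real n powr v)" using u by (intro mult_left_mono) auto
    then have "u / 2 powr v * x powr v \<le> u * real n powr v" by (simp add: field_simps)
    then show ?thesis using u by (intro mult_left_mono) auto
  qed
  finally show ?thesis .
qed

text \<open>Union bound over all times, each of which has the same law because \<open>sh k\<close>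
  preserves the measure. For two numbers that are at least 1 the product is at least half of the
  sum; so the tail at \<open>t * w k\<close> splits into a factor in \<open>t\<close> and a factor
  that is summable in \<open>k\<close>.\<close>

lemma (in prob_space) stretched_exp_orbit_sup:
  fixes sh :: "int \<Rightarrow> 'a \<Rightarrow> 'a" and W :: "'a \<Rightarrow> real"
  assumes sh: "\<And>k. sh k \<in> measurable M M" "\<And>k. distr M M (sh k) = M"
    and W[measurable]: "W \<in> borel_measurable M" and W0: "\<And>\<omega>. 0 \<le> W \<omega>"
    and u: "0 < u" "0 < v" "0 \<le> C" "0 < \<beta>"
    and tail: "\<And>n::nat. 1 \<le> n \<Longrightarrow> prob {\<omega> \<in> space M. real n < W \<omega>} \<le> C * exp (- u * real n powr v)"
  shows "\<exists>Z \<Omega>'. \<Omega>' \<in> sets M \<and> prob \<Omega>' = 1 \<and> Z \<in> borel_measurable M \<and> (\<forall>\<omega>. 1 \<le> Z \<omega>) \<and>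
    (\<forall>\<omega>\<in>\<Omega>'. \<forall>k. W (sh k \<omega>) \<le> Z \<omega> * (1 + \<bar>real_of_int k\<bar>) powr \<beta>) \<and>
    (\<exists>C'>0. \<exists>u'>0. \<forall>t\<ge>1. prob {\<omega> \<in> \<Omega>'. t < Z \<omega>} \<le> C' * exp (- u' * t powr v))"
proof -
  note sh(1)[measurable]
  define w where "w k = (1 + \<bar>real_of_int k\<bar>) powr \<beta>" for k
  have w1: "1 \<le> w k" for k unfolding w_def using u by (intro ge_one_powr_ge_zero) auto
  define Ze where "Ze \<omega> = (SUP k. ennreal (W (sh k \<omega>) / w k))" for \<omega>
  have Ze_meas[measurable]: "Ze \<in> borel_measurable M" unfolding Ze_def by measurable
  define \<Omega>' where "\<Omega>' = {\<omega> \<in> space M. Ze \<omega> < \<infinity>}"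
  define Z where "Z \<omega> = max 1 (enn2real (Ze \<omega>))" for \<omega>
  have [measurable]: "Z \<in> borel_measurable M" unfolding Z_def by measurable
  have \<Omega>'s[measurable]: "\<Omega>' \<in> sets M" unfolding \<Omega>'_def by measurable
  \<comment> \<open>\<open>2 powr v\<close> comes from real thresholds, the last 2 from replacing a
    product by half of a sum.\<close>
  define u1 where "u1 = u / 2 powr v / 2"
  have u1: "0 < u1" unfolding u1_def using u by simp
  \<comment> \<open>The times \<open>m\<close> and \<open>- m\<close> are taken together, so that
    the union runs over the naturals.\<close>
  define A where "A t m = {\<omega> \<in> space M. t * w (int m) < W (sh (int m) \<omega>)} \<union> {\<omega> \<in> space M. t * w (- int m) < W (sh (- int m) \<omega>)}" for t m
  have [measurable]: "A t m \<in> sets M" for t m unfolding A_def by measurable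
  have single: "prob {\<omega> \<in> space M. t * w k < W (sh k \<omega>)} \<le> C * exp (- u1 * t powr v) * exp (- u1 * w k powr v)"
    if t: "1 \<le> t" for t k
  proof -
    have "prob {\<omega> \<in> space M. t * w k < W (sh k \<omega>)} = measure (distr M M (sh k)) {\<omega> \<in> space M. t * w k < W \<omega>}"
      by (subst measure_distr) (auto intro!: arg_cong[where f=prob] dest: measurable_space[OF sh(1)])
    also have "\<dots> = prob {\<omega> \<in> space M. t * w k < W \<omega>}" by (simp add: sh(2))
    also have "\<dots> \<le> C * exp (- (u / 2 powr v) * (t * w k) powr v)"
      by (rule stretched_exp_tail_real[OF W u(1-3) tail]) (use mult_mono[OF t w1[of k]] t in auto)
    also have "\<dots> \<le> C * (exp (- u1 * t powr v) * exp (- u1 * w k powr v))"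
    proof (intro mult_left_mono u(3))
      define x y where "x = t powr v" and "y = w k powr v"
      have xy: "1 \<le> x" "1 \<le> y" unfolding x_def y_def using t w1[of k] u by (auto intro!: ge_one_powr_ge_zero)
      have "x + y \<le> 2 * (x * y)"
      proof -
        have "0 \<le> (x - 1) * y + (y - 1) * x" using xy by (intro add_nonneg_nonneg mult_nonneg_nonneg) auto
        then show ?thesis by (simp add: algebra_simps)
      qed
      then have "u1 * (x + y) \<le> u1 * (2 * (x * y))" using u1 by (intro mult_left_mono) auto
      also have "\<dots> = u / 2 powr v * (x * y)" unfolding u1_def by simp
      also have "x * y = (t * w k) powr v" unfolding x_def y_def using t w1[of k] by (simp add: powr_mult)
      finally show "exp (- (u / 2 powr v) * (t * w k) powr v) \<le> exp (- u1 * t powr v) * exp (- u1 * w k powr v)"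
        unfolding x_def y_def exp_add[symmetric] by (simp add: algebra_simps)
    qed
    finally show ?thesis by (simp add: mult.assoc)
  qed
  define s where "s m = exp (- u1 * (1 + real m) powr (\<beta> * v))" for m :: nat
  have s: "summable s" unfolding s_def[abs_def] using u1 u by (intro summable_stretched_exp) auto
  have s0: "0 \<le> s m" for m unfolding s_def by simp
  have ws: "exp (- u1 * w k powr v) = s (nat \<bar>k\<bar>)" for k unfolding w_def s_def by (simp add: powr_powr)
  define C' where "C' = 2 * C * suminf s + 1"
  have C': "0 < C'" unfolding C'_def using u(3) suminf_nonneg[OF s s0] by (simp add: add_nonneg_pos)
  have bad: "prob (\<Union>m. A t m) \<le> C' * exp (- u1 * t powr v)" if t: "1 \<le> t" for t
  proof -
    have Am: "prob (A t m) \<le> 2 * C * exp (- u1 * t powr v) * s m" for m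
    proof -
      have "prob (A t m) \<le> prob {\<omega> \<in> space M. t * w (int m) < W (sh (int m) \<omega>)} + prob {\<omega> \<in> space M. t * w (- int m) < W (sh (- int m) \<omega>)}"
        unfolding A_def by (rule measure_Un_le) measurable
      also have "\<dots> \<le> C * exp (- u1 * t powr v) * s m + C * exp (- u1 * t powr v) * s m"
        using single[OF t, of "int m", unfolded ws] single[OF t, of "- int m", unfolded ws]
        by (intro add_mono) simp_all
      finally show ?thesis by (simp add: algebra_simps)
    qed
    have sm: "summable (\<lambda>m. 2 * C * exp (- u1 * t powr v) * s m)" using s by (rule summable_mult)
    have sA: "summable (\<lambda>m. prob (A t m))"
      by (rule summable_comparison_test'[OF sm]) (use Am in simp)
    have "prob (\<Union>m. A t m) \<le> (\<Sum>m. prob (A t m))"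
      by (rule finite_measure_subadditive_countably) (use sA in auto)
    also have "\<dots> \<le> (\<Sum>m. 2 * C * exp (- u1 * t powr v) * s m)" by (rule suminf_le[OF Am sA sm])
    also have "\<dots> = 2 * C * exp (- u1 * t powr v) * suminf s" using s by (rule suminf_mult)
    also have "\<dots> \<le> C' * exp (- u1 * t powr v)" unfolding C'_def by (simp add: algebra_simps)
    finally show ?thesis .
  qed
  have sub: "\<omega> \<in> (\<Union>m. A t m)" if sp: "\<omega> \<in> space M" and lt: "ennreal t < Ze \<omega>" and t0: "0 \<le> t" for \<omega> t
  proof -
    obtain k where "ennreal t < ennreal (W (sh k \<omega>) / w k)" using lt unfolding Ze_def less_SUP_iff by blast
    then have "t < W (sh k \<omega>) / w k" using t0 by (simp add: ennreal_less_iff)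
    then have "t * w k < W (sh k \<omega>)" using w1[of k] by (simp add: less_divide_eq)
    then have "\<omega> \<in> A t (nat \<bar>k\<bar>)" unfolding A_def using sp by (cases "0 \<le> k") auto
    then show ?thesis by blast
  qed
  \<comment> \<open>Where the supremum is infinite, every threshold is exceeded, and the probability
    of exceeding \<open>n\<close> tends to 0.\<close>
  have full: "prob \<Omega>' = 1"
  proof -
    have "prob (space M - \<Omega>') \<le> C' * exp (- u1 * real n powr v)" if "1 \<le> n" for n :: nat
    proof -
      have "prob (space M - \<Omega>') \<le> prob (\<Union>m. A (real n) m)"
      proof (intro finite_measure_mono subsetI)
        fix \<omega> assume "\<omega> \<in> space M - \<Omega>'"
        then have "\<omega> \<in> space M" "Ze \<omega> = \<top>" unfolding \<Omega>'_def by (auto simp: not_less top_unique)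
        then show "\<omega> \<in> (\<Union>m. A (real n) m)" by (intro sub) auto
      qed auto
      then show ?thesis using bad[of "real n"] that by simp
    qed
    moreover have "(\<lambda>n::nat. C' * exp (- u1 * real n powr v)) \<longlonglongrightarrow> 0" using u1 u by real_asymp
    ultimately have "prob (space M - \<Omega>') \<le> 0" by (intro LIMSEQ_le_const) auto
    then show ?thesis using prob_compl[OF \<Omega>'s] measure_nonneg[of M "space M - \<Omega>'"] by linarith
  qed
  have bound: "W (sh k \<omega>) \<le> Z \<omega> * w k" if "\<omega> \<in> \<Omega>'" for \<omega> k
  proof -
    have fin: "Ze \<omega> < \<infinity>" using that unfolding \<Omega>'_def by simp
    have "ennreal (W (sh k \<omega>) / w k) \<le> Ze \<omega>" unfolding Ze_def by (rule SUP_upper) simp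
    then have "W (sh k \<omega>) / w k \<le> enn2real (Ze \<omega>)"
      using W0[of "sh k \<omega>"] w1[of k] fin by (cases "Ze \<omega>") auto
    then have "W (sh k \<omega>) / w k \<le> Z \<omega>" unfolding Z_def by simp
    then show ?thesis using w1[of k] by (simp add: divide_le_eq)
  qed
  have Ztail: "prob {\<omega> \<in> \<Omega>'. t < Z \<omega>} \<le> C' * exp (- u1 * t powr v)" if t: "1 \<le> t" for t
  proof -
    have "{\<omega> \<in> \<Omega>'. t < Z \<omega>} \<subseteq> (\<Union>m. A t m)"
    proof
      fix \<omega> assume \<omega>: "\<omega> \<in> {\<omega> \<in> \<Omega>'. t < Z \<omega>}"
      then have "t < enn2real (Ze \<omega>)" "Ze \<omega> < \<infinity>" "\<omega> \<in> space M" using t unfolding Z_def \<Omega>'_def by auto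
      then have "ennreal t < Ze \<omega>" using t by (cases "Ze \<omega>") (auto simp: ennreal_less_iff)
      then show "\<omega> \<in> (\<Union>m. A t m)" using sub \<open>\<omega> \<in> space M\<close> t by simp
    qed
    then have "prob {\<omega> \<in> \<Omega>'. t < Z \<omega>} \<le> prob (\<Union>m. A t m)" by (intro finite_measure_mono) auto
    then show ?thesis using bad[OF t] by simp
  qed
  have "\<forall>\<omega>. 1 \<le> Z \<omega>" unfolding Z_def by simp
  moreover have "\<forall>\<omega>\<in>\<Omega>'. \<forall>k. W (sh k \<omega>) \<le> Z \<omega> * (1 + \<bar>real_of_int k\<bar>) powr \<beta>" using bound unfolding w_def by blast
  moreover have "\<exists>C'>0. \<exists>u'>0. \<forall>t\<ge>1. prob {\<omega> \<in> \<Omega>'. t < Z \<omega>} \<le> C' * exp (- u' * t powr v)"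
    using C' u1 Ztail by blast
  ultimately show ?thesis using \<Omega>'s full \<open>Z \<in> borel_measurable M\<close> by (intro exI[of _ Z] exI[of _ \<Omega>']) simp
qed

text \<open>The witnesses are \<open>q\<close>, the integer part of \<open>n powr \<beta>\<close>,
  and blocks of length \<open>k + n0\<close>, the integer part of
  \<open>n powr (1 - \<beta>)\<close>. Of each block, \<open>k\<close> steps serve to return and
  \<open>n0\<close> to synchronise. Asking only for \<open>n powr (1 - 2 * \<beta>)\<close> leaves
  room for the constants, and \<open>(1 - \<theta>) ^ q \<le> exp (- \<theta> * q)\<close> beats
  every power of \<open>n\<close>.\<close>

lemma block_schedule:
  fixes a \<beta> \<theta> :: real and n0 i0 :: nat
  assumes "0 < \<beta>" "\<beta> \<le> 1 / 8" "0 < \<theta>" "\<theta> \<le> 1"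
  shows "\<exists>N\<ge>1. \<forall>n\<ge>N. \<exists>q k. q * (k + n0) \<le> n \<and> i0 \<le> k \<and> 2 \<le> k \<and> real n powr (1 - 2 * \<beta>) \<le> real k \<and>
     (1 - \<theta>) ^ q \<le> real n powr (- a)"
proof -
  define c where "c = real i0 + real n0 + 4"
  have "\<forall>\<^sub>F n in sequentially. real n powr (1 - 2 * \<beta>) + c \<le> real n powr (1 - \<beta>)"
    using assms by real_asymp
  moreover have "\<forall>\<^sub>F n in sequentially. exp (- \<theta> * (real n powr \<beta> - 1)) \<le> real n powr (- a)"
    using assms by real_asymp
  ultimately have "\<forall>\<^sub>F n in sequentially. real n powr (1 - 2 * \<beta>) + c \<le> real n powr (1 - \<beta>) \<and>
     exp (- \<theta> * (real n powr \<beta> - 1)) \<le> real n powr (- a)" by (rule eventually_conj)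
  then obtain N where N: "\<And>n. N \<le> n \<Longrightarrow> real n powr (1 - 2 * \<beta>) + c \<le> real n powr (1 - \<beta>) \<and>
     exp (- \<theta> * (real n powr \<beta> - 1)) \<le> real n powr (- a)"
    unfolding eventually_sequentially by blast
  show ?thesis
  proof (rule exI[of _ "max 1 N"], intro conjI allI impI)
    fix n assume n: "max 1 N \<le> n"
    then have n1: "1 \<le> real n" by simp
    note e = N[of n]
    define m where "m = nat \<lfloor>real n powr (1 - \<beta>)\<rfloor>"
    define q where "q = nat \<lfloor>real n powr \<beta>\<rfloor>"
    define k where "k = m - n0"
    have m: "real m \<le> real n powr (1 - \<beta>)" "real n powr (1 - \<beta>) < real m + 1"
      unfolding m_def by simp_all
    have q: "real q \<le> real n powr \<beta>" "real n powr \<beta> < real q + 1"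
      unfolding q_def by simp_all
    have pw: "0 \<le> real n powr (1 - 2 * \<beta>)" by simp
    have m2: "real n powr (1 - 2 * \<beta>) + real i0 + real n0 + 3 \<le> real m"
      using e n m unfolding c_def by linarith
    then have "n0 + i0 + 2 \<le> m" using pw by linarith
    then have k: "m = k + n0" "i0 \<le> k" "2 \<le> k" unfolding k_def by auto
    have rk: "real m = real k + real n0" using k(1) by simp
    have kr: "real n powr (1 - 2 * \<beta>) \<le> real k" using m2 rk by linarith
    have "real (q * m) \<le> real n powr \<beta> * real n powr (1 - \<beta>)"
      unfolding of_nat_mult using q m by (intro mult_mono) auto
    also have "\<dots> = real n" using n1 by (simp add: powr_add[symmetric])
    finally have qm: "q * m \<le> n" by linarith
    have "(1 - \<theta>) ^ q \<le> exp (- \<theta>) ^ q"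
      using assms exp_ge_add_one_self[of "- \<theta>"] by (intro power_mono) auto
    also have "\<dots> = exp (- \<theta> * real q)" by (simp add: exp_of_nat_mult[symmetric] mult.commute)
    also have "\<dots> \<le> exp (- \<theta> * (real n powr \<beta> - 1))"
    proof -
      have "\<theta> * (real n powr \<beta> - 1) \<le> \<theta> * real q" using q assms by (intro mult_left_mono) auto
      then show ?thesis by simp
    qed
    also have "\<dots> \<le> real n powr (- a)" using e n by simp
    finally show "\<exists>q k. q * (k + n0) \<le> n \<and> i0 \<le> k \<and> 2 \<le> k \<and> real n powr (1 - 2 * \<beta>) \<le> real k \<and>
     (1 - \<theta>) ^ q \<le> real n powr (- a)"
      using qm k kr by (intro exI[of _ q] exI[of _ k]) simp
  qed simp
qed

text \<open>The logarithm is compared with the power \<open>\<beta> / (b + 1)\<close>; the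
  \<open>+ 1\<close> keeps this meaningful for \<open>b = 0\<close>.\<close>

lemma ln_powr_le_powr:
  fixes b \<beta> x :: real
  assumes "0 \<le> b" "0 < \<beta>" "1 \<le> x"
  shows "ln x powr b \<le> ((b + 1) / \<beta>) powr b * x powr \<beta>"
proof -
  have "ln x \<le> x powr (\<beta> / (b + 1)) / (\<beta> / (b + 1))"
    using assms by (intro ln_powr_bound) auto
  then have "ln x powr b \<le> (x powr (\<beta> / (b + 1)) / (\<beta> / (b + 1))) powr b"
    using assms by (intro powr_mono2) auto
  also have "\<dots> = (x powr (\<beta> / (b + 1)) * ((b + 1) / \<beta>)) powr b" by simp
  also have "\<dots> = x powr (\<beta> / (b + 1) * b) * ((b + 1) / \<beta>) powr b"
    using assms by (simp only: powr_mult powr_powr)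
  also have "\<dots> \<le> x powr \<beta> * ((b + 1) / \<beta>) powr b"
  proof (intro mult_right_mono powr_mono)
    show "\<beta> / (b + 1) * b \<le> \<beta>" using assms by (simp add: field_simps)
  qed (use assms in auto)
  finally show ?thesis by (simp add: mult.commute)
qed

text \<open>The exponent is split as
  \<open>\<beta> - a = (1 - a + 2 * \<beta>) + (- 1 - \<beta>)\<close>. The first part is
  nonpositive, so its power is largest at \<open>l = 0\<close>; the second part makes the series
  converge.\<close>

lemma power_tail_le:
  fixes a \<beta> :: real
  assumes \<beta>: "0 < \<beta>" and a: "1 - a + 2 * \<beta> \<le> 0" and k: "1 \<le> k" and E: "0 \<le> E"
  shows "(\<Sum>l. ennreal (E * real (l + k) powr (\<beta> - a))) \<le>
    ennreal (E * (\<Sum>l. real (Suc l) powr (- 1 - \<beta>)) * real k powr (1 - a + 2 * \<beta>))"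
proof -
  have s: "summable (\<lambda>l. real (Suc l) powr (- 1 - \<beta>))"
    using summable_real_powr_iff[of "- 1 - \<beta>"] \<beta> by (subst summable_Suc_iff) simp
  let ?c = "E * real k powr (1 - a + 2 * \<beta>)"
  have "(\<Sum>l. ennreal (E * real (l + k) powr (\<beta> - a))) \<le> (\<Sum>l. ennreal (?c * real (Suc l) powr (- 1 - \<beta>)))"
  proof (intro suminf_le summableI ennreal_leI)
    fix l
    have "real (l + k) powr (\<beta> - a) = real (l + k) powr (1 - a + 2 * \<beta>) * real (l + k) powr (- 1 - \<beta>)"
      by (simp add: powr_add[symmetric])
    also have "\<dots> \<le> real k powr (1 - a + 2 * \<beta>) * real (Suc l) powr (- 1 - \<beta>)"
      using k a \<beta> by (intro mult_mono powr_mono2') auto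
    finally have "E * real (l + k) powr (\<beta> - a) \<le> E * (real k powr (1 - a + 2 * \<beta>) * real (Suc l) powr (- 1 - \<beta>))"
      using E by (intro mult_left_mono) auto
    then show "E * real (l + k) powr (\<beta> - a) \<le> ?c * real (Suc l) powr (- 1 - \<beta>)" by (simp only: mult.assoc)
  qed
  also have "\<dots> = ennreal (\<Sum>l. ?c * real (Suc l) powr (- 1 - \<beta>))"
    using E by (intro suminf_ennreal2 summable_mult s) auto
  also have "(\<Sum>l. ?c * real (Suc l) powr (- 1 - \<beta>)) = ?c * (\<Sum>l. real (Suc l) powr (- 1 - \<beta>))"
    by (rule suminf_mult[OF s])
  finally show ?thesis by (simp only: mult_ac)
qed

text \<open>At scale \<open>n \<ge> Z\<^bsup>1/\<beta>\<^esup>\<close> the tail bound (P4) applies at all levels \<open>l\<close> that matter, since \<open>n \<le> l\<^sup>2\<close>.\<close>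

lemma good_scale:
  fixes n l m :: nat and \<beta> Z :: real and k :: int
  assumes \<beta>: "0 < \<beta>" "\<beta> \<le> 1 / 8" and n: "1 \<le> n" and Z: "Z \<le> real n powr \<beta>" "0 \<le> Z"
    and l: "2 \<le> l" "real n powr (1 - 2 * \<beta>) \<le> real l"
    and k: "\<bar>k\<bar> \<le> 2 * int n + int l" and m: "real m \<le> Z * (1 + \<bar>real_of_int k\<bar>) powr \<beta>"
  shows "m \<le> l"
proof -
  have l1: "1 \<le> real l" using l by simp
  have nl: "real n \<le> real l ^ 2"
  proof -
    have "real n powr (1 / 2) \<le> real n powr (1 - 2 * \<beta>)" using \<beta> n by (intro powr_mono) auto
    then have "real n powr (1 / 2) \<le> real l" using l by simp
    then have "(real n powr (1 / 2)) ^ 2 \<le> real l ^ 2" by (intro power_mono) auto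
    then show ?thesis using n by (simp add: powr_half_sqrt)
  qed
  have "\<bar>real_of_int k\<bar> \<le> 2 * real n + real l" using k by linarith
  moreover have "1 \<le> real l ^ 2" using l1 by (simp add: one_le_power)
  moreover have "real l \<le> real l ^ 2" using l1 by (simp add: power2_eq_square)
  moreover have "4 * real l ^ 2 \<le> real l ^ 2 * real l ^ 2"
    using l power_mono[of 2 "real l" 2] by (intro mult_right_mono) auto
  ultimately have "1 + \<bar>real_of_int k\<bar> \<le> real l ^ 2 * real l ^ 2" using nl by linarith
  then have kl: "1 + \<bar>real_of_int k\<bar> \<le> real l powr 4"
    using l1 by (simp add: powr_numeral power_add[symmetric] flip: power_add)
  have "real m \<le> real n powr \<beta> * (1 + \<bar>real_of_int k\<bar>) powr \<beta>"
    using m Z mult_right_mono[OF Z(1), of "(1 + \<bar>real_of_int k\<bar>) powr \<beta>"] by simp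
  also have "\<dots> \<le> (real l powr 2) powr \<beta> * (real l powr 4) powr \<beta>"
    using nl kl \<beta> l1 by (intro mult_mono powr_mono2) (auto simp: powr_numeral)
  \<comment> \<open>The scale contributes \<open>2 * \<beta>\<close> and the position on the orbit
    \<open>4 * \<beta>\<close>; \<beta> at most 1/8 keeps the sum below 1.\<close>
  also have "\<dots> = real l powr (6 * \<beta>)" by (simp only: powr_powr powr_add[symmetric]) (simp add: algebra_simps)
  also have "\<dots> \<le> real l powr 1" using \<beta> l1 by (intro powr_mono) auto
  finally show ?thesis using l1 by simp
qed

text \<open>Each of the three factors \<open>K\<close> is at most twice
  \<open>n powr (2 * \<beta>)\<close>, and \<open>k\<close> is at least
  \<open>n powr (1 - 2 * \<beta>)\<close>. The resulting exponent is
  \<open>1 - a + \<beta> * (6 + 2 * a) - 4 * \<beta> ^ 2\<close>, which is where the condition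
  \<open>\<beta> * (6 + 2 * a) \<le> \<delta>\<close> comes from.\<close>

lemma main_regime:
  fixes A Ke Ks Z \<beta> a \<delta> S0 p :: real and n k :: nat
  assumes \<beta>: "0 < \<beta>" "\<beta> \<le> 1 / 8" "\<beta> * (6 + 2 * a) \<le> \<delta>" and a: "1 < a" "1 - a + 2 * \<beta> \<le> 0" and A: "0 \<le> A" "0 \<le> S0"
    and K: "0 \<le> Ke" "Ke \<le> Z * (1 + real n) powr \<beta>" "0 \<le> Ks" "Ks \<le> Z * (1 + real n) powr \<beta>"
    and n: "1 \<le> n" and Z: "1 \<le> Z" "Z \<le> real n powr \<beta>" and k: "real n powr (1 - 2 * \<beta>) \<le> real k"
    and p: "0 \<le> p" "p \<le> real n powr (- a)"
  shows "A * Ke * Ks ^ 2 * (S0 * real k powr (1 - a + 2 * \<beta>) + p) \<le> 8 * A * (S0 + 1) * real n powr (1 + \<delta> - a)"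
proof -
  have n1: "1 \<le> real n" using n by simp
  define y where "y = 2 * real n powr (2 * \<beta>)"
  have "Z * (1 + real n) powr \<beta> \<le> real n powr \<beta> * (2 * real n) powr \<beta>"
    using Z \<beta> n1 by (intro mult_mono powr_mono2) auto
  also have "\<dots> = 2 powr \<beta> * real n powr (2 * \<beta>)" by (simp add: powr_mult powr_add[symmetric])
  also have "\<dots> \<le> 2 powr 1 * real n powr (2 * \<beta>)" using \<beta> by (intro mult_right_mono powr_mono) auto
  finally have Zy: "Z * (1 + real n) powr \<beta> \<le> y" unfolding y_def by simp
  have y0: "0 \<le> y" unfolding y_def by simp
  have KK: "Ke * Ks ^ 2 \<le> y * y ^ 2" using K Zy y0 by (intro mult_mono power_mono) auto
  have y3: "y * y ^ 2 = 8 * real n powr (6 * \<beta>)"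
  proof -
    have "y * y ^ 2 = 8 * (real n powr (2 * \<beta>)) ^ 3" unfolding y_def by (simp add: power2_eq_square power3_eq_cube)
    also have "(real n powr (2 * \<beta>)) ^ 3 = real n powr (6 * \<beta>)" using n1 by (simp add: powr_power mult.commute)
    finally show ?thesis .
  qed
  have "0 < real n powr (1 - 2 * \<beta>)" using n1 by simp
  then have "real k powr (1 - a + 2 * \<beta>) \<le> (real n powr (1 - 2 * \<beta>)) powr (1 - a + 2 * \<beta>)"
    using k a by (intro powr_mono2') auto
  then have kp: "S0 * real k powr (1 - a + 2 * \<beta>) \<le> S0 * real n powr ((1 - 2 * \<beta>) * (1 - a + 2 * \<beta>))"
    using A by (intro mult_left_mono) (simp_all add: powr_powr)
  have s0: "0 \<le> S0 * real k powr (1 - a + 2 * \<beta>) + p" using A p by simp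
  have "Ke * Ks ^ 2 * (S0 * real k powr (1 - a + 2 * \<beta>) + p)
    \<le> (8 * real n powr (6 * \<beta>)) * (S0 * real n powr ((1 - 2 * \<beta>) * (1 - a + 2 * \<beta>)) + real n powr (- a))"
    by (rule mult_mono[OF KK[unfolded y3] add_mono[OF kp p(2)] _ s0]) simp
  also have "\<dots> = 8 * (S0 * real n powr (6 * \<beta> + (1 - 2 * \<beta>) * (1 - a + 2 * \<beta>)) + real n powr (6 * \<beta> - a))"
    by (simp only: powr_add distrib_left diff_conv_add_uminus mult_ac)
  also have "\<dots> \<le> 8 * (S0 * real n powr (1 + \<delta> - a) + 1 * real n powr (1 + \<delta> - a))"
  proof -
    have "6 * \<beta> + (1 - 2 * \<beta>) * (1 - a + 2 * \<beta>) = 1 - a + (\<beta> * (6 + 2 * a) - 4 * \<beta> ^ 2)"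
      by (simp add: algebra_simps power2_eq_square)
    then have e1: "6 * \<beta> + (1 - 2 * \<beta>) * (1 - a + 2 * \<beta>) \<le> 1 + \<delta> - a" using \<beta>(3) zero_le_power2[of \<beta>] by linarith
    have "6 * \<beta> \<le> \<beta> * (6 + 2 * a)" using \<beta> a by (simp add: algebra_simps)
    then have e2: "6 * \<beta> - a \<le> 1 + \<delta> - a" using \<beta>(3) by linarith
    have "real n powr (6 * \<beta> + (1 - 2 * \<beta>) * (1 - a + 2 * \<beta>)) \<le> real n powr (1 + \<delta> - a)"
      by (rule powr_mono[OF e1 n1])
    moreover have "real n powr (6 * \<beta> - a) \<le> 1 * real n powr (1 + \<delta> - a)" using powr_mono[OF e2 n1] by simp
    ultimately show ?thesis using A by (intro mult_left_mono add_mono) auto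
  qed
  finally have "A * (Ke * Ks ^ 2 * (S0 * real k powr (1 - a + 2 * \<beta>) + p)) \<le>
    A * (8 * (S0 * real n powr (1 + \<delta> - a) + 1 * real n powr (1 + \<delta> - a)))"
    using A(1) by (rule mult_left_mono)
  then show ?thesis by (simp add: algebra_simps)
qed

text \<open>No decay is available here, so the missing factor \<open>n powr (a - 1)\<close> is
  bounded by \<open>Z powr ((a - 1) / \<beta>)\<close> or by a power of \<open>N\<close>. The 6 in
  the exponent collects three factors \<open>Z\<close> from the bounds on \<open>K\<close> and three
  more from \<open>n powr (3 * \<beta>)\<close>.\<close>

lemma trivial_regime:
  fixes A Ke Ks Z \<beta> a \<delta> :: real and n N :: nat
  assumes \<beta>: "0 < \<beta>" "\<beta> \<le> 1" and a: "1 < a" "0 < \<delta>" and A: "0 \<le> A"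
    and K: "0 \<le> Ke" "Ke \<le> Z * (1 + real n) powr \<beta>" "0 \<le> Ks" "Ks \<le> Z * (1 + real n) powr \<beta>"
    and n: "1 \<le> n" and Z: "1 \<le> Z" and regime: "real n powr \<beta> < Z \<or> n \<le> N" and N: "1 \<le> N"
  shows "A * Ke * Ks ^ 2 \<le> Z powr (6 + (a - 1) / \<beta>) * (A * (8 + (1 + real N) powr (3 * \<beta>) * real N powr (a - 1))) * real n powr (1 + \<delta> - a)"
proof -
  have n1: "1 \<le> real n" using n by simp
  define y where "y = Z * (1 + real n) powr \<beta>"
  have y0: "0 \<le> y" unfolding y_def using Z by simp
  have KK: "Ke * Ks ^ 2 \<le> y * y ^ 2" unfolding y_def using K Z by (intro mult_mono power_mono) auto
  have y3: "y * y ^ 2 = Z powr 3 * (1 + real n) powr (3 * \<beta>)"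
  proof -
    have "y * y ^ 2 = Z ^ 3 * ((1 + real n) powr \<beta>) ^ 3" unfolding y_def by (simp add: power2_eq_square power3_eq_cube)
    then show ?thesis using Z by (simp add: powr_power powr_numeral mult.commute)
  qed
  have "real n powr (1 - a) \<le> real n powr (1 + \<delta> - a)" using a n1 by (intro powr_mono) auto
  define r where "r = 6 + (a - 1) / \<beta>"
  have r0: "0 \<le> (a - 1) / \<beta>" using a \<beta> by simp
  have r6: "6 \<le> r" unfolding r_def using r0 by simp
  have na: "real n powr (a - 1) * real n powr (1 + \<delta> - a) \<ge> 1"
  proof -
    have "real n powr (a - 1) * real n powr (1 + \<delta> - a) = real n powr \<delta>" by (simp add: powr_add[symmetric])
    then show ?thesis using a n1 by (simp add: ge_one_powr_ge_zero)
  qed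
  have main: "y * y ^ 2 \<le> Z powr r * (8 + (1 + real N) powr (3 * \<beta>) * real N powr (a - 1)) * real n powr (1 + \<delta> - a)"
    using regime
  proof
    assume nZ: "real n powr \<beta> < Z"
    have "(1 + real n) powr (3 * \<beta>) \<le> (2 * real n) powr (3 * \<beta>)" using \<beta> n1 by (intro powr_mono2) auto
    also have "\<dots> = 2 powr (3 * \<beta>) * (real n powr \<beta>) powr 3" by (simp add: powr_mult powr_powr mult.commute)
    also have "\<dots> \<le> 2 powr 3 * Z powr 3" using \<beta> nZ by (intro mult_mono powr_mono powr_mono2) auto
    finally have "y * y ^ 2 \<le> Z powr 3 * (2 powr 3 * Z powr 3)" unfolding y3 by (intro mult_left_mono) auto
    also have "\<dots> = 8 * Z powr 6" by (simp add: powr_add[symmetric])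
    also have "\<dots> \<le> 8 * (Z powr 6 * (real n powr (a - 1) * real n powr (1 + \<delta> - a)))"
      using mult_left_mono[OF na, of "Z powr 6"] by simp
    also have "\<dots> \<le> 8 * (Z powr 6 * (Z powr ((a - 1) / \<beta>) * real n powr (1 + \<delta> - a)))"
    proof -
      have "real n powr (a - 1) = (real n powr \<beta>) powr ((a - 1) / \<beta>)" using \<beta> by (simp add: powr_powr)
      also have "\<dots> \<le> Z powr ((a - 1) / \<beta>)" using nZ r0 by (intro powr_mono2) auto
      finally show ?thesis by (intro mult_left_mono mult_right_mono) auto
    qed
    also have "\<dots> = Z powr r * 8 * real n powr (1 + \<delta> - a)" unfolding r_def by (simp add: powr_add)
    also have "\<dots> \<le> Z powr r * (8 + (1 + real N) powr (3 * \<beta>) * real N powr (a - 1)) * real n powr (1 + \<delta> - a)"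
      by (intro mult_right_mono mult_left_mono) auto
    finally show ?thesis .
  next
    assume nN: "n \<le> N"
    have "y * y ^ 2 \<le> Z powr r * (1 + real N) powr (3 * \<beta>)"
      unfolding y3 using Z nN \<beta> r6 by (intro mult_mono powr_mono powr_mono2) auto
    also have "\<dots> \<le> Z powr r * (1 + real N) powr (3 * \<beta>) * (real n powr (a - 1) * real n powr (1 + \<delta> - a))"
      using mult_left_mono[OF na, of "Z powr r * (1 + real N) powr (3 * \<beta>)"] by simp
    also have "\<dots> \<le> Z powr r * (1 + real N) powr (3 * \<beta>) * (real N powr (a - 1) * real n powr (1 + \<delta> - a))"
      using nN a by (intro mult_left_mono mult_right_mono powr_mono2) auto
    also have "\<dots> = Z powr r * ((1 + real N) powr (3 * \<beta>) * real N powr (a - 1)) * real n powr (1 + \<delta> - a)"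
      by (simp only: mult.assoc)
    also have "\<dots> \<le> Z powr r * (8 + (1 + real N) powr (3 * \<beta>) * real N powr (a - 1)) * real n powr (1 + \<delta> - a)"
      by (intro mult_right_mono mult_left_mono) auto
    finally show ?thesis .
  qed
  have "A * (Ke * Ks ^ 2) \<le> A * (Z powr r * (8 + (1 + real N) powr (3 * \<beta>) * real N powr (a - 1)) * real n powr (1 + \<delta> - a))"
    using order_trans[OF KK main] A by (rule mult_left_mono)
  then show ?thesis unfolding r_def by (simp only: mult_ac)
qed

section \<open>A renewal equation with coupling\<close>

text \<open>The least positive difference \<open>d\<close> of two elements divides every element, so
  it is 1. Two consecutive elements \<open>s\<close> and \<open>s + 1\<close> then generate
  everything from \<open>s * s\<close> on.\<close>

lemma numerical_semigroup_cofinite: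
  fixes S :: "nat set"
  assumes add: "\<And>x y. x \<in> S \<Longrightarrow> y \<in> S \<Longrightarrow> x + y \<in> S" and gcd: "Gcd S = 1"
  shows "\<exists>n0. \<forall>n\<ge>n0. n \<in> S \<or> n = 0"
proof -
  define P where "P d \<longleftrightarrow> 0 < d \<and> (\<exists>s\<in>insert 0 S. s + d \<in> S)" for d
  obtain s0 where s0: "s0 \<in> S" "0 < s0"
  proof -
    have "\<not> S \<subseteq> {0}"
      using gcd by (metis Gcd_0_iff zero_neq_one)
    then show ?thesis using that by auto
  qed
  have mult: "m * x \<in> insert 0 S" if "x \<in> insert 0 S" for m x
    by (induction m) (use that add in auto)
  have add0: "x + y \<in> insert 0 S" if "x \<in> insert 0 S" "y \<in> insert 0 S" for x y
    using that add by auto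
  have "P s0" unfolding P_def using s0 by auto
  define d where "d = (LEAST d. P d)"
  have Pd: "P d" unfolding d_def using \<open>P s0\<close> by (rule LeastI)
  have dmin: "d \<le> x" if "P x" for x unfolding d_def using that by (rule Least_le)
  obtain s where s: "s \<in> insert 0 S" "s + d \<in> S" and d0: "0 < d" using Pd unfolding P_def by blast
  have "d dvd x" if x: "x \<in> S" for x
  proof (rule ccontr)
    assume nd: "\<not> d dvd x"
    define q where "q = x div d"
    define r where "r = x mod d"
    have xr: "x = q * d + r" unfolding q_def r_def by simp
    have r0: "0 < r" "r < d" using nd d0 unfolding r_def by (auto simp: dvd_eq_mod_eq_0)
    have a: "q * (s + d) \<in> insert 0 S" using s(2) by (intro mult) auto
    have b: "q * s \<in> insert 0 S" using s by (intro mult)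
    have c: "q * s + x \<in> S" using b x add by auto
    \<comment> \<open>Both \<open>q * s + x\<close> and \<open>q * (s + d)\<close> are available,
      and they differ by the remainder \<open>r < d\<close>, against the minimality of
      \<open>d\<close>.\<close>
    have "q * s + x = q * (s + d) + r" using xr by (simp add: algebra_simps)
    then have "P r" unfolding P_def using a c r0 by (intro conjI bexI[of _ "q * (s + d)"]) auto
    then show False using dmin[of r] r0 by simp
  qed
  then have "d dvd Gcd S" by (rule Gcd_greatest)
  then have d1: "d = 1" using gcd by simp
  have s1: "s + 1 \<in> S" using s d1 by simp
  show ?thesis
  proof (intro exI[of _ "s * s"] allI impI)
    fix n assume n: "s * s \<le> n"
    have "n \<in> insert 0 S"
    proof (cases "s = 0")
      case True
      then show ?thesis using mult[of 1 n] s1 by simp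
    next
      case False
      define q where "q = n div s"
      define r where "r = n mod s"
      have nr: "n = q * s + r" "r < s" unfolding q_def r_def using False by auto
      have "s \<le> q" unfolding q_def using n False
        by (metis div_le_mono nonzero_mult_div_cancel_left)
      \<comment> \<open>The remainder is less than \<open>s\<close> and hence than the quotient, so
        \<open>r\<close> of the \<open>q\<close> copies of \<open>s\<close> can be raised to
        \<open>s + 1\<close>.\<close>
      then obtain p where p: "q = r + p" using nr(2) by (metis le_add_diff_inverse less_imp_le_nat le_trans)
      have "n = r * (s + 1) + p * s" using nr p by (simp add: algebra_simps)
      then show ?thesis using add0[OF mult[of "s+1" r] mult[of s p]] s s1 by auto
    qed
    then show "n \<in> S \<or> n = 0" by auto
  qed
qed

lemma suminf_split_first_ennreal: "(\<Sum>i. f i :: ennreal) = f 0 + (\<Sum>i. f (Suc i))"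
  using suminf_offset[of f 1] by (simp add: summableI)

lemma suminf_add_ennreal: "(\<Sum>i. f i + g i :: ennreal) = (\<Sum>i. f i) + (\<Sum>i. g i)"
  by (intro suminf_add[symmetric] summableI)

lemma le_exp_mult_mono:
  assumes "x \<le> ennreal (exp r) * y" "r \<le> r'"
  shows "x \<le> ennreal (exp r') * y"
  by (rule order_trans[OF assms(1)]) (auto intro!: mult_right_mono ennreal_leI simp: assms(2))

lemma less_infinity_ennrealD: "(x :: ennreal) < \<infinity> \<Longrightarrow> \<exists>r\<ge>0. x = ennreal r"
  by (cases x) auto

lemma ennreal_exp_mult_assoc:
  "ennreal (exp r) * (ennreal (exp r') * y) = ennreal (exp (r' + r)) * y"
  by (simp add: exp_add ennreal_mult mult_ac)

text \<open>Convexity of the exponential gives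
  \<open>exp ((1 - e) * r) \<le> (1 - e) * exp r + e\<close>; the term \<open>e\<close> is exactly
  what pays for subtracting \<open>c \<le> e * y\<close> on both sides.\<close>

lemma exp_sink_convex:
  fixes e r x y c :: real
  assumes "0 < e" "e < 1" "0 \<le> r" "x \<le> exp ((1 - e) * r) * y" "c \<le> e * y" "0 \<le> c"
  shows "x - c \<le> exp r * (y - c)"
proof -
  have y: "0 \<le> y" using assms by (smt (verit) mult_pos_neg)
  have "exp ((1 - e) * r + e * 0) \<le> (1 - e) * exp r + e * exp 0"
    using convex_onD[OF exp_convex, of "1 - e" 0 r] assms by (simp add: algebra_simps)
  then have "exp ((1 - e) * r) * y \<le> ((1 - e) * exp r + e) * y"
    using y by (intro mult_right_mono) auto
  moreover have "(exp r - 1) * c \<le> (exp r - 1) * (e * y)"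
    using assms by (intro mult_left_mono) auto
  ultimately show ?thesis using assms(4) by (simp add: algebra_simps)
qed

text \<open>
  \<open>M\<close> is the base, \<open>R k\<close>, \<open>G k\<close> and \<open>L k j\<close> are the return time, the return map and the transfer operator
  of the branches with return time \<open>j\<close> for the fibre at time \<open>k\<close> of a fixed orbit; \<open>d k x y\<close> stands for
  \<open>\<gamma>\<close> to the power of the separation time. A state \<open>s\<close> at time \<open>t\<close> lists the densities on the levels: \<open>s l\<close> is
  a function on the base at time \<open>t - l\<close>, of which only the restriction to \<open>{l < R (t - l)}\<close> matters.
\<close>

definition couple_rate :: "real \<Rightarrow> real \<Rightarrow> real \<Rightarrow> real \<Rightarrow> nat \<Rightarrow> nat \<Rightarrow> real" where
  "couple_rate Mt Hc e \<epsilon> n0 i0 = (let H = (1 - e) * Hc; \<eta> = exp (- H) * \<epsilon> in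
     e * exp (- H) * (\<eta> ^ (n0 + i0) / (real i0 * exp (exp H / \<eta> * Mt))))"

locale renewal_tower = prob_space M for M :: "'x measure" +
  fixes R :: "int \<Rightarrow> 'x \<Rightarrow> nat" and G :: "int \<Rightarrow> 'x \<Rightarrow> 'x" and d :: "int \<Rightarrow> 'x \<Rightarrow> 'x \<Rightarrow> real"
    and same :: "int \<Rightarrow> 'x \<Rightarrow> 'x \<Rightarrow> bool" and L :: "int \<Rightarrow> nat \<Rightarrow> ('x \<Rightarrow> ennreal) \<Rightarrow> 'x \<Rightarrow> ennreal"
    and \<gamma> D Mt Hc e \<epsilon> :: real and I :: "nat set"
    and n0 i0 :: nat
  assumes R_meas[measurable]: "R k \<in> measurable M (count_space UNIV)"
    and G_meas[measurable]: "G k \<in> measurable M M"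
    and R_pos: "x \<in> space M \<Longrightarrow> 0 < R k x"
    and d_range: "0 \<le> d k x y" "d k x y \<le> 1"
    and L_meas: "b \<in> borel_measurable M \<Longrightarrow> L k j b \<in> borel_measurable M"
    and L_dual: "f \<in> borel_measurable M \<Longrightarrow> b \<in> borel_measurable M \<Longrightarrow>
       (\<integral>\<^sup>+y. f y * L k j b y \<partial>M) = (\<integral>\<^sup>+x. f (G k x) * b x * indicator {x. R k x = j} x \<partial>M)"
    and L_reg: "\<And>H b k j y y'. 0 \<le> H \<Longrightarrow>
       (\<And>x x'. x \<in> space M \<Longrightarrow> x' \<in> space M \<Longrightarrow> same k x x' \<Longrightarrow> b x \<le> ennreal (exp (H * d k x x')) * b x') \<Longrightarrow>
       y \<in> space M \<Longrightarrow> y' \<in> space M \<Longrightarrow>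
       L k j b y \<le> ennreal (exp ((\<gamma> * H + D) * d (k + int j) y y')) * L k j b y'"
    and mass_bound: "(\<Sum>l. emeasure M {x \<in> space M. l < R (k - int l) x}) \<le> ennreal Mt"
    and I_aperiodic: "n0 \<le> n \<Longrightarrow> \<exists>xs. set xs \<subseteq> I \<and> sum_list xs = n" and i0: "i0 \<in> I"
    and I_mass: "i \<in> I \<Longrightarrow> ennreal \<epsilon> \<le> emeasure M {x \<in> space M. R k x = i}"
    and params: "0 < e" "e < 1" "0 \<le> Hc" "\<gamma> * Hc + D \<le> (1 - e) * Hc" "0 < \<epsilon>" "0 \<le> Mt"
begin

section \<open>Regular densities, their evolution, and the dual action on observables\<close>

abbreviation "H \<equiv> (1 - e) * Hc"

text \<open>Two strengths of log-Hoelder regularity: \<open>cellreg\<close> compares points of one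
  cell only and is all that survives a subtraction; \<open>basereg\<close>, with the better constant
  and on the whole base, is what a return produces.\<close>

definition cellreg :: "int \<Rightarrow> ('x \<Rightarrow> ennreal) \<Rightarrow> bool" where
  "cellreg k b \<longleftrightarrow> (\<forall>x\<in>space M. \<forall>x'\<in>space M. same k x x' \<longrightarrow> b x \<le> ennreal (exp (Hc * d k x x')) * b x')"

definition basereg :: "int \<Rightarrow> ('x \<Rightarrow> ennreal) \<Rightarrow> bool" where
  "basereg k b \<longleftrightarrow> (\<forall>x\<in>space M. \<forall>x'\<in>space M. b x \<le> ennreal (exp (H * d k x x')) * b x')"

text \<open>The integral of the observable \<phi> against the state \<open>s\<close>. The indicator
  discards values at points that have already left the level, so neither \<phi> nor \<open>s\<close>
  need be meaningful there.\<close>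

definition levint :: "int \<Rightarrow> (nat \<Rightarrow> 'x \<Rightarrow> ennreal) \<Rightarrow> (nat \<Rightarrow> 'x \<Rightarrow> ennreal) \<Rightarrow> ennreal" where
  "levint t s \<phi> = (\<Sum>l. \<integral>\<^sup>+x. \<phi> l x * s l x * indicator {x. l < R (t - int l) x} x \<partial>M)"

text \<open>Mass on level \<open>l\<close> at time \<open>t\<close> left the base at time
  \<open>t - l\<close>; it is on the base at time \<open>t + 1\<close> exactly if its return time is
  \<open>l + 1\<close>.\<close>

definition incoming :: "int \<Rightarrow> (nat \<Rightarrow> 'x \<Rightarrow> ennreal) \<Rightarrow> 'x \<Rightarrow> ennreal" where
  "incoming t s = (\<lambda>y. \<Sum>l. L (t - int l) (Suc l) (s l) y)"

definition step :: "int \<Rightarrow> (nat \<Rightarrow> 'x \<Rightarrow> ennreal) \<Rightarrow> nat \<Rightarrow> 'x \<Rightarrow> ennreal" where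
  "step t s = (\<lambda>l. case l of 0 \<Rightarrow> incoming t s | Suc l' \<Rightarrow> s l')"

primrec evol :: "int \<Rightarrow> nat \<Rightarrow> (nat \<Rightarrow> 'x \<Rightarrow> ennreal) \<Rightarrow> nat \<Rightarrow> 'x \<Rightarrow> ennreal" where
  "evol t 0 s = s"
| "evol t (Suc n) s = step (t + int n) (evol t n s)"

text \<open>The composition of an observable with the tower map, level by level. Above the tower it
  takes the value of the second branch, which \<open>levint\<close> ignores.\<close>

definition koop :: "int \<Rightarrow> (nat \<Rightarrow> 'x \<Rightarrow> ennreal) \<Rightarrow> nat \<Rightarrow> 'x \<Rightarrow> ennreal" where
  "koop t \<phi> = (\<lambda>l x. if Suc l < R (t - int l) x then \<phi> (Suc l) x else \<phi> 0 (G (t - int l) x))"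

primrec koopn :: "int \<Rightarrow> nat \<Rightarrow> (nat \<Rightarrow> 'x \<Rightarrow> ennreal) \<Rightarrow> nat \<Rightarrow> 'x \<Rightarrow> ennreal" where
  "koopn t 0 \<phi> = \<phi>"
| "koopn t (Suc n) \<phi> = koop t (koopn (t + 1) n \<phi>)"

lemma step_simps[simp]: "step t s 0 = incoming t s" "step t s (Suc l) = s l"
  by (simp_all add: step_def)

lemma incoming_meas: "(\<And>l. s l \<in> borel_measurable M) \<Longrightarrow> incoming t s \<in> borel_measurable M"
  unfolding incoming_def using L_meas by measurable

lemma step_meas: "(\<And>l. s l \<in> borel_measurable M) \<Longrightarrow> step t s l \<in> borel_measurable M"
  by (cases l) (auto intro: incoming_meas)

lemma evol_meas: "(\<And>l. s l \<in> borel_measurable M) \<Longrightarrow> evol t n s l \<in> borel_measurable M"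
  by (induction n arbitrary: l) (auto intro: step_meas)

lemma koop_meas: "(\<And>l. \<phi> l \<in> borel_measurable M) \<Longrightarrow> koop t \<phi> l \<in> borel_measurable M"
proof -
  assume [measurable]: "\<And>l. \<phi> l \<in> borel_measurable M"
  show ?thesis unfolding koop_def by measurable
qed

lemma koopn_meas: "(\<And>l. \<phi> l \<in> borel_measurable M) \<Longrightarrow> koopn t n \<phi> l \<in> borel_measurable M"
  by (induction n arbitrary: t l) (auto intro: koop_meas)

lemma koop_le: "(\<And>l x. x \<in> space M \<Longrightarrow> \<phi> l x \<le> c) \<Longrightarrow> x \<in> space M \<Longrightarrow> koop t \<phi> l x \<le> c"
  unfolding koop_def using measurable_space[OF G_meas] by auto

lemma koopn_le: "(\<And>l x. x \<in> space M \<Longrightarrow> \<phi> l x \<le> c) \<Longrightarrow> x \<in> space M \<Longrightarrow> koopn t n \<phi> l x \<le> c"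
  by (induction n arbitrary: t l x) (auto intro: koop_le)

lemma koopn_add: "koopn t (m + n) \<phi> = koopn t m (koopn (t + int m) n \<phi>)"
  by (induction m arbitrary: t) (simp_all add: algebra_simps)

lemma evol_add: "evol t (m + n) s = evol (t + int m) n (evol t m s)"
  by (induction n) (simp_all add: algebra_simps)

lemma nn_integral_incoming:
  assumes [measurable]: "f \<in> borel_measurable M" "\<And>l. s l \<in> borel_measurable M"
  shows "(\<integral>\<^sup>+y. f y * incoming t s y \<partial>M) =
     (\<Sum>l. \<integral>\<^sup>+x. f (G (t - int l) x) * s l x * indicator {x. R (t - int l) x = Suc l} x \<partial>M)"
proof -
  have [measurable]: "L k j (s l) \<in> borel_measurable M" for k j l by (intro L_meas) simp
  have "(\<integral>\<^sup>+y. f y * incoming t s y \<partial>M) = (\<integral>\<^sup>+y. (\<Sum>l. f y * L (t - int l) (Suc l) (s l) y) \<partial>M)"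
    unfolding incoming_def by simp
  also have "\<dots> = (\<Sum>l. \<integral>\<^sup>+y. f y * L (t - int l) (Suc l) (s l) y \<partial>M)"
    by (intro nn_integral_suminf) measurable
  finally show ?thesis by (simp add: L_dual)
qed

text \<open>Each level splits into points that climb and points that return. The climbing parts are
  the levels from 1 on at time \<open>t + 1\<close>; the returning parts add up to the base level by
  duality of \<open>L\<close>.\<close>

lemma levint_step:
  assumes [measurable]: "\<And>l. \<phi> l \<in> borel_measurable M" "\<And>l. s l \<in> borel_measurable M"
  shows "levint t s (koop t \<phi>) = levint (t + 1) (step t s) \<phi>"
proof -
  define a where "a l = (\<integral>\<^sup>+x. \<phi> (Suc l) x * s l x * indicator {x. Suc l < R (t - int l) x} x \<partial>M)" for l
  define b where "b l = (\<integral>\<^sup>+x. \<phi> 0 (G (t - int l) x) * s l x * indicator {x. R (t - int l) x = Suc l} x \<partial>M)" for l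
  have "(\<integral>\<^sup>+x. koop t \<phi> l x * s l x * indicator {x. l < R (t - int l) x} x \<partial>M) = a l + b l" for l
  proof -
    have "(\<integral>\<^sup>+x. koop t \<phi> l x * s l x * indicator {x. l < R (t - int l) x} x \<partial>M) =
      (\<integral>\<^sup>+x. \<phi> (Suc l) x * s l x * indicator {x. Suc l < R (t - int l) x} x
         + \<phi> 0 (G (t - int l) x) * s l x * indicator {x. R (t - int l) x = Suc l} x \<partial>M)"
      by (intro nn_integral_cong) (auto simp: koop_def indicator_def)
    also have "\<dots> = a l + b l" unfolding a_def b_def
      by (rule nn_integral_add) measurable
    finally show ?thesis .
  qed
  then have "levint t s (koop t \<phi>) = (\<Sum>l. a l) + (\<Sum>l. b l)"
    unfolding levint_def by (simp add: suminf_add_ennreal)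
  also have "(\<Sum>l. b l) = (\<integral>\<^sup>+y. \<phi> 0 y * incoming t s y \<partial>M)"
    unfolding b_def by (subst nn_integral_incoming) auto
  also have "\<dots> = (\<integral>\<^sup>+x. \<phi> 0 x * step t s 0 x * indicator {x. 0 < R (t + 1 - int 0) x} x \<partial>M)"
    by (intro nn_integral_cong) (auto simp: R_pos)
  also have "(\<Sum>l. a l) = (\<Sum>l. \<integral>\<^sup>+x. \<phi> (Suc l) x * step t s (Suc l) x * indicator {x. Suc l < R (t + 1 - int (Suc l)) x} x \<partial>M)"
    unfolding a_def by simp
  finally show ?thesis
    unfolding levint_def suminf_split_first_ennreal[of "\<lambda>l. \<integral>\<^sup>+x. \<phi> l x * step t s l x * indicator {x. l < R (t + 1 - int l) x} x \<partial>M"]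
    by (simp only: add.commute)
qed

lemma levint_evol:
  assumes "\<And>l. \<phi> l \<in> borel_measurable M" "\<And>l. s l \<in> borel_measurable M"
  shows "levint t s (koopn t n \<phi>) = levint (t + int n) (evol t n s) \<phi>"
  using assms
proof (induction n arbitrary: \<phi>)
  case (Suc n)
  have "koopn t (Suc n) \<phi> = koopn t n (koop (t + int n) \<phi>)"
    using koopn_add[of t n 1 \<phi>] by simp
  then have "levint t s (koopn t (Suc n) \<phi>) = levint (t + int n) (evol t n s) (koop (t + int n) \<phi>)"
    using Suc by (simp add: koop_meas)
  also have "\<dots> = levint (t + int n + 1) (evol t (Suc n) s) \<phi>"
    using Suc.prems by (simp add: levint_step evol_meas)
  finally show ?case by (simp add: algebra_simps)
qed simp

abbreviation mass :: "int \<Rightarrow> (nat \<Rightarrow> 'x \<Rightarrow> ennreal) \<Rightarrow> ennreal" where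
  "mass t s \<equiv> levint t s (\<lambda>_ _. 1)"

lemma koopn_one: "koopn t n (\<lambda>_ _. 1) = (\<lambda>_ _. 1)"
  by (induction n arbitrary: t) (auto simp: koop_def)

lemma mass_evol: "(\<And>l. s l \<in> borel_measurable M) \<Longrightarrow> mass (t + int n) (evol t n s) = mass t s"
  using levint_evol[of "\<lambda>_ _. 1" s t n] by (simp add: koopn_one)

lemma levint_mono:
  assumes "\<And>l x. x \<in> space M \<Longrightarrow> \<phi> l x \<le> \<psi> l x"
  shows "levint t s \<phi> \<le> levint t s \<psi>"
  unfolding levint_def by (intro suminf_le nn_integral_mono mult_right_mono assms) (auto simp: summableI)

lemma levint_add:
  assumes [measurable]: "\<And>l. \<phi> l \<in> borel_measurable M" "\<And>l. \<psi> l \<in> borel_measurable M" "\<And>l. s l \<in> borel_measurable M"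
  shows "levint t s (\<lambda>l x. \<phi> l x + \<psi> l x) = levint t s \<phi> + levint t s \<psi>"
  unfolding levint_def suminf_add_ennreal[symmetric]
  by (subst nn_integral_add[symmetric]) (auto simp: distrib_right)

lemma levint_le_mass:
  assumes [measurable]: "\<And>l. s l \<in> borel_measurable M" and "\<And>l x. x \<in> space M \<Longrightarrow> \<phi> l x \<le> c"
  shows "levint t s \<phi> \<le> c * mass t s"
proof -
  have "levint t s \<phi> \<le> levint t s (\<lambda>_ _. c)" using assms by (intro levint_mono)
  also have "\<dots> = c * mass t s"
    unfolding levint_def ennreal_suminf_cmult[symmetric]
    by (subst nn_integral_cmult[symmetric]) (auto simp: mult.assoc)
  finally show ?thesis .
qed

lemma basereg_cellreg: "basereg k b \<Longrightarrow> cellreg k b"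
proof -
  assume b: "basereg k b"
  have "H * d k x y \<le> Hc * d k x y" for x y
    using params d_range[of k x y] by (intro mult_right_mono mult_left_le_one_le) auto
  then show ?thesis using b unfolding cellreg_def basereg_def
    by (blast intro: le_exp_mult_mono)
qed

text \<open>A branch that starts at time \<open>t - l\<close> with return time \<open>l + 1\<close>
  lands at time \<open>t + 1\<close> whatever \<open>l\<close> is. So all summands satisfy the
  estimate with the same weight \<open>d (t + 1)\<close>, and it passes to the sum.\<close>

lemma incoming_basereg:
  assumes "\<And>l. cellreg (t - int l) (s l)"
  shows "basereg (t + 1) (incoming t s)"
  unfolding basereg_def
proof (intro ballI)
  fix y y' assume y: "y \<in> space M" "y' \<in> space M"
  have "L (t - int l) (Suc l) (s l) y \<le> ennreal (exp (H * d (t + 1) y y')) * L (t - int l) (Suc l) (s l) y'" for l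
  proof -
    have "L (t - int l) (Suc l) (s l) y \<le>
      ennreal (exp ((\<gamma> * Hc + D) * d (t - int l + int (Suc l)) y y')) * L (t - int l) (Suc l) (s l) y'"
      using assms[of l] params y unfolding cellreg_def by (intro L_reg) auto
    moreover have "t - int l + int (Suc l) = t + 1" by simp
    moreover have "(\<gamma> * Hc + D) * d (t + 1) y y' \<le> H * d (t + 1) y y'"
      using params d_range by (intro mult_right_mono) auto
    ultimately show ?thesis
      using le_exp_mult_mono by simp
  qed
  then show "incoming t s y \<le> ennreal (exp (H * d (t + 1) y y')) * incoming t s y'"
    unfolding incoming_def ennreal_suminf_cmult[symmetric] by (intro suminf_le) (auto simp: summableI)
qed

lemma step_cellreg:
  assumes "\<And>l. cellreg (t - int l) (s l)"
  shows "cellreg (t + 1 - int l) (step t s l)"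
  using assms by (cases l) (auto intro: basereg_cellreg incoming_basereg)

lemma evol_cellreg:
  assumes "\<And>l. cellreg (t - int l) (s l)"
  shows "cellreg (t + int n - int l) (evol t n s l)"
proof (induction n arbitrary: l)
  case (Suc n)
  show ?case using step_cellreg[OF Suc, of l] by (simp add: algebra_simps)
qed (use assms in simp)

lemma evol_basereg:
  assumes "\<And>l. cellreg (t - int l) (s l)" and "0 < n"
  shows "basereg (t + int n) (evol t n s 0)"
proof -
  obtain m where n: "n = Suc m" using assms(2) by (cases n) auto
  show ?thesis using incoming_basereg[OF evol_cellreg[of t s m], OF assms(1)] n by (simp add: algebra_simps)
qed

lemma expH_mono: "H * d k x y \<le> H"
  using params d_range[of k x y] by (intro mult_left_le) auto

text \<open>The weights \<open>d\<close> are at most 1, so a regular base density varies at most by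
  the factor \<open>exp H\<close>. As \<open>M\<close> is a probability, it is comparable with its
  own mass at every point.\<close>

lemma basereg_global:
  assumes "basereg k b" "x \<in> space M" "y \<in> space M"
  shows "b x \<le> ennreal (exp H) * b y"
  using assms unfolding basereg_def by (blast intro: le_exp_mult_mono[OF _ expH_mono])

lemma basereg_upper:
  assumes "basereg k b" "x \<in> space M" and [measurable]: "b \<in> borel_measurable M"
  shows "b x \<le> ennreal (exp H) * (\<integral>\<^sup>+y. b y \<partial>M)"
proof -
  have "b x = (\<integral>\<^sup>+y. b x \<partial>M)" by (simp add: emeasure_space_1)
  also have "\<dots> \<le> (\<integral>\<^sup>+y. ennreal (exp H) * b y \<partial>M)"
    using assms by (intro nn_integral_mono basereg_global) auto
  finally show ?thesis by (simp add: nn_integral_cmult)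
qed

lemma basereg_lower:
  assumes "basereg k b" "x \<in> space M"
  shows "(\<integral>\<^sup>+y. b y \<partial>M) \<le> ennreal (exp H) * b x"
proof -
  have "(\<integral>\<^sup>+y. b y \<partial>M) \<le> (\<integral>\<^sup>+y. ennreal (exp H) * b x \<partial>M)"
    using assms by (intro nn_integral_mono basereg_global) auto
  then show ?thesis by (simp add: emeasure_space_1)
qed

lemma basereg_set_upper:
  assumes "basereg k b" and [measurable]: "b \<in> borel_measurable M" "A \<in> sets M"
  shows "(\<integral>\<^sup>+y. b y * indicator A y \<partial>M) \<le> ennreal (exp H) * emeasure M A * (\<integral>\<^sup>+y. b y \<partial>M)"
proof -
  have "(\<integral>\<^sup>+y. b y * indicator A y \<partial>M) \<le> (\<integral>\<^sup>+y. ennreal (exp H) * (\<integral>\<^sup>+y. b y \<partial>M) * indicator A y \<partial>M)"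
    using assms by (intro nn_integral_mono mult_right_mono basereg_upper) auto
  also have "\<dots> = ennreal (exp H) * (\<integral>\<^sup>+y. b y \<partial>M) * emeasure M A"
    by (simp add: nn_integral_cmult)
  finally show ?thesis by (simp add: mult_ac)
qed

lemma basereg_set_lower:
  assumes "basereg k b" and [measurable]: "b \<in> borel_measurable M" "A \<in> sets M"
  shows "emeasure M A * (\<integral>\<^sup>+y. b y \<partial>M) \<le> ennreal (exp H) * (\<integral>\<^sup>+y. b y * indicator A y \<partial>M)"
proof -
  have "emeasure M A * (\<integral>\<^sup>+y. b y \<partial>M) = (\<integral>\<^sup>+x. (\<integral>\<^sup>+y. b y \<partial>M) * indicator A x \<partial>M)"
    by (subst nn_integral_cmult_indicator) (simp_all add: mult.commute)
  also have "\<dots> \<le> (\<integral>\<^sup>+x. ennreal (exp H) * b x * indicator A x \<partial>M)"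
    using assms by (intro nn_integral_mono mult_right_mono basereg_lower) auto
  finally show ?thesis by (simp add: nn_integral_cmult mult.assoc)
qed

section \<open>Lower bound for the mass that is on the base at a given time\<close>

definition \<eta> :: real where "\<eta> = exp (- H) * \<epsilon>"

text \<open>The mass whose next visit to the base happens at one of the times \<open>t + 1, \<dots>, t + k\<close>.\<close>

definition lands :: "int \<Rightarrow> nat \<Rightarrow> (nat \<Rightarrow> 'x \<Rightarrow> ennreal) \<Rightarrow> ennreal" where
  "lands t k s = levint t s (\<lambda>l. indicator {x. R (t - int l) x \<le> l + k})"

abbreviation base_mass :: "(nat \<Rightarrow> 'x \<Rightarrow> ennreal) \<Rightarrow> ennreal" where
  "base_mass s \<equiv> \<integral>\<^sup>+x. s 0 x \<partial>M"

lemma H_nonneg: "0 \<le> H"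
  using params by simp

lemma \<epsilon>_le_1: "\<epsilon> \<le> 1"
  using order_trans[OF I_mass[OF i0, of 0] measure_le_1] by simp

text \<open>\<eta> is the share of a regular base density that is certain to have a prescribed
  return time in \<open>I\<close>: the set has measure at least \<epsilon>, and passing from measure
  to density costs \<open>exp (- H)\<close>.\<close>

lemma \<eta>_pos: "0 < \<eta>" and \<eta>_le_1: "\<eta> \<le> 1"
proof -
  show "0 < \<eta>" unfolding \<eta>_def using params by simp
  have "exp (-H) * \<epsilon> \<le> 1 * 1" using H_nonneg \<epsilon>_le_1 params by (intro mult_mono) auto
  then show "\<eta> \<le> 1" unfolding \<eta>_def by simp
qed

lemma I_pos: "i \<in> I \<Longrightarrow> 0 < i"
proof (rule ccontr)
  assume i: "i \<in> I" "\<not> 0 < i"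
  have "emeasure M {x \<in> space M. R 0 x = 0} = emeasure M {}"
    by (rule arg_cong[where f="emeasure M"]) (auto dest: R_pos[of _ 0])
  then show False using I_mass[OF i(1), of 0] i(2) params by simp
qed

lemma lands_0: "lands t 0 s = 0"
proof -
  have "(\<integral>\<^sup>+x. indicator {x. R (t - int l) x \<le> l + 0} x * s l x * indicator {x. l < R (t - int l) x} x \<partial>M) = 0" for l
    by (intro nn_integral_zero' AE_I2) (auto simp: indicator_def)
  then show ?thesis unfolding lands_def levint_def by simp
qed

text \<open>What lands at time \<open>t + 1\<close> stands on the base there and has a new return
  time. It is counted again at the next step, unless that return time exceeds the remaining window;
  the integral restores this part.\<close>

lemma lands_Suc:
  assumes [measurable]: "\<And>l. s l \<in> borel_measurable M"
  shows "lands t (Suc k) s = lands (t + 1) k (step t s)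
     + (\<integral>\<^sup>+x. incoming t s x * indicator {x. k < R (t + 1) x} x \<partial>M)"
proof -
  have [measurable]: "step t s l \<in> borel_measurable M" for l by (intro step_meas) simp
  define \<phi> where "\<phi> l x = (indicator {x. R (t + 1 - int l) x \<le> l + k} x
    + (if l = 0 then indicator {x. k < R (t + 1) x} x else 0) :: ennreal)" for l x
  have \<phi>[measurable]: "\<phi> l \<in> borel_measurable M" for l unfolding \<phi>_def by measurable
  have "koop t \<phi> = (\<lambda>l. indicator {x. R (t - int l) x \<le> l + Suc k})"
    unfolding koop_def \<phi>_def by (intro ext) (auto simp: indicator_def algebra_simps)
  then have "lands t (Suc k) s = levint (t + 1) (step t s) \<phi>"
    unfolding lands_def by (subst levint_step[symmetric]) simp_all
  also have "\<dots> = lands (t + 1) k (step t s) + levint (t + 1) (step t s) (\<lambda>l x. if l = 0 then indicator {x. k < R (t + 1) x} x else 0)"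
    unfolding lands_def \<phi>_def by (intro levint_add) measurable
  also have "levint (t + 1) (step t s) (\<lambda>l x. if l = 0 then indicator {x. k < R (t + 1) x} x else 0)
     = (\<integral>\<^sup>+x. incoming t s x * indicator {x. k < R (t + 1) x} x \<partial>M)"
    unfolding levint_def suminf_split_first_ennreal[of "\<lambda>l. \<integral>\<^sup>+x. (if l = 0 then indicator {x. k < R (t + 1) x} x else 0) * step t s l x * indicator {x. l < R (t + 1 - int l) x} x \<partial>M"]
    by (auto intro!: nn_integral_cong simp: indicator_def R_pos)
  finally show ?thesis .
qed

lemma lands_Suc_le:
  assumes [measurable]: "\<And>l. s l \<in> borel_measurable M"
  shows "lands t (Suc k) s \<le> lands (t + 1) k (step t s) + base_mass (step t s)"
  unfolding lands_Suc[of s t k, OF assms]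
  by (intro add_left_mono nn_integral_mono) (auto simp: indicator_def)

lemma base_mass_le_lands:
  assumes [measurable]: "\<And>l. s l \<in> borel_measurable M"
  shows "base_mass (step t s) \<le> lands t (Suc k) s"
proof -
  have [measurable]: "incoming t s \<in> borel_measurable M" by (intro incoming_meas) simp
  have "base_mass (step t s) = (\<integral>\<^sup>+x. indicator {x. R (t + 1 - int 0) x \<le> 0 + k} x * step t s 0 x * indicator {x. 0 < R (t + 1 - int 0) x} x
     + incoming t s x * indicator {x. k < R (t + 1) x} x \<partial>M)"
    by (intro nn_integral_cong) (auto simp: indicator_def R_pos)
  also have "\<dots> = (\<integral>\<^sup>+x. indicator {x. R (t + 1 - int 0) x \<le> 0 + k} x * step t s 0 x * indicator {x. 0 < R (t + 1 - int 0) x} x \<partial>M)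
     + (\<integral>\<^sup>+x. incoming t s x * indicator {x. k < R (t + 1) x} x \<partial>M)"
    by (intro nn_integral_add) (auto simp: step_meas)
  also have "\<dots> \<le> lands t (Suc k) s"
    unfolding lands_Suc[of s t k, OF assms]
    unfolding lands_def levint_def
    by (intro add_right_mono) (subst suminf_split_first_ennreal, auto)
  finally show ?thesis .
qed

text \<open>Every landing is charged to the mass on the base at the time at which it
  happens.\<close>

lemma lands_le_sum:
  assumes "\<And>l. s l \<in> borel_measurable M"
  shows "lands t k s \<le> (\<Sum>r=1..k. base_mass (evol t r s))"
  using assms
proof (induction k arbitrary: t s)
  case (Suc k)
  have "evol (t + 1) r (step t s) = evol t (Suc r) s" for r
    using evol_add[of t 1 r s] by (simp del: evol.simps(2) add: evol.simps(2)[of _ 0])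
  then have "lands (t + 1) k (step t s) \<le> (\<Sum>r=1..k. base_mass (evol t (Suc r) s))"
    using Suc.IH[of "step t s" "t + 1"] Suc.prems by (simp add: step_meas)
  also have "\<dots> = (\<Sum>r=2..Suc k. base_mass (evol t r s))"
    by (simp only: sum.atLeast_Suc_atMost_Suc_shift numeral_2_eq_2 One_nat_def o_def)
  finally have "lands t (Suc k) s \<le> (\<Sum>r=2..Suc k. base_mass (evol t r s)) + base_mass (evol t 1 s)"
    by (intro order_trans[OF lands_Suc_le[of s t k, OF Suc.prems]] add_mono) simp_all
  also have "\<dots> = (\<Sum>r=1..Suc k. base_mass (evol t r s))"
    by (subst (2) sum.atLeast_Suc_atMost) (auto simp: add.commute numeral_2_eq_2)
  finally show ?case .
qed (simp add: lands_0)

text \<open>The points with return time \<open>i\<close> do not jump over \<open>n\<close>, and they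
  carry at least the share \<eta>. Finiteness is needed to subtract them.\<close>

lemma jump_over_le:
  assumes "basereg k b" and [measurable]: "b \<in> borel_measurable M" and "i \<in> I" "i \<le> n"
    and fin: "(\<integral>\<^sup>+x. b x \<partial>M) < \<infinity>"
  shows "(\<integral>\<^sup>+x. b x * indicator {x. n < R k x} x \<partial>M) \<le> ennreal (1 - \<eta>) * (\<integral>\<^sup>+x. b x \<partial>M)"
proof -
  let ?A = "{x \<in> space M. R k x = i}"
  let ?a = "\<integral>\<^sup>+x. b x * indicator {x. n < R k x} x \<partial>M" and ?b = "\<integral>\<^sup>+x. b x * indicator ?A x \<partial>M"
  let ?c = "\<integral>\<^sup>+x. b x \<partial>M"
  have "?a + ?b = (\<integral>\<^sup>+x. b x * indicator {x. n < R k x} x + b x * indicator ?A x \<partial>M)"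
    by (intro nn_integral_add[symmetric]) auto
  also have "\<dots> \<le> ?c" using assms(4) by (intro nn_integral_mono) (auto simp: indicator_def)
  finally have 1: "?a + ?b \<le> ?c" .
  have "ennreal \<epsilon> * ?c \<le> emeasure M ?A * ?c" by (intro mult_right_mono I_mass assms) auto
  also have "\<dots> \<le> ennreal (exp H) * ?b" by (intro basereg_set_lower[OF assms(1)]) auto
  finally have 2: "ennreal \<epsilon> * ?c \<le> ennreal (exp H) * ?b" .
  have "?a \<le> ?c" "?b \<le> ?c" by (rule order_trans[OF _ 1], simp)+
  then have abfin: "?a < \<infinity>" "?b < \<infinity>" using fin by (auto intro: le_less_trans)
  obtain a where a: "?a = ennreal a" "0 \<le> a" using less_infinity_ennrealD[OF abfin(1)] by blast
  obtain b' where b': "?b = ennreal b'" "0 \<le> b'" using less_infinity_ennrealD[OF abfin(2)] by blast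
  obtain c where c: "?c = ennreal c" "0 \<le> c" using less_infinity_ennrealD[OF fin] by blast
  have 3: "a + b' \<le> c" using 1 a(2) b'(2) c(2) unfolding a(1) b'(1) c(1)
    by (simp add: ennreal_plus[symmetric] del: ennreal_plus)
  have "\<epsilon> * c \<le> exp H * b'" using 2 b'(2) c(2) params unfolding b'(1) c(1)
    by (simp add: ennreal_mult[symmetric])
  then have "exp (- H) * (\<epsilon> * c) \<le> exp (- H) * (exp H * b')" by (intro mult_left_mono) auto
  also have "\<dots> = b'" by (simp only: mult.assoc[symmetric] exp_add[symmetric]) simp
  finally have "\<eta> * c \<le> b'" unfolding \<eta>_def by (simp add: mult.assoc)
  then have "ennreal a \<le> ennreal ((1 - \<eta>) * c)" using 3 by (intro ennreal_leI) (simp add: algebra_simps)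
  also have "\<dots> = ennreal (1 - \<eta>) * ennreal c" by (rule ennreal_mult) (use c \<eta>_le_1 in auto)
  finally show ?thesis unfolding a(1) c(1) .
qed

text \<open>A factor \<open>1 - \<kappa>\<close> that stays above \<open>h\<close> is at least
  \<open>exp (- \<kappa> / h)\<close>. This turns the product of the survival shares into the
  exponential of a sum.\<close>

lemma one_le_exp_mult:
  fixes \<kappa> h :: real
  assumes "0 < h" "0 \<le> \<kappa>" "\<kappa> \<le> 1 - h"
  shows "1 \<le> exp (\<kappa> / h) * (1 - \<kappa>)"
proof -
  have "1 + \<kappa> / h \<le> exp (\<kappa> / h)" by (rule exp_ge_add_one_self)
  then have "(1 + \<kappa> / h) * (1 - \<kappa>) \<le> exp (\<kappa> / h) * (1 - \<kappa>)" using assms by (intro mult_right_mono) auto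
  moreover have "h * 1 \<le> h * ((1 + \<kappa> / h) * (1 - \<kappa>))"
  proof -
    have "h * ((1 + \<kappa> / h) * (1 - \<kappa>)) = (h + \<kappa>) * (1 - \<kappa>)" using assms by (simp add: field_simps)
    moreover have "\<kappa> * \<kappa> + h * \<kappa> \<le> \<kappa>"
      using mult_left_mono[OF assms(3) assms(2)] by (simp add: algebra_simps)
    ultimately show ?thesis by (simp add: algebra_simps)
  qed
  then have "1 \<le> (1 + \<kappa> / h) * (1 - \<kappa>)" using assms(1) mult_le_cancel_left_pos by blast
  ultimately show ?thesis by linarith
qed

text \<open>
  Mass is lost only by jumping from the base at time \<open>t + 1\<close> over the final time \<open>t + 1 + k\<close>. With the final
  time fixed, the probabilities in the exponent sum to at most the mass of one tower.
\<close>

lemma lands_contract: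
  assumes meas: "\<And>l. s l \<in> borel_measurable M" and reg: "\<And>l. cellreg (t - int l) (s l)"
    and k: "i0 \<le> k" and fin: "lands t (Suc k) s < \<infinity>"
  shows "lands t (Suc k) s \<le>
    ennreal (exp (exp H / \<eta> * prob {x \<in> space M. k < R (t + 1) x})) * lands (t + 1) k (step t s)"
proof -
  have [measurable]: "incoming t s \<in> borel_measurable M" using meas by (intro incoming_meas) simp
  let ?A = "{x \<in> space M. k < R (t + 1) x}"
  let ?J = "\<integral>\<^sup>+x. incoming t s x * indicator {x. k < R (t + 1) x} x \<partial>M"
  let ?c = "\<integral>\<^sup>+x. incoming t s x \<partial>M"
  have br: "basereg (t + 1) (incoming t s)" using reg by (rule incoming_basereg)
  have cw: "?c \<le> lands t (Suc k) s" using base_mass_le_lands[of s t k, OF meas] by simp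
  then have cfin: "?c < \<infinity>" using fin by (rule le_less_trans)
  define p where "p = prob ?A"
  \<comment> \<open>The first bound is small when few points jump, which makes the losses summable;
    the second keeps \<open>1 - \<kappa>\<close> above \<eta>, as \<open>one_le_exp_mult\<close>
    demands.\<close>
  define \<kappa> where "\<kappa> = min (exp H * p) (1 - \<eta>)"
  have p0: "0 \<le> p" unfolding p_def by simp
  have J1: "?J \<le> ennreal (1 - \<eta>) * ?c" using jump_over_le[OF br _ i0 k cfin] by simp
  have "?J = (\<integral>\<^sup>+x. incoming t s x * indicator ?A x \<partial>M)"
    by (intro nn_integral_cong) (auto simp: indicator_def)
  then have J2: "?J \<le> ennreal (exp H * p) * ?c"
    using basereg_set_upper[OF br, of ?A] p0 by (simp add: p_def emeasure_eq_measure ennreal_mult)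
  have J: "?J \<le> ennreal \<kappa> * ?c" unfolding \<kappa>_def using J1 J2 by (auto simp: min_def)
  have \<kappa>: "0 \<le> \<kappa>" "\<kappa> \<le> 1 - \<eta>" "\<kappa> \<le> exp H * p" unfolding \<kappa>_def using p0 \<eta>_le_1 by auto
  have W: "lands t (Suc k) s \<le> lands (t + 1) k (step t s) + ennreal \<kappa> * lands t (Suc k) s"
    using J cw unfolding lands_Suc[of s t k, OF meas] by (meson add_left_mono dual_order.trans mult_left_mono zero_le)
  have "lands (t + 1) k (step t s) \<le> lands t (Suc k) s" unfolding lands_Suc[of s t k, OF meas] by simp
  then have "lands (t + 1) k (step t s) < \<infinity>" using fin by (rule le_less_trans)
  then obtain w w' where w: "lands t (Suc k) s = ennreal w" "lands (t + 1) k (step t s) = ennreal w'" "0 \<le> w" "0 \<le> w'"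
    using fin less_infinity_ennrealD by metis
  have "w \<le> w' + \<kappa> * w" using W w \<kappa> by (simp add: ennreal_mult[symmetric] ennreal_plus[symmetric] del: ennreal_plus)
  then have a: "(1 - \<kappa>) * w \<le> w'" by (simp add: algebra_simps)
  have "1 * w \<le> (exp (\<kappa> / \<eta>) * (1 - \<kappa>)) * w"
    using one_le_exp_mult[OF \<eta>_pos \<kappa>(1,2)] w by (intro mult_right_mono) auto
  also have "\<dots> \<le> exp (\<kappa> / \<eta>) * w'" using a by (simp add: mult.assoc)
  also have "\<dots> \<le> exp (exp H / \<eta> * p) * w'"
    using \<kappa>(3) \<eta>_pos w by (intro mult_right_mono) (auto simp: divide_right_mono)
  finally have "ennreal w \<le> ennreal (exp (exp H / \<eta> * p) * w')" by (intro ennreal_leI) simp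
  also have "\<dots> = ennreal (exp (exp H / \<eta> * p)) * ennreal w'" by (rule ennreal_mult) (use w in auto)
  finally show ?thesis unfolding w(1,2) p_def .
qed

text \<open>The final time \<open>t + i0 + n\<close> stays fixed while the window shrinks, so a
  window of length \<open>i0 + m\<close> belongs to a jump from time \<open>t + n - m\<close>. The
  iteration stops at window \<open>i0\<close>, the last one for which the return time
  \<open>i0\<close> prevents a jump.\<close>

lemma lands_contract_iter:
  assumes meas: "\<And>l. s l \<in> borel_measurable M" and reg: "\<And>l. cellreg (t - int l) (s l)"
    and fin: "lands t (i0 + n) s < \<infinity>"
  shows "lands t (i0 + n) s \<le>
    ennreal (exp (exp H / \<eta> * (\<Sum>m<n. prob {x \<in> space M. i0 + m < R (t + int (n - m)) x}))) * lands (t + int n) i0 (evol t n s)"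
  using assms
proof (induction n arbitrary: t s)
  case 0
  show ?case
    unfolding lessThan_0 sum.empty mult_zero_right exp_zero ennreal_1 mult_1 evol.simps(1) add_0_right of_nat_0
    by (rule order_refl)
next
  case (Suc n)
  let ?p = "\<lambda>m. prob {x \<in> space M. i0 + m < R (t + int (Suc n - m)) x}"
  have meas': "step t s l \<in> borel_measurable M" for l using Suc.prems by (intro step_meas)
  have reg': "cellreg (t + 1 - int l) (step t s l)" for l using Suc.prems by (intro step_cellreg)
  have "lands (t + 1) (i0 + n) (step t s) \<le> lands t (Suc (i0 + n)) s"
    unfolding lands_Suc[of s t "i0 + n", OF Suc.prems(1)] by simp
  then have fin': "lands (t + 1) (i0 + n) (step t s) < \<infinity>" using Suc.prems(3) by simp
  have ev: "evol (t + 1) n (step t s) = evol t (Suc n) s" using evol_add[of t 1 n s] by (simp del: evol.simps(2) add: evol.simps(2)[of _ 0])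
  have pe: "prob {x \<in> space M. i0 + m < R (t + 1 + int (n - m)) x} = ?p m" if "m < n" for m
    using that by (simp add: Suc_diff_le algebra_simps)
  have "(\<Sum>m<n. prob {x \<in> space M. i0 + m < R (t + 1 + int (n - m)) x}) = (\<Sum>m<n. ?p m)"
    by (intro sum.cong) (simp_all only: lessThan_iff pe)
  moreover have "t + 1 + int n = t + int (Suc n)" by simp
  ultimately have IH: "lands (t + 1) (i0 + n) (step t s)
      \<le> ennreal (exp (exp H / \<eta> * (\<Sum>m<n. ?p m))) * lands (t + int (Suc n)) i0 (evol t (Suc n) s)"
    using Suc.IH[of "step t s" "t + 1", OF meas' reg' fin'] unfolding ev by (simp only:)
  have e1: "i0 + Suc n = Suc (i0 + n)" "t + int (Suc n - n) = t + 1" by simp_all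
  have "lands t (i0 + Suc n) s \<le> ennreal (exp (exp H / \<eta> * ?p n)) * lands (t + 1) (i0 + n) (step t s)"
    unfolding e1 by (rule lands_contract[of s t "i0 + n", OF Suc.prems(1,2) le_add1 Suc.prems(3)[unfolded e1]])
  also have "\<dots> \<le> ennreal (exp (exp H / \<eta> * ?p n)) *
     (ennreal (exp (exp H / \<eta> * (\<Sum>m<n. ?p m))) * lands (t + int (Suc n)) i0 (evol t (Suc n) s))"
    by (rule mult_left_mono[OF IH zero_le])
  also have "\<dots> = ennreal (exp (exp H / \<eta> * (\<Sum>m<Suc n. ?p m))) * lands (t + int (Suc n)) i0 (evol t (Suc n) s)"
    by (simp only: ennreal_exp_mult_assoc sum.lessThan_Suc distrib_left)
  finally show ?case .
qed

text \<open>A base density climbs unchanged, so after \<open>i - 1\<close> steps it sits on level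
  \<open>i - 1\<close>, and the part with return time \<open>i\<close> lands next.\<close>

lemma hit_once:
  assumes meas: "\<And>l. s l \<in> borel_measurable M" and reg: "\<And>l. cellreg (t - int l) (s l)"
    and n: "0 < n" and i: "i \<in> I"
  shows "ennreal (\<eta> ^ i) * base_mass (evol t n s) \<le> base_mass (evol t (n + i) s)"
proof -
  obtain j where j: "i = Suc j" using I_pos[OF i] by (cases i) auto
  define s1 where "s1 = evol t n s"
  have [measurable]: "s1 l \<in> borel_measurable M" for l unfolding s1_def using meas by (intro evol_meas)
  have e: "evol (t + int n) m s1 m = s1 0" for m
    by (induction m) auto
  have em: "evol (t + int n) j s1 l \<in> borel_measurable M" for l by (intro evol_meas) simp
  let ?A = "{x \<in> space M. R (t + int n) x = i}"
  have br: "basereg (t + int n) (s1 0)" unfolding s1_def using reg n by (intro evol_basereg)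
  have "base_mass (evol t (n + i) s) = (\<integral>\<^sup>+x. 1 * incoming (t + int n + int j) (evol (t + int n) j s1) x \<partial>M)"
    using evol_add[of t n i s] j by (simp add: s1_def)
  also have "\<dots> = (\<Sum>l. \<integral>\<^sup>+x. 1 * evol (t + int n) j s1 l x * indicator {x. R (t + int n + int j - int l) x = Suc l} x \<partial>M)"
    using em by (subst nn_integral_incoming) auto
  also have "\<dots> \<ge> (\<Sum>l\<in>{j}. \<integral>\<^sup>+x. 1 * evol (t + int n) j s1 l x * indicator {x. R (t + int n + int j - int l) x = Suc l} x \<partial>M)"
    by (intro sum_le_suminf) (auto simp: summableI)
  finally have 1: "(\<integral>\<^sup>+x. s1 0 x * indicator ?A x \<partial>M) \<le> base_mass (evol t (n + i) s)"
    using e[of j] j by (simp add: indicator_def cong: nn_integral_cong_simp)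
  \<comment> \<open>The share \<eta> is weakened to \<open>\<eta> ^ i\<close>, so that successive
    hits multiply to a power of the total time, whatever the summands are.\<close>
  have "\<eta> ^ i \<le> \<eta>" using power_decreasing[of 1 i \<eta>] \<eta>_pos \<eta>_le_1 j by simp
  then have "ennreal (\<eta> ^ i) * base_mass s1 \<le> ennreal \<eta> * base_mass s1" by (intro mult_right_mono ennreal_leI) auto
  also have "\<dots> = ennreal (exp (-H)) * (ennreal \<epsilon> * base_mass s1)"
    unfolding \<eta>_def using params by (simp add: ennreal_mult mult.assoc)
  also have "\<dots> \<le> ennreal (exp (-H)) * (emeasure M ?A * base_mass s1)"
    by (intro mult_left_mono mult_right_mono I_mass i) auto
  also have "\<dots> \<le> ennreal (exp (-H)) * (ennreal (exp H) * (\<integral>\<^sup>+x. s1 0 x * indicator ?A x \<partial>M))"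
    by (intro mult_left_mono basereg_set_lower[OF br]) auto
  also have "\<dots> = (\<integral>\<^sup>+x. s1 0 x * indicator ?A x \<partial>M)"
    unfolding ennreal_exp_mult_assoc by simp
  finally show ?thesis using 1 unfolding s1_def by simp
qed

text \<open>Write \<open>m\<close> as a sum of elements of \<open>I\<close> and apply
  \<open>hit_once\<close> to the summands one after the other.\<close>

lemma hit_many:
  assumes meas: "\<And>l. s l \<in> borel_measurable M" and reg: "\<And>l. cellreg (t - int l) (s l)"
    and n: "0 < n" and m: "n0 \<le> m"
  shows "ennreal (\<eta> ^ m) * base_mass (evol t n s) \<le> base_mass (evol t (n + m) s)"
proof -
  have "set xs \<subseteq> I \<Longrightarrow> 0 < n \<Longrightarrow> ennreal (\<eta> ^ sum_list xs) * base_mass (evol t n s) \<le> base_mass (evol t (n + sum_list xs) s)" for xs n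
  proof (induction xs arbitrary: n)
    case (Cons i xs)
    have "ennreal (\<eta> ^ sum_list (i # xs)) * base_mass (evol t n s)
      = ennreal (\<eta> ^ sum_list xs) * (ennreal (\<eta> ^ i) * base_mass (evol t n s))"
      using \<eta>_pos by (simp add: power_add ennreal_mult mult_ac)
    also have "\<dots> \<le> ennreal (\<eta> ^ sum_list xs) * base_mass (evol t (n + i) s)"
      using Cons.prems by (intro mult_left_mono hit_once meas reg) auto
    also have "\<dots> \<le> base_mass (evol t (n + i + sum_list xs) s)"
      using Cons by auto
    finally show ?case by (simp add: algebra_simps)
  qed simp
  then show ?thesis using I_aperiodic[OF m] n by blast
qed

text \<open>What one block of the coupling has to preserve. The pointwise bound \<open>B\<close>
  converts the reference measure of high levels into a bound for the mass that the state has
  there.\<close>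

definition admissible :: "int \<Rightarrow> real \<Rightarrow> (nat \<Rightarrow> 'x \<Rightarrow> ennreal) \<Rightarrow> bool" where
  "admissible t B s \<longleftrightarrow> (\<forall>l. s l \<in> borel_measurable M \<and> cellreg (t - int l) (s l) \<and>
     (\<forall>x\<in>space M. s l x \<le> ennreal B))"

lemma admissible_meas: "admissible t B s \<Longrightarrow> s l \<in> borel_measurable M"
  and admissible_cellreg: "admissible t B s \<Longrightarrow> cellreg (t - int l) (s l)"
  and admissible_le: "admissible t B s \<Longrightarrow> x \<in> space M \<Longrightarrow> s l x \<le> ennreal B"
  by (auto simp: admissible_def)

text \<open>The reference measure of the levels from \<open>n\<close> on in the tower at time
  \<open>t\<close>.\<close>

definition tail :: "int \<Rightarrow> nat \<Rightarrow> ennreal" where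
  "tail t n = (\<Sum>l. emeasure M {x \<in> space M. l + n < R (t - int (l + n)) x})"

lemma levint_ge_base:
  assumes [measurable]: "\<And>l. s l \<in> borel_measurable M"
  shows "base_mass s \<le> mass t s"
proof -
  have "base_mass s = (\<integral>\<^sup>+x. 1 * s 0 x * indicator {x. 0 < R (t - int 0) x} x \<partial>M)"
    by (intro nn_integral_cong) (auto simp: R_pos)
  then show ?thesis unfolding levint_def
    by (subst suminf_split_first_ennreal) simp
qed

text \<open>Each new base density is at most \<open>exp H\<close> times its mass, which never
  exceeds the conserved total mass; the other levels are copies of earlier ones.\<close>

lemma evol_admissible:
  assumes "admissible t B s" and m: "ennreal (exp H) * mass t s \<le> ennreal B"
  shows "admissible (t + int n) B (evol t n s)"
proof -
  note meas = admissible_meas[OF assms(1)] and reg = admissible_cellreg[OF assms(1)]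
  have "\<forall>x\<in>space M. evol t n s l x \<le> ennreal B" for l
  proof (induction n arbitrary: l)
    case 0
    then show ?case using admissible_le[OF assms(1)] by simp
  next
    case (Suc n)
    show ?case
    proof (cases l)
      case 0
      show ?thesis
      proof
        fix x assume x: "x \<in> space M"
        have "evol t (Suc n) s 0 x \<le> ennreal (exp H) * base_mass (evol t (Suc n) s)"
          by (intro basereg_upper[OF evol_basereg]) (use reg meas x in \<open>auto intro: evol_meas simp del: evol.simps\<close>)
        also have "\<dots> \<le> ennreal (exp H) * mass (t + int (Suc n)) (evol t (Suc n) s)"
          by (intro mult_left_mono levint_ge_base evol_meas meas) auto
        also have "\<dots> = ennreal (exp H) * mass t s" by (subst mass_evol[OF meas]) simp
        finally show "evol t (Suc n) s l x \<le> ennreal B" using m 0 by simp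
      qed
    qed (use Suc in simp)
  qed
  then show ?thesis unfolding admissible_def
    using evol_meas[of s t n, OF meas] evol_cellreg[of t s n, OF reg] by auto
qed

text \<open>Mass on level \<open>l\<close> that does not land within \<open>k\<close> steps is on
  level \<open>l + k\<close> at time \<open>t + k\<close>, hence in the part of the tower measured
  by \<open>tail (t + int k) k\<close>.\<close>

lemma mass_le_lands_tail:
  assumes adm: "admissible t B s" and B: "0 \<le> B"
  shows "mass t s \<le> lands t k s + ennreal B * tail (t + int k) k"
proof -
  note [measurable] = admissible_meas[OF adm]
  have "mass t s = levint t s (\<lambda>l x. indicator {x. R (t - int l) x \<le> l + k} x + indicator {x. l + k < R (t - int l) x} x)"
    by (intro arg_cong[where f="levint t s"] ext) (auto simp: indicator_def)
  also have "\<dots> = lands t k s + levint t s (\<lambda>l x. indicator {x. l + k < R (t - int l) x} x)"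
    unfolding lands_def by (intro levint_add) measurable
  also have "levint t s (\<lambda>l x. indicator {x. l + k < R (t - int l) x} x) \<le> ennreal B * tail (t + int k) k"
    unfolding levint_def tail_def ennreal_suminf_cmult[symmetric]
  proof (intro suminf_le)
    fix l
    let ?A = "{x \<in> space M. l + k < R (t + int k - int (l + k)) x}"
    have "(\<integral>\<^sup>+x. indicator {x. l + k < R (t - int l) x} x * s l x * indicator {x. l < R (t - int l) x} x \<partial>M)
      \<le> (\<integral>\<^sup>+x. ennreal B * indicator ?A x \<partial>M)"
      using admissible_le[OF adm] by (intro nn_integral_mono) (auto simp: indicator_def)
    also have "\<dots> = ennreal B * emeasure M ?A"
      by (rule nn_integral_cmult_indicator) measurable
    finally show "(\<integral>\<^sup>+x. indicator {x. l + k < R (t - int l) x} x * s l x * indicator {x. l < R (t - int l) x} x \<partial>M)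
      \<le> ennreal B * emeasure M ?A" .
  qed (auto simp: summableI)
  finally show ?thesis by simp
qed

text \<open>The constant of \<open>lands_le_base_mass\<close>: the exponential is the total loss by
  jumping over the final time, \<open>real i0\<close> the number of last moments among which the
  landings are shared out, and the power of \<eta> the price of steering them to one common
  time.\<close>

definition c1 :: real where
  "c1 = \<eta> ^ (n0 + i0) / (real i0 * exp (exp H / \<eta> * Mt))"

text \<open>Up to the jump losses, landing within \<open>k\<close> steps means landing at one of the
  last \<open>i0\<close> moments of the window. From each of these at least \<open>n0\<close> steps
  remain until time \<open>k + n0\<close>, so \<open>hit_many\<close> brings the mass to the base
  exactly then.\<close>

lemma lands_le_base_mass:
  assumes meas: "\<And>l. s l \<in> borel_measurable M" and reg: "\<And>l. cellreg (t - int l) (s l)"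
    and k: "i0 \<le> k" and fin: "lands t k s < \<infinity>"
  shows "ennreal c1 * lands t k s \<le> base_mass (evol t (k + n0) s)"
proof -
  define n where "n = k - i0"
  have k': "k = i0 + n" unfolding n_def using k by simp
  let ?s = "evol t n s"
  have i0p: "0 < i0" using I_pos[OF i0] .
  have meas': "?s l \<in> borel_measurable M" for l by (intro evol_meas meas)
  \<comment> \<open>With level \<open>i0 + m\<close> the time \<open>t + n - m\<close> is
    \<open>t + k - (i0 + m)\<close>; so these are measures of different levels of the single tower
    at time \<open>t + k\<close>, and \<open>mass_bound\<close> applies.\<close>
  have "ennreal (\<Sum>m<n. prob {x \<in> space M. i0 + m < R (t + int (n - m)) x})
      = (\<Sum>m<n. emeasure M {x \<in> space M. i0 + m < R (t + int (n - m)) x})"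
    by (subst sum_ennreal[symmetric]) (auto simp: emeasure_eq_measure)
  also have "\<dots> = (\<Sum>m\<in>(\<lambda>m. i0 + m) ` {..<n}. emeasure M {x \<in> space M. m < R (t + int k - int m) x})"
    by (subst sum.reindex) (auto simp: k' algebra_simps of_nat_diff intro!: sum.cong)
  also have "\<dots> \<le> (\<Sum>m. emeasure M {x \<in> space M. m < R (t + int k - int m) x})"
    by (intro sum_le_suminf summableI) auto
  also have "\<dots> \<le> ennreal Mt" by (rule mass_bound)
  finally have p: "(\<Sum>m<n. prob {x \<in> space M. i0 + m < R (t + int (n - m)) x}) \<le> Mt"
    using params by (simp add: ennreal_le_iff)
  have pe: "exp H / \<eta> * (\<Sum>m<n. prob {x \<in> space M. i0 + m < R (t + int (n - m)) x}) \<le> exp H / \<eta> * Mt"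
    using \<eta>_pos by (intro mult_left_mono p) simp
  have "lands t k s \<le> ennreal (exp (exp H / \<eta> * Mt)) * lands (t + int n) i0 ?s"
    unfolding k' by (rule le_exp_mult_mono[OF lands_contract_iter[of s t n, OF meas reg fin[unfolded k']] pe])
  also have "lands (t + int n) i0 ?s \<le> (\<Sum>r=1..i0. base_mass (evol (t + int n) r ?s))"
    by (intro lands_le_sum meas')
  finally have 1: "lands t k s \<le> ennreal (exp (exp H / \<eta> * Mt)) * (\<Sum>r=1..i0. base_mass (evol t (n + r) s))"
    by (simp add: mult_left_mono evol_add)
  have "ennreal (\<eta> ^ (n0 + i0)) * (\<Sum>r=1..i0. base_mass (evol t (n + r) s))
    = (\<Sum>r=1..i0. ennreal (\<eta> ^ (n0 + i0)) * base_mass (evol t (n + r) s))"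
    by (simp add: sum_distrib_left)
  also have "\<dots> \<le> (\<Sum>r=1..i0. base_mass (evol t (k + n0) s))"
  proof (intro sum_mono)
    fix r assume r: "r \<in> {1..i0}"
    have "\<eta> ^ (n0 + i0) \<le> \<eta> ^ (n0 + i0 - r)"
      using \<eta>_pos \<eta>_le_1 by (intro power_decreasing) auto
    then have "ennreal (\<eta> ^ (n0 + i0)) * base_mass (evol t (n + r) s) \<le> ennreal (\<eta> ^ (n0 + i0 - r)) * base_mass (evol t (n + r) s)"
      by (intro mult_right_mono ennreal_leI) auto
    also have "\<dots> \<le> base_mass (evol t (n + r + (n0 + i0 - r)) s)"
      using r by (intro hit_many meas reg) auto
    also have "n + r + (n0 + i0 - r) = k + n0" using r k' by auto
    finally show "ennreal (\<eta> ^ (n0 + i0)) * base_mass (evol t (n + r) s) \<le> base_mass (evol t (k + n0) s)" .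
  qed
  also have "\<dots> = ennreal (real i0) * base_mass (evol t (k + n0) s)"
    by (simp add: ennreal_of_nat_eq_real_of_nat)
  finally have 2: "ennreal (\<eta> ^ (n0 + i0)) * (\<Sum>r=1..i0. base_mass (evol t (n + r) s)) \<le> ennreal (real i0) * base_mass (evol t (k + n0) s)" .
  let ?S = "\<Sum>r=1..i0. base_mass (evol t (n + r) s)"
  have "ennreal c1 * lands t k s \<le> ennreal c1 * (ennreal (exp (exp H / \<eta> * Mt)) * ?S)"
    using 1 by (intro mult_left_mono) auto
  also have "\<dots> = ennreal (1 / real i0) * (ennreal (\<eta> ^ (n0 + i0)) * ?S)"
    unfolding c1_def mult.assoc[symmetric] using \<eta>_pos i0p
    by (subst (1 2) ennreal_mult[symmetric]) auto
  also have "\<dots> \<le> ennreal (1 / real i0) * (ennreal (real i0) * base_mass (evol t (k + n0) s))"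
    using 2 by (intro mult_left_mono) auto
  also have "\<dots> = base_mass (evol t (k + n0) s)"
    unfolding mult.assoc[symmetric] using i0p by (subst ennreal_mult[symmetric]) auto
  finally show ?thesis .
qed

section \<open>Coupling two states of equal mass\<close>

definition \<theta> :: real where "\<theta> = e * exp (- H) * c1"

lemma c1_pos: "0 < c1" and \<theta>_pos: "0 < \<theta>" and \<theta>_le_1: "\<theta> \<le> 1"
proof -
  have i: "1 \<le> real i0" using I_pos[OF i0] by simp
  show c: "0 < c1" unfolding c1_def using \<eta>_pos i by simp
  show "0 < \<theta>" unfolding \<theta>_def using c params by simp
  have "1 \<le> exp (exp H / \<eta> * Mt)" using \<eta>_pos params by simp
  then have "1 * 1 \<le> real i0 * exp (exp H / \<eta> * Mt)" using i by (intro mult_mono) auto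
  moreover have "\<eta> ^ (n0 + i0) \<le> 1" using \<eta>_pos \<eta>_le_1 by (intro power_le_one) auto
  ultimately have "c1 \<le> 1" unfolding c1_def using \<eta>_pos by (simp add: divide_le_eq_1)
  moreover have "e * exp (- H) \<le> 1 * 1" using params H_nonneg by (intro mult_mono) auto
  ultimately show "\<theta> \<le> 1" unfolding \<theta>_def using c params mult_mono[of "e * exp (-H)" 1 c1 1] by simp
qed

text \<open>A multiple of \<open>M\<close> on the base is taken away and not followed further: both
  states lose the same one.\<close>

definition sink :: "real \<Rightarrow> (nat \<Rightarrow> 'x \<Rightarrow> ennreal) \<Rightarrow> nat \<Rightarrow> 'x \<Rightarrow> ennreal" where
  "sink c s = s(0 := (\<lambda>x. s 0 x - ennreal c))"

text \<open>Removing a small constant turns the regularity constant \<open>H\<close> into at most \<open>Hc\<close>; the next return brings it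
  back to \<open>H\<close>.\<close>

lemma sink_cellreg:
  assumes b: "basereg k b" and c: "0 \<le> c" "\<And>x. x \<in> space M \<Longrightarrow> ennreal c \<le> ennreal e * b x"
  shows "cellreg k (\<lambda>x. b x - ennreal c)"
  unfolding cellreg_def
proof (intro ballI impI)
  fix x y assume xy: "x \<in> space M" "y \<in> space M"
  let ?r = "Hc * d k x y"
  have le: "b x \<le> ennreal (exp (H * d k x y)) * b y" using b xy unfolding basereg_def by blast
  show "b x - ennreal c \<le> ennreal (exp ?r) * (b y - ennreal c)"
  proof (cases "b y = \<infinity>")
    case True
    then show ?thesis by (simp add: ennreal_top_mult ennreal_mult_top)
  next
    case False
    then have "b y < \<infinity>" by (simp add: less_top)
    moreover from this have "b x < \<infinity>" by (intro le_less_trans[OF le]) (simp add: ennreal_mult_less_top)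
    ultimately obtain p q where pq: "b x = ennreal p" "b y = ennreal q" "0 \<le> p" "0 \<le> q"
      using less_infinity_ennrealD by metis
    have p: "p \<le> exp ((1 - e) * ?r) * q" using le pq by (simp add: ennreal_mult[symmetric] mult_ac)
    have cq: "c \<le> e * q" using c(2)[OF xy(2)] pq params by (simp add: ennreal_mult[symmetric])
    have "p - c \<le> exp ?r * (q - c)"
      using params d_range c p cq by (intro exp_sink_convex[of e]) auto
    moreover have "c \<le> q" using cq params pq mult_right_mono[of e 1 q] by simp
    ultimately show ?thesis unfolding pq using c(1) pq
      by (simp add: ennreal_minus ennreal_mult[symmetric] ennreal_leI)
  qed
qed

text \<open>The removed part contributes a term that does not depend on the rest of the state, so it
  cancels when two states with the same \<open>c\<close> are compared.\<close>

lemma levint_sink: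
  assumes [measurable]: "\<And>l. s l \<in> borel_measurable M" "\<And>l. \<phi> l \<in> borel_measurable M"
    and c: "\<And>x. x \<in> space M \<Longrightarrow> ennreal c \<le> s 0 x"
  shows "levint t s \<phi> = levint t (sink c s) \<phi> + ennreal c * (\<integral>\<^sup>+x. \<phi> 0 x \<partial>M)"
proof -
  have split: "levint t u \<phi> = (\<integral>\<^sup>+x. \<phi> 0 x * u 0 x \<partial>M) +
     (\<Sum>l. \<integral>\<^sup>+x. \<phi> (Suc l) x * u (Suc l) x * indicator {x. Suc l < R (t - int (Suc l)) x} x \<partial>M)" for u
    unfolding levint_def
    by (subst suminf_split_first_ennreal, rule arg_cong2[where f="(+)"])
       (auto intro!: nn_integral_cong simp: R_pos)
  have "(\<integral>\<^sup>+x. \<phi> 0 x * s 0 x \<partial>M) = (\<integral>\<^sup>+x. \<phi> 0 x * (s 0 x - ennreal c) + ennreal c * \<phi> 0 x \<partial>M)"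
    using c by (intro nn_integral_cong) (metis diff_add_cancel_ennreal distrib_left mult.commute)
  also have "\<dots> = (\<integral>\<^sup>+x. \<phi> 0 x * (s 0 x - ennreal c) \<partial>M) + ennreal c * (\<integral>\<^sup>+x. \<phi> 0 x \<partial>M)"
    by (subst nn_integral_add) (auto simp: nn_integral_cmult)
  finally have eq: "(\<integral>\<^sup>+x. \<phi> 0 x * s 0 x \<partial>M) =
    (\<integral>\<^sup>+x. \<phi> 0 x * (s 0 x - ennreal c) \<partial>M) + ennreal c * (\<integral>\<^sup>+x. \<phi> 0 x \<partial>M)" .
  have s1: "levint t (sink c s) \<phi> = (\<integral>\<^sup>+x. \<phi> 0 x * (s 0 x - ennreal c) \<partial>M) +
     (\<Sum>l. \<integral>\<^sup>+x. \<phi> (Suc l) x * s (Suc l) x * indicator {x. Suc l < R (t - int (Suc l)) x} x \<partial>M)"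
    using split[of "sink c s"] by (simp add: sink_def)
  show ?thesis unfolding split[of s] s1 eq by (simp only: add_ac)
qed

text \<open>Induction over the blocks. After a block both base densities lie above a common constant
  \<open>c\<close>, which is removed from both. When no block is left, the remaining mass bounds the
  difference.\<close>

lemma contraction:
  assumes "admissible t B s" "admissible t B s'" "mass t s = ennreal \<mu>" "mass t s' = ennreal \<mu>"
    and "0 \<le> \<mu>" "exp H * \<mu> \<le> B" "0 \<le> S" "q * (k + n0) \<le> n"
    and "i0 \<le> k" "\<And>j. j < q \<Longrightarrow> tail (t + int (j * (k + n0) + k)) k \<le> ennreal S"
    and "\<And>l. \<psi> l \<in> borel_measurable M" "\<And>l x. x \<in> space M \<Longrightarrow> \<psi> l x \<le> ennreal P" "0 \<le> P"
  shows "levint t s (koopn t n \<psi>) \<le> levint t s' (koopn t n \<psi>)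
           + ennreal (P * (B * S + (1 - \<theta>) ^ q * max 0 (\<mu> - B * S)))"
  using assms
proof (induction q arbitrary: t s s' n \<mu>)
  case 0
  \<comment> \<open>Without blocks the second state is simply dropped, its integral being
    nonnegative.\<close>
  have "levint t s (koopn t n \<psi>) \<le> ennreal P * mass t s"
    using 0 by (intro levint_le_mass koopn_le) (auto intro: admissible_meas)
  also have "\<dots> = ennreal (P * \<mu>)" using 0 by (simp add: ennreal_mult)
  also have "\<dots> \<le> ennreal (P * (B * S + (1 - \<theta>) ^ 0 * max 0 (\<mu> - B * S)))"
    using 0 by (intro ennreal_leI mult_left_mono) auto
  also have "\<dots> \<le> levint t s' (koopn t n \<psi>) + \<dots>" by simp
  finally show ?case .
next
  case (Suc q)
  define N where "N = k + n0"
  \<comment> \<open>At least \<open>\<mu> - B * S\<close> lands, the share \<open>c1\<close> of it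
    is on the base at the end of the block, the density there is at least \<open>exp (- H)\<close>
    times that mass, and only the share \<open>e\<close> may be removed.\<close>
  define c where "c = \<theta> * max 0 (\<mu> - B * S)"
  have B0: "0 \<le> B" using order_trans[OF _ Suc.prems(6), of 0] Suc.prems(5) by simp
  have c0: "0 \<le> c" unfolding c_def using \<theta>_pos by simp
  have BS: "0 \<le> B * S" using B0 Suc.prems by simp
  have c_le: "c \<le> \<mu>" unfolding c_def using \<theta>_pos \<theta>_le_1 BS Suc.prems(5)
      mult_right_mono[of \<theta> 1 "max 0 (\<mu> - B * S)"] by auto
  \<comment> \<open>The excess of the mass over the floor \<open>B * S\<close> contracts. Once the
    mass is below the floor, \<open>c\<close> is 0 and nothing more is removed.\<close>
  have max': "max 0 (\<mu> - c - B * S) = (1 - \<theta>) * max 0 (\<mu> - B * S)"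
  proof (cases "\<mu> \<le> B * S")
    case False
    then have "max 0 (\<mu> - B * S) = \<mu> - B * S" by simp
    moreover from this have "\<mu> - c - B * S = (1 - \<theta>) * (\<mu> - B * S)"
      unfolding c_def by (simp add: algebra_simps)
    moreover have "0 \<le> (1 - \<theta>) * (\<mu> - B * S)" using False \<theta>_le_1 by simp
    ultimately show ?thesis by simp
  qed (simp add: c_def)
  \<comment> \<open>One block for an arbitrary state \<open>u\<close>. As \<open>c\<close> is
    computed from the common mass \<mu>, the same constant serves \<open>s\<close> and
    \<open>s'\<close>.\<close>
  have stage: "admissible (t + int N) B (sink c (evol t N u)) \<and> mass (t + int N) (sink c (evol t N u)) = ennreal (\<mu> - c)
      \<and> (\<forall>\<phi>. (\<forall>l. \<phi> l \<in> borel_measurable M) \<longrightarrow> levint t u (koopn t N \<phi>) =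
           levint (t + int N) (sink c (evol t N u)) \<phi> + ennreal c * (\<integral>\<^sup>+x. \<phi> 0 x \<partial>M))"
    if adm: "admissible t B u" and mu: "mass t u = ennreal \<mu>" for u
  proof -
    note meas = admissible_meas[OF adm] and reg = admissible_cellreg[OF adm]
    have m2: "evol t N u l \<in> borel_measurable M" for l by (intro evol_meas meas)
    have adm2: "admissible (t + int N) B (evol t N u)"
      using adm by (rule evol_admissible) (use Suc.prems mu in \<open>simp add: ennreal_mult[symmetric] ennreal_leI\<close>)
    have "0 < N" unfolding N_def using I_pos[OF i0] Suc.prems(9) by simp
    then have br: "basereg (t + int N) (evol t N u 0)" by (intro evol_basereg reg)
    have lm: "lands t k u \<le> mass t u"
      unfolding lands_def by (intro levint_mono) (auto simp: indicator_def)
    then have lfin: "lands t k u < \<infinity>" using mu by (simp add: le_less_trans)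
    then obtain w where w: "lands t k u = ennreal w" "0 \<le> w"
      using less_infinity_ennrealD by metis
    have "ennreal \<mu> \<le> ennreal w + ennreal B * tail (t + int k) k"
      using mass_le_lands_tail[OF adm B0, of k] mu w by simp
    also have "\<dots> \<le> ennreal w + ennreal B * ennreal S"
      using Suc.prems(10)[of 0] by (intro add_left_mono mult_left_mono) auto
    also have "\<dots> = ennreal (w + B * S)" using B0 Suc.prems(7) w by (simp add: ennreal_mult)
    finally have "\<mu> \<le> w + B * S" using w BS by (simp add: ennreal_le_iff del: ennreal_plus)
    then have "c1 * max 0 (\<mu> - B * S) \<le> c1 * w" using w c1_pos by (intro mult_left_mono) auto
    then have "ennreal (c1 * max 0 (\<mu> - B * S)) \<le> ennreal c1 * ennreal w"
      using c1_pos w by (simp add: ennreal_mult[symmetric] ennreal_leI)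
    also have "\<dots> \<le> base_mass (evol t N u)"
      using lands_le_base_mass[of u t k, OF meas reg Suc.prems(9) lfin] w by (simp add: N_def)
    finally have bm: "ennreal (c1 * max 0 (\<mu> - B * S)) \<le> base_mass (evol t N u)" .
    have ce: "ennreal c \<le> ennreal e * evol t N u 0 x" if x: "x \<in> space M" for x
    proof -
      have "ennreal c = ennreal (e * exp (-H)) * ennreal (c1 * max 0 (\<mu> - B * S))"
        unfolding c_def \<theta>_def using params c1_pos by (simp add: ennreal_mult[symmetric] mult_ac)
      also have "\<dots> \<le> ennreal (e * exp (-H)) * (ennreal (exp H) * evol t N u 0 x)"
        by (intro mult_left_mono order_trans[OF bm] basereg_lower[OF br x]) auto
      also have "\<dots> = ennreal e * evol t N u 0 x"
      proof -
        have "e * exp (- H) * exp H = e" by (simp only: mult.assoc exp_add[symmetric]) simp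
        then show ?thesis using params
          by (simp only: mult.assoc[symmetric] ennreal_mult[symmetric] exp_ge_zero mult_nonneg_nonneg less_imp_le)
      qed
      finally show ?thesis .
    qed
    have cu: "ennreal c \<le> evol t N u 0 x" if x: "x \<in> space M" for x
    proof -
      have "ennreal e * evol t N u 0 x \<le> 1 * evol t N u 0 x"
        using params by (intro mult_right_mono) auto
      then show ?thesis using ce[OF x] by simp
    qed
    have "cellreg (t + int N - int l) (sink c (evol t N u) l)" for l
      using sink_cellreg[OF br c0 ce] admissible_cellreg[OF adm2, of l] by (auto simp: sink_def)
    moreover have "sink c (evol t N u) l \<in> borel_measurable M" for l
      using m2 by (auto simp: sink_def)
    moreover have "sink c (evol t N u) l x \<le> ennreal B" if "x \<in> space M" for l x
      using admissible_le[OF adm2 that, of l] by (auto simp: sink_def intro: order_trans[OF diff_le_self_ennreal])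
    ultimately have 1: "admissible (t + int N) B (sink c (evol t N u))" unfolding admissible_def by auto
    have 2: "levint t u (koopn t N \<phi>) = levint (t + int N) (sink c (evol t N u)) \<phi> + ennreal c * (\<integral>\<^sup>+x. \<phi> 0 x \<partial>M)"
      if "\<And>l. \<phi> l \<in> borel_measurable M" for \<phi>
      using levint_evol[of \<phi> u t N, OF that meas] levint_sink[of "evol t N u" \<phi> c "t + int N", OF m2 that cu] by simp
    have "ennreal \<mu> = mass (t + int N) (sink c (evol t N u)) + ennreal c"
      using 2[of "\<lambda>_ _. 1"] mu by (simp add: koopn_one emeasure_space_1)
    then have "mass (t + int N) (sink c (evol t N u)) = ennreal \<mu> - ennreal c"
      by (simp add: ennreal_add_diff_cancel_right)
    then have 3: "mass (t + int N) (sink c (evol t N u)) = ennreal (\<mu> - c)"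
      using c0 by (simp add: ennreal_minus)
    from 1 2 3 show ?thesis by blast
  qed
  have nN: "N \<le> n" "q * N \<le> n - N" using Suc.prems(8) by (auto simp: N_def)
  define \<xi> where "\<xi> = koopn (t + int N) (n - N) \<psi>"
  have \<xi>: "koopn t n \<psi> = koopn t N \<xi>" using koopn_add[of t N "n - N" \<psi>] nN by (simp add: \<xi>_def)
  have \<xi>m: "\<xi> l \<in> borel_measurable M" for l unfolding \<xi>_def by (intro koopn_meas Suc.prems)
  have tl: "tail (t + int N + int (j * (k + n0) + k)) k \<le> ennreal S" if "j < q" for j
    using Suc.prems(10)[of "Suc j"] that by (simp add: N_def algebra_simps)
  \<comment> \<open>The mass only decreases, so the same \<open>B\<close> remains valid for all
    later blocks.\<close>
  have "exp H * (\<mu> - c) \<le> exp H * \<mu>" using c0 by (intro mult_left_mono) simp_all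
  then have "exp H * (\<mu> - c) \<le> B" using Suc.prems(6) by (rule order_trans)
  then have IH: "levint (t + int N) (sink c (evol t N s)) \<xi> \<le> levint (t + int N) (sink c (evol t N s')) \<xi>
      + ennreal (P * (B * S + (1 - \<theta>) ^ q * max 0 (\<mu> - c - B * S)))"
    unfolding \<xi>_def using stage[OF Suc.prems(1,3)] stage[OF Suc.prems(2,4)] nN c_le Suc.prems tl
    by (intro Suc.IH) (auto simp: N_def)
  have "levint t s (koopn t n \<psi>) = levint (t + int N) (sink c (evol t N s)) \<xi> + ennreal c * (\<integral>\<^sup>+x. \<xi> 0 x \<partial>M)"
    unfolding \<xi> using stage[OF Suc.prems(1,3)] \<xi>m by blast
  also have "\<dots> \<le> levint (t + int N) (sink c (evol t N s')) \<xi>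
      + ennreal (P * (B * S + (1 - \<theta>) ^ q * max 0 (\<mu> - c - B * S))) + ennreal c * (\<integral>\<^sup>+x. \<xi> 0 x \<partial>M)"
    by (intro add_right_mono IH)
  also have "\<dots> = levint t s' (koopn t n \<psi>) + ennreal (P * (B * S + (1 - \<theta>) ^ q * max 0 (\<mu> - c - B * S)))"
    unfolding \<xi> using stage[OF Suc.prems(2,4)] \<xi>m by (simp add: add_ac)
  finally show ?case unfolding max' by (simp add: mult_ac)
qed

text \<open>Outside this locale the rate is a function of the constants only, which shows that it is
  the same for all orbits.\<close>

lemma \<theta>_eq_couple_rate: "\<theta> = couple_rate Mt Hc e \<epsilon> n0 i0"
  by (simp only: \<theta>_def c1_def \<eta>_def couple_rate_def Let_def)

end

section \<open>Geometry of the tower\<close>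

lemma shift_shift[simp]: "shift i (shift j \<omega>) = shift (i + j) \<omega>"
  by (auto simp: shift_def algebra_simps)

lemma shift_0[simp]: "shift 0 \<omega> = \<omega>"
  by (auto simp: shift_def)

lemma titer_add: "titer T (m + n) \<omega> z = titer T n (shift (int m) \<omega>) (titer T m \<omega> z)"
  by (induction n) (simp_all add: add.commute)

lemma eSuc_INF_enat: "(INF n\<in>X. enat (Suc n)) = eSuc (INF n\<in>X. enat n)"
proof (rule antisym)
  show "(INF n\<in>X. enat (Suc n)) \<le> eSuc (INF n\<in>X. enat n)"
  proof (cases "X = {}")
    case False
    then have "(INF n\<in>X. enat n) \<in> enat ` X"
      by (metis (no_types, lifting) Inf_enat_def LeastI_ex ex_in_conv image_is_empty)
    then obtain n where n: "n \<in> X" "(INF n\<in>X. enat n) = enat n" by auto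
    then show ?thesis by (auto simp: eSuc_enat intro!: INF_lower2[of n])
  qed (simp add: top_enat_def)
  show "eSuc (INF n\<in>X. enat n) \<le> (INF n\<in>X. enat (Suc n))"
    by (intro INF_greatest) (auto simp: eSuc_enat[symmetric] intro: INF_lower)
qed

text \<open>Splitting off the index 0 from the infimum gives a recursion along returns, the form in
  which separation times are used from here on.\<close>

lemma sep_unfold:
  "sep T q1 q2 = (if same_cell T q1 q2 then eSuc (sep T (retmap T q1) (retmap T q2)) else 0)"
proof -
  define P where "P n \<longleftrightarrow> same_cell T ((retmap T ^^ n) q1) ((retmap T ^^ n) q2)" for n
  have s: "sep T q1 q2 = (INF n\<in>{n. \<not> P n}. enat n)" unfolding sep_def P_def ..
  have s': "sep T (retmap T q1) (retmap T q2) = (INF n\<in>{n. \<not> P (Suc n)}. enat n)"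
    unfolding sep_def P_def by (simp add: funpow_swap1)
  show ?thesis
  proof (cases "P 0")
    case True
    then have "{n. \<not> P n} = Suc ` {n. \<not> P (Suc n)}"
      by (auto simp: image_iff) (metis not0_implies_Suc)
    then have "sep T q1 q2 = (INF n\<in>{n. \<not> P (Suc n)}. enat (Suc n))"
      unfolding s by (simp add: image_image)
    then show ?thesis unfolding eSuc_INF_enat s' using True by (simp add: P_def)
  next
    case False
    then have "(INF n\<in>{n. \<not> P n}. enat n) \<le> enat 0" by (intro INF_lower) auto
    then show ?thesis using False s by (simp add: P_def zero_enat_def[symmetric])
  qed
qed

lemma epow_eSuc[simp]: "epow \<gamma> (eSuc s) = \<gamma> * epow \<gamma> s"
  by (cases s) (simp_all add: epow_def eSuc_enat)

lemma epow_nonneg: "0 \<le> \<gamma> \<Longrightarrow> 0 \<le> epow \<gamma> s"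
  and epow_le_1: "0 \<le> \<gamma> \<Longrightarrow> \<gamma> \<le> 1 \<Longrightarrow> epow \<gamma> s \<le> 1"
  by (cases s; simp add: epow_def power_le_one)+

lemma epow_le_power:
  assumes "0 \<le> \<gamma>" "\<gamma> \<le> 1" "enat n \<le> s" shows "epow \<gamma> s \<le> \<gamma> ^ n"
  using assms by (cases s) (auto simp: epow_def power_decreasing)

locale tower =
  fixes T :: "('u::topological_space, 'x) random_tower" and \<gamma> :: real
  assumes setting: "random_tower_setting T" and branches: "full_branches T"
    and distortion: "bounded_distortion T \<gamma>"
begin

abbreviation "\<Lambda> \<equiv> base T"
abbreviation "lam \<equiv> restrict_space (refm T) (base T)"
abbreviation "R \<equiv> rtime T"
abbreviation "cells \<equiv> basecells T"

definition gmap :: "(int \<Rightarrow> 'u) \<Rightarrow> 'x \<Rightarrow> 'x" where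
  "gmap \<omega> x = fiter T (R \<omega> x) \<omega> x"

lemma \<Lambda>_sets[measurable]: "\<Lambda> \<in> sets (refm T)"
  and \<Lambda>_mass: "emeasure (refm T) \<Lambda> = 1"
  using setting by (auto simp: random_tower_setting_def)

lemma \<Lambda>_space: "\<Lambda> \<subseteq> space (refm T)"
  using sets.sets_into_space[OF \<Lambda>_sets] .

lemma space_lam[simp]: "space lam = \<Lambda>"
  using \<Lambda>_space by (auto simp: space_restrict_space)

lemma prob_space_lam: "prob_space lam"
  by (rule prob_spaceI) (simp add: emeasure_restrict_space \<Lambda>_mass)

lemma sets_lam: "A \<in> sets lam \<longleftrightarrow> A \<in> sets (refm T) \<and> A \<subseteq> \<Lambda>"
  by (subst sets_restrict_space_iff) (auto simp: Int_absorb2[OF \<Lambda>_space])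

lemma emeasure_lam: "A \<subseteq> \<Lambda> \<Longrightarrow> emeasure lam A = emeasure (refm T) A"
  by (intro emeasure_restrict_space) (simp_all add: Int_absorb2[OF \<Lambda>_space])

lemma fibres_shift[simp]: "shift k \<omega> \<in> fibres T \<longleftrightarrow> \<omega> \<in> fibres T"
proof -
  have 1: "shift 1 \<omega> \<in> fibres T \<longleftrightarrow> \<omega> \<in> fibres T" for \<omega>
    using setting by (auto simp: random_tower_setting_def)
  have n: "shift (int n) \<omega> \<in> fibres T \<longleftrightarrow> \<omega> \<in> fibres T" for n \<omega>
  proof (induction n)
    case (Suc n)
    then show ?case using 1[of "shift (int n) \<omega>"] by (simp add: add.commute)
  qed simp
  show ?thesis
  proof (cases "0 \<le> k")
    case True
    then show ?thesis using n[of "nat k" \<omega>] by simp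
  next
    case False
    then show ?thesis using n[of "nat (-k)" "shift k \<omega>"] by simp
  qed
qed

lemma cells_partition: "\<omega> \<in> fibres T \<Longrightarrow> partition_on \<Lambda> (cells \<omega>)"
  and cells_countable: "\<omega> \<in> fibres T \<Longrightarrow> countable (cells \<omega>)"
  and cells_sets: "\<omega> \<in> fibres T \<Longrightarrow> A \<in> cells \<omega> \<Longrightarrow> A \<in> sets (refm T)"
  and R_pos: "\<omega> \<in> fibres T \<Longrightarrow> x \<in> \<Lambda> \<Longrightarrow> 0 < R \<omega> x"
  and R_const: "\<omega> \<in> fibres T \<Longrightarrow> A \<in> cells \<omega> \<Longrightarrow> x \<in> A \<Longrightarrow> y \<in> A \<Longrightarrow> R \<omega> x = R \<omega> y"
proof -
  have *: "\<forall>\<omega>\<in>fibres T.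
        partition_on (base T) (basecells T \<omega>) \<and> countable (basecells T \<omega>) \<and>
        basecells T \<omega> \<subseteq> sets (refm T) \<and>
        (\<forall>x\<in>base T. 1 \<le> rtime T \<omega> x) \<and>
        (\<forall>A\<in>basecells T \<omega>. \<forall>x\<in>A. \<forall>y\<in>A. rtime T \<omega> x = rtime T \<omega> y)"
    using setting unfolding random_tower_setting_def by (elim conjE) assumption
  then show "\<omega> \<in> fibres T \<Longrightarrow> partition_on \<Lambda> (cells \<omega>)" "\<omega> \<in> fibres T \<Longrightarrow> countable (cells \<omega>)"
    "\<omega> \<in> fibres T \<Longrightarrow> A \<in> cells \<omega> \<Longrightarrow> A \<in> sets (refm T)"
    "\<omega> \<in> fibres T \<Longrightarrow> A \<in> cells \<omega> \<Longrightarrow> x \<in> A \<Longrightarrow> y \<in> A \<Longrightarrow> R \<omega> x = R \<omega> y"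
    by blast+
  show "\<omega> \<in> fibres T \<Longrightarrow> x \<in> \<Lambda> \<Longrightarrow> 0 < R \<omega> x" using * by (auto simp: Suc_le_eq)
qed

lemma cells_subset: "\<omega> \<in> fibres T \<Longrightarrow> A \<in> cells \<omega> \<Longrightarrow> A \<subseteq> \<Lambda>"
  and cells_Union: "\<omega> \<in> fibres T \<Longrightarrow> \<Union>(cells \<omega>) = \<Lambda>"
  using cells_partition by (auto simp: partition_on_def)

lemma cells_unique:
  "\<omega> \<in> fibres T \<Longrightarrow> A \<in> cells \<omega> \<Longrightarrow> B \<in> cells \<omega> \<Longrightarrow> x \<in> A \<Longrightarrow> x \<in> B \<Longrightarrow> A = B"
  using cells_partition[of \<omega>] by (auto simp: partition_on_def disjoint_def)

lemma cells_sets_lam: "\<omega> \<in> fibres T \<Longrightarrow> A \<in> cells \<omega> \<Longrightarrow> A \<in> sets lam"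
  using cells_sets cells_subset by (auto simp: sets_lam)

lemma measurable_on_cells:
  assumes "\<omega> \<in> fibres T" "\<And>A. A \<in> cells \<omega> \<Longrightarrow> f \<in> measurable (restrict_space lam A) N"
  shows "f \<in> measurable lam N"
proof (rule measurable_piecewise_restrict[of "cells \<omega>"])
  show "A \<inter> space lam \<in> sets lam" if "A \<in> cells \<omega>" for A
    by (intro sets.Int[OF cells_sets_lam[OF assms(1) that] sets.top])
qed (use assms cells_countable cells_Union in auto)

lemma R_meas: "\<omega> \<in> fibres T \<Longrightarrow> R \<omega> \<in> measurable lam (count_space UNIV)"
proof (rule measurable_on_cells)
  fix A assume A: "\<omega> \<in> fibres T" "A \<in> cells \<omega>"
  have "A \<noteq> {}" using partition_onD3[OF cells_partition[OF A(1)]] A(2) by auto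
  then obtain x where x: "x \<in> A" by blast
  have "(\<lambda>_. R \<omega> x) \<in> measurable (restrict_space lam A) (count_space UNIV)" by simp
  then show "R \<omega> \<in> measurable (restrict_space lam A) (count_space UNIV)"
    by (rule measurable_cong[THEN iffD1, rotated]) (simp add: space_restrict_space R_const[OF A x])
qed

lemma Tower_iff: "\<omega> \<in> fibres T \<Longrightarrow> (x, l) \<in> Tower T \<omega> \<longleftrightarrow> x \<in> \<Lambda> \<and> l < R (shift (- int l) \<omega>) x"
  using cells_Union by (auto simp: Tower_def)

lemma tmap_up:
  assumes "Suc l < R (shift (- int l) \<omega>) x"
  shows "tmap T \<omega> (x, l) = (x, Suc l)"
  using assms by (simp add: tmap_def)

lemma tmap_return:
  assumes "R (shift (- int l) \<omega>) x = Suc l"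
  shows "tmap T \<omega> (x, l) = (gmap (shift (- int l) \<omega>) x, 0)"
  using assms by (simp add: tmap_def gmap_def)

text \<open>A point at level \<open>l\<close> is placed in the fibre
  \<open>shift (int l) \<omega>\<close>, where \<omega> is the fibre in which it left the base. Its
  return time is then \<open>R \<omega> x\<close> at all levels.\<close>

lemma titer_up: "l + k < R \<omega> x \<Longrightarrow> titer T k (shift (int l) \<omega>) (x, l) = (x, l + k)"
proof (induction k)
  case (Suc k)
  then show ?case using tmap_up[of "l + k" "shift (int k + int l) \<omega>" x] by simp
qed simp

lemma titer_return:
  assumes "l < R \<omega> x"
  shows "titer T (R \<omega> x - l) (shift (int l) \<omega>) (x, l) = (gmap \<omega> x, 0)"
proof -
  define k where "k = R \<omega> x - Suc l"
  have k: "R \<omega> x - l = Suc k" "R \<omega> x = Suc (l + k)" unfolding k_def using assms by auto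
  show ?thesis unfolding k(1) using titer_up[of l k \<omega> x] tmap_return[of "l + k" "shift (int k + int l) \<omega>" x] k(2) by simp
qed

lemma rettime_eq:
  assumes "l < R \<omega> x"
  shows "rettime T (shift (int l) \<omega>) (x, l) = R \<omega> x - l"
  unfolding rettime_def
proof (rule Least_equality)
  show "0 < R \<omega> x - l \<and> snd (titer T (R \<omega> x - l) (shift (int l) \<omega>) (x, l)) = 0"
    using assms titer_return[OF assms] by simp
  fix k assume k: "0 < k \<and> snd (titer T k (shift (int l) \<omega>) (x, l)) = 0"
  show "R \<omega> x - l \<le> k"
  proof (rule ccontr)
    assume "\<not> R \<omega> x - l \<le> k"
    then show False using titer_up[of l k \<omega> x] k by simp
  qed
qed

lemma retmap_eq:
  assumes "l < R \<omega> x"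
  shows "retmap T (shift (int l) \<omega>, (x, l)) = (shift (int (R \<omega> x)) \<omega>, (gmap \<omega> x, 0))"
  unfolding retmap_def using rettime_eq[OF assms] titer_return[OF assms] assms by (simp add: of_nat_diff)

lemma titer_base: "x \<in> \<Lambda> \<Longrightarrow> \<omega> \<in> fibres T \<Longrightarrow> titer T (R \<omega> x) \<omega> (x, 0) = (gmap \<omega> x, 0)"
  using titer_return[of 0 \<omega> x] R_pos by simp

text \<open>Below the return time \<open>titer\<close> only raises the level, so the images that
  define the partition are plain copies of base cells.\<close>

lemma tcells_eq:
  assumes "\<omega> \<in> fibres T"
  shows "tcells T \<omega> = {A \<times> {l} | l A. A \<in> cells (shift (- int l) \<omega>) \<and> (\<forall>x\<in>A. l < R (shift (- int l) \<omega>) x)}"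
proof -
  have "titer T l (shift (- int l) \<omega>) ` (A \<times> {0}) = A \<times> {l}"
    if "\<forall>x\<in>A. l + 1 \<le> R (shift (- int l) \<omega>) x" for l A
  proof -
    have "titer T l (shift (- int l) \<omega>) (x, 0) = (x, l)" if "x \<in> A" for x
      using titer_up[of 0 l "shift (- int l) \<omega>" x] that \<open>\<forall>x\<in>A. _ x\<close> by (auto simp: Suc_le_eq)
    then show ?thesis by force
  qed
  then have *: "(\<forall>x\<in>A. l + 1 \<le> R (shift (- int l) \<omega>) x) \<Longrightarrow> titer T l (shift (- int l) \<omega>) ` (A \<times> {0}) = A \<times> {l}" for l A
    by blast
  show ?thesis
  proof (intro set_eqI iffI)
    fix I assume "I \<in> tcells T \<omega>"
    then obtain l A where "I = titer T l (shift (- int l) \<omega>) ` (A \<times> {0})" "A \<in> cells (shift (- int l) \<omega>)"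
      "\<forall>x\<in>A. l + 1 \<le> R (shift (- int l) \<omega>) x"
      unfolding tcells_def by blast
    then show "I \<in> {A \<times> {l} | l A. A \<in> cells (shift (- int l) \<omega>) \<and> (\<forall>x\<in>A. l < R (shift (- int l) \<omega>) x)}"
      using *[of A l] unfolding mem_Collect_eq by (intro exI[of _ l] exI[of _ A]) (simp add: Suc_le_eq)
  next
    fix I assume "I \<in> {A \<times> {l} | l A. A \<in> cells (shift (- int l) \<omega>) \<and> (\<forall>x\<in>A. l < R (shift (- int l) \<omega>) x)}"
    then obtain l A where "I = A \<times> {l}" "A \<in> cells (shift (- int l) \<omega>)" "\<forall>x\<in>A. l < R (shift (- int l) \<omega>) x"
      by blast
    then show "I \<in> tcells T \<omega>"
      using *[of A l] unfolding tcells_def by (auto simp: Suc_le_eq intro!: exI[of _ l] exI[of _ A])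
  qed
qed

section \<open>Separation of points in a common cell\<close>

lemma same_cell_eq:
  assumes "\<omega> \<in> fibres T"
  shows "same_cell T (shift (int l) \<omega>, (x, l)) (shift (int l) \<omega>, (y, l)) \<longleftrightarrow>
     (\<exists>A\<in>cells \<omega>. x \<in> A \<and> y \<in> A \<and> l < R \<omega> x)"
proof -
  have tc: "tcells T (shift (int l) \<omega>) = {A \<times> {k} | k A. A \<in> cells (shift (int l - int k) \<omega>) \<and>
      (\<forall>x\<in>A. k < R (shift (int l - int k) \<omega>) x)}"
    using tcells_eq[of "shift (int l) \<omega>"] assms by simp
  have sc: "same_cell T (shift (int l) \<omega>, (x, l)) (shift (int l) \<omega>, (y, l)) \<longleftrightarrow>
     (\<exists>I\<in>tcells T (shift (int l) \<omega>). (x, l) \<in> I \<and> (y, l) \<in> I)"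
    unfolding same_cell_def by simp
  show ?thesis
  proof
    assume "same_cell T (shift (int l) \<omega>, (x, l)) (shift (int l) \<omega>, (y, l))"
    then obtain k A where A: "A \<in> cells (shift (int l - int k) \<omega>)"
      "\<forall>x\<in>A. k < R (shift (int l - int k) \<omega>) x" "(x, l) \<in> A \<times> {k}" "(y, l) \<in> A \<times> {k}"
      unfolding sc tc by blast
    then have "k = l" by simp
    then show "\<exists>A\<in>cells \<omega>. x \<in> A \<and> y \<in> A \<and> l < R \<omega> x"
      using A by (intro bexI[of _ A]) simp_all
  next
    assume "\<exists>A\<in>cells \<omega>. x \<in> A \<and> y \<in> A \<and> l < R \<omega> x"
    then obtain A where A: "A \<in> cells \<omega>" "x \<in> A" "y \<in> A" "l < R \<omega> x" by blast
    have "\<forall>z\<in>A. l < R \<omega> z"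
    proof
      fix z assume "z \<in> A"
      then show "l < R \<omega> z" using R_const[OF assms A(1) _ A(2), of z] A(4) by simp
    qed
    then have "A \<times> {l} \<in> tcells T (shift (int l) \<omega>)"
      unfolding tc mem_Collect_eq using A(1) by (intro exI[of _ l] exI[of _ A]) simp
    then show "same_cell T (shift (int l) \<omega>, (x, l)) (shift (int l) \<omega>, (y, l))"
      unfolding sc using A(2,3) by (intro bexI[of _ "A \<times> {l}"]) simp_all
  qed
qed

text \<open>The weight that plays the role of \<open>d\<close> in the renewal locale.\<close>

definition bsep :: "(int \<Rightarrow> 'u) \<Rightarrow> 'x \<Rightarrow> 'x \<Rightarrow> real" where
  "bsep \<omega> x y = epow \<gamma> (sep T (\<omega>, (x, 0)) (\<omega>, (y, 0)))"

lemma \<gamma>_range: "0 < \<gamma>" "\<gamma> < 1"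
  using distortion by (auto simp: bounded_distortion_def)

lemma bsep_range: "0 \<le> bsep \<omega> x y" "bsep \<omega> x y \<le> 1"
  unfolding bsep_def using \<gamma>_range epow_nonneg epow_le_1 by auto

lemma same_cell_sym: "same_cell T q1 q2 \<longleftrightarrow> same_cell T q2 q1"
  unfolding same_cell_def by (cases q1; cases q2) auto

lemma sep_sym: "sep T q1 q2 = sep T q2 q1"
  unfolding sep_def using same_cell_sym by simp

lemma bsep_sym: "bsep \<omega> x y = bsep \<omega> y x"
  unfolding bsep_def by (simp only: sep_sym)

lemma epow_sep_cell:
  assumes "\<omega> \<in> fibres T" "A \<in> cells \<omega>" "x \<in> A" "y \<in> A" "l < R \<omega> x"
  shows "epow \<gamma> (sep T (shift (int l) \<omega>, (x, l)) (shift (int l) \<omega>, (y, l)))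
     = \<gamma> * bsep (shift (int (R \<omega> x)) \<omega>) (gmap \<omega> x) (gmap \<omega> y)"
proof -
  have Ry: "R \<omega> y = R \<omega> x" using R_const assms by metis
  have "same_cell T (shift (int l) \<omega>, (x, l)) (shift (int l) \<omega>, (y, l))"
    using assms same_cell_eq by blast
  then show ?thesis
    by (subst sep_unfold) (simp add: retmap_eq assms Ry bsep_def)
qed

text \<open>Two points of one cell survive the index 0, so their images have one return less to
  separate. The factor \<gamma> is the gain of regularity under the transfer operator.\<close>

lemma bsep_cell:
  assumes "\<omega> \<in> fibres T" "A \<in> cells \<omega>" "x \<in> A" "y \<in> A"
  shows "bsep \<omega> x y = \<gamma> * bsep (shift (int (R \<omega> x)) \<omega>) (gmap \<omega> x) (gmap \<omega> y)"
  using epow_sep_cell[OF assms, of 0] R_pos[OF assms(1)] cells_subset[OF assms(1,2)] assms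
  unfolding bsep_def by auto

text \<open>Separation is counted in returns, not in steps, so lifting both points to a common level
  does not change it.\<close>

lemma epow_sep_level:
  assumes "\<omega> \<in> fibres T" "A \<in> cells \<omega>" "x \<in> A" "y \<in> A" "l < R \<omega> x"
  shows "epow \<gamma> (sep T (shift (int l) \<omega>, (x, l)) (shift (int l) \<omega>, (y, l))) = bsep \<omega> x y"
  using epow_sep_cell[OF assms] bsep_cell[OF assms(1-4)] by simp

section \<open>The branches of the return map and their Jacobians\<close>

lemma gmap_bij: "\<omega> \<in> fibres T \<Longrightarrow> A \<in> cells \<omega> \<Longrightarrow> bij_betw (gmap \<omega>) A \<Lambda>"
proof -
  assume a: "\<omega> \<in> fibres T" "A \<in> cells \<omega>"
  have "bij_betw (\<lambda>x. titer T (R \<omega> x) \<omega> (x, 0)) A (\<Lambda> \<times> {0})"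
    using branches a by (auto simp: full_branches_def)
  then have "bij_betw (\<lambda>x. (gmap \<omega> x, 0::nat)) A (\<Lambda> \<times> {0})"
    by (rule bij_betw_cong[THEN iffD1, rotated]) (use a cells_subset[OF a] titer_base in blast)
  moreover have "bij_betw fst (\<Lambda> \<times> {0::nat}) \<Lambda>" by (auto simp: bij_betw_def inj_on_def image_iff)
  ultimately have "bij_betw (fst \<circ> (\<lambda>x. (gmap \<omega> x, 0::nat))) A \<Lambda>" by (rule bij_betw_trans)
  then show ?thesis by (simp add: o_def)
qed

abbreviation ginv :: "(int \<Rightarrow> 'u) \<Rightarrow> 'x set \<Rightarrow> 'x \<Rightarrow> 'x" where
  "ginv \<omega> A \<equiv> the_inv_into A (gmap \<omega>)"

lemma ginv:
  assumes "\<omega> \<in> fibres T" "A \<in> cells \<omega>" "y \<in> \<Lambda>"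
  shows "ginv \<omega> A y \<in> A" "gmap \<omega> (ginv \<omega> A y) = y"
proof -
  have b: "inj_on (gmap \<omega>) A" "gmap \<omega> ` A = \<Lambda>"
    using gmap_bij[OF assms(1,2)] by (simp_all add: bij_betw_def)
  show "ginv \<omega> A y \<in> A" by (rule the_inv_into_into[OF b(1) _ subset_refl]) (use b assms in simp)
  show "gmap \<omega> (ginv \<omega> A y) = y" by (rule f_the_inv_into_f[OF b(1)]) (use b assms in simp)
qed

lemma ginv_gmap: "\<omega> \<in> fibres T \<Longrightarrow> A \<in> cells \<omega> \<Longrightarrow> x \<in> A \<Longrightarrow> ginv \<omega> A (gmap \<omega> x) = x"
  by (rule the_inv_into_f_f[OF bij_betw_imp_inj_on[OF gmap_bij]])

end

text \<open>Fixes one distortion constant and one version of the Jacobian per cell. The one-sided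
  form of the distortion bound loses nothing, because \<open>x\<close> and \<open>y\<close> may be
  exchanged.\<close>

locale tower_jac = tower T \<gamma>
  for T :: "('u::topological_space, 'x) random_tower" and \<gamma> :: real +
  fixes D :: real and J :: "(int \<Rightarrow> 'u) \<Rightarrow> 'x set \<Rightarrow> 'x \<Rightarrow> real"
  assumes gmap_cell_meas: "\<omega> \<in> fibres T \<Longrightarrow> A \<in> cells \<omega> \<Longrightarrow> gmap \<omega> \<in> measurable (restrict_space lam A) lam"
    and ginv_meas: "\<omega> \<in> fibres T \<Longrightarrow> A \<in> cells \<omega> \<Longrightarrow> ginv \<omega> A \<in> measurable lam (restrict_space lam A)"
    and jac: "\<omega> \<in> fibres T \<Longrightarrow> A \<in> cells \<omega> \<Longrightarrow> jacobian (restrict_space lam A) lam (gmap \<omega>) (J \<omega> A)"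
    and J_pos: "\<omega> \<in> fibres T \<Longrightarrow> A \<in> cells \<omega> \<Longrightarrow> x \<in> A \<Longrightarrow> 0 < J \<omega> A x"
    and J_dist: "\<omega> \<in> fibres T \<Longrightarrow> A \<in> cells \<omega> \<Longrightarrow> x \<in> A \<Longrightarrow> y \<in> A \<Longrightarrow>
      J \<omega> A x / J \<omega> A y \<le> 1 + D * bsep (shift (int (R \<omega> x)) \<omega>) (gmap \<omega> x) (gmap \<omega> y)"

context tower begin

lemma tower_jac_exists: "\<exists>D J. tower_jac T \<gamma> D J"
proof -
  obtain D where dist: "\<forall>\<omega>\<in>fibres T. \<forall>A\<in>cells \<omega>.
        let g = (\<lambda>x. fst (titer T (rtime T \<omega> x) \<omega> (x, 0)));
            mA = restrict_space (refm T) A; mB = restrict_space (refm T) (base T)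
        in nonsingular mA mB g \<and> nonsingular mB mA (the_inv_into A g) \<and>
           (\<exists>J. jacobian mA mB g J \<and> (\<forall>x\<in>A. 0 < J x) \<and>
              (\<forall>x\<in>A. \<forall>y\<in>A. \<bar>J x / J y - 1\<bar> \<le>
                 D * epow \<gamma> (sep T
                   (shift (int (rtime T \<omega> x)) \<omega>, titer T (rtime T \<omega> x) \<omega> (x, 0))
                   (shift (int (rtime T \<omega> y)) \<omega>, titer T (rtime T \<omega> y) \<omega> (y, 0)))))"
    using distortion unfolding bounded_distortion_def by blast
  have *: "gmap \<omega> \<in> measurable (restrict_space lam A) lam \<and> ginv \<omega> A \<in> measurable lam (restrict_space lam A) \<and>
     (\<exists>J. jacobian (restrict_space lam A) lam (gmap \<omega>) J \<and> (\<forall>x\<in>A. 0 < J x) \<and>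
       (\<forall>x\<in>A. \<forall>y\<in>A. J x / J y \<le> 1 + D * bsep (shift (int (R \<omega> x)) \<omega>) (gmap \<omega> x) (gmap \<omega> y)))"
    if \<omega>: "\<omega> \<in> fibres T" and A: "A \<in> cells \<omega>" for \<omega> A
  proof -
    let ?g = "\<lambda>x. fst (titer T (rtime T \<omega> x) \<omega> (x, 0))"
    have sub: "A \<subseteq> \<Lambda>" using cells_subset[OF \<omega> A] .
    have g: "?g x = gmap \<omega> x" if "x \<in> A" for x using titer_base[of x \<omega>] that sub \<omega> by auto
    have mA: "restrict_space (refm T) A = restrict_space lam A"
      using sub \<Lambda>_space cells_sets[OF \<omega> A]
      by (subst restrict_restrict_space) (auto simp: Int_absorb1 Int_absorb2 sets.Int)
    have spA: "space (restrict_space lam A) = A" using sub by (auto simp: space_restrict_space)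
    \<comment> \<open>The inverse looks at its function on \<open>A\<close> only, where the return
      by \<open>titer\<close> and \<open>gmap\<close> agree.\<close>
    have inv: "the_inv_into A ?g = ginv \<omega> A"
      unfolding the_inv_into_def by (intro ext arg_cong[where f=The] conj_cong refl) (simp add: g)
    note dist' = bspec[OF bspec[OF dist \<omega>] A, unfolded Let_def mA inv]
    have ns: "nonsingular (restrict_space lam A) lam ?g" "nonsingular lam (restrict_space lam A) (ginv \<omega> A)"
      using conjunct1[OF dist'] conjunct1[OF conjunct2[OF dist']] .
    from conjunct2[OF conjunct2[OF dist']] obtain J where
      J: "jacobian (restrict_space lam A) lam ?g J" "\<forall>x\<in>A. 0 < J x"
      and d: "\<And>x y. x \<in> A \<Longrightarrow> y \<in> A \<Longrightarrow> \<bar>J x / J y - 1\<bar> \<le>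
                 D * epow \<gamma> (sep T
                   (shift (int (rtime T \<omega> x)) \<omega>, titer T (rtime T \<omega> x) \<omega> (x, 0))
                   (shift (int (rtime T \<omega> y)) \<omega>, titer T (rtime T \<omega> y) \<omega> (y, 0)))"
      by (elim exE conjE) simp
    have "gmap \<omega> \<in> measurable (restrict_space lam A) lam"
      using ns(1) unfolding nonsingular_def
      by (auto intro: measurable_cong[THEN iffD1, rotated] simp: spA g)
    moreover have "ginv \<omega> A \<in> measurable lam (restrict_space lam A)"
      using ns(2) unfolding nonsingular_def by blast
    moreover have "jacobian (restrict_space lam A) lam (gmap \<omega>) J"
    proof -
      have "?g ` B = gmap \<omega> ` B" if "B \<in> sets (restrict_space lam A)" for B
        using sets.sets_into_space[OF that] g unfolding spA by (intro image_cong) auto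
      then show ?thesis using J(1) unfolding jacobian_def by auto
    qed
    moreover have "J x / J y \<le> 1 + D * bsep (shift (int (R \<omega> x)) \<omega>) (gmap \<omega> x) (gmap \<omega> y)"
      if xy: "x \<in> A" "y \<in> A" for x y
    proof -
      have "R \<omega> y = R \<omega> x" using R_const[OF \<omega> A xy(2,1)] .
      moreover have "titer T (R \<omega> x) \<omega> (x, 0) = (gmap \<omega> x, 0)" "titer T (R \<omega> y) \<omega> (y, 0) = (gmap \<omega> y, 0)"
        using titer_base xy sub \<omega> by blast+
      ultimately have "\<bar>J x / J y - 1\<bar> \<le> D * bsep (shift (int (R \<omega> x)) \<omega>) (gmap \<omega> x) (gmap \<omega> y)"
        using d[OF xy] unfolding bsep_def by (simp only:)
      then show ?thesis by linarith
    qed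
    ultimately show ?thesis using J(2) by blast
  qed
  \<comment> \<open>The Jacobian and its distortion bound must be chosen together, since the bound
    holds for a suitable version only.\<close>
  define J where "J \<omega> A = (SOME J. jacobian (restrict_space lam A) lam (gmap \<omega>) J \<and> (\<forall>x\<in>A. 0 < J x) \<and>
       (\<forall>x\<in>A. \<forall>y\<in>A. J x / J y \<le> 1 + D * bsep (shift (int (R \<omega> x)) \<omega>) (gmap \<omega> x) (gmap \<omega> y)))" for \<omega> A
  have J: "jacobian (restrict_space lam A) lam (gmap \<omega>) (J \<omega> A) \<and> (\<forall>x\<in>A. 0 < J \<omega> A x) \<and>
       (\<forall>x\<in>A. \<forall>y\<in>A. J \<omega> A x / J \<omega> A y \<le> 1 + D * bsep (shift (int (R \<omega> x)) \<omega>) (gmap \<omega> x) (gmap \<omega> y))"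
    if "\<omega> \<in> fibres T" "A \<in> cells \<omega>" for \<omega> A
    unfolding J_def by (rule someI_ex[OF conjunct2[OF conjunct2[OF *[OF that]]]])
  show ?thesis
  proof (intro exI[of _ D] exI[of _ J] tower_jac.intro tower_axioms tower_jac_axioms.intro)
    fix \<omega> A assume \<omega>A: "\<omega> \<in> fibres T" "A \<in> cells \<omega>"
    show "gmap \<omega> \<in> measurable (restrict_space lam A) lam" using *[OF \<omega>A] by (rule conjunct1)
    show "ginv \<omega> A \<in> measurable lam (restrict_space lam A)" using *[OF \<omega>A] by (elim conjE)
    show "jacobian (restrict_space lam A) lam (gmap \<omega>) (J \<omega> A)" using J[OF \<omega>A] by (elim conjE)
  next
    fix \<omega> A x assume "\<omega> \<in> fibres T" "A \<in> cells \<omega>" "x \<in> A"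
    then show "0 < J \<omega> A x" using J by simp
  next
    fix \<omega> A x y assume "\<omega> \<in> fibres T" "A \<in> cells \<omega>" "x \<in> A" "y \<in> A"
    then show "J \<omega> A x / J \<omega> A y \<le> 1 + D * bsep (shift (int (R \<omega> x)) \<omega>) (gmap \<omega> x) (gmap \<omega> y)" using J by simp
  qed
qed

lemma gmap_meas:
  assumes "\<omega> \<in> fibres T"
  shows "gmap \<omega> \<in> measurable lam lam"
proof -
  obtain D J where "tower_jac T \<gamma> D J" using tower_jac_exists by blast
  then show ?thesis by (intro measurable_on_cells[OF assms] tower_jac.gmap_cell_meas[OF _ assms])
qed

section \<open>Measurability and integration on the tower, level by level\<close>

lemma count_nat_sigma_finite: "sigma_finite_measure (count_space (UNIV :: nat set))"
  by (rule sigma_finite_measure_count_space)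

lemma level_set: "\<omega> \<in> fibres T \<Longrightarrow> {x \<in> \<Lambda>. l < R (shift k \<omega>) x} \<in> sets (refm T)"
proof -
  assume "\<omega> \<in> fibres T"
  then have [measurable]: "R (shift k \<omega>) \<in> measurable lam (count_space UNIV)" by (intro R_meas) simp
  have "{x \<in> space lam. l < R (shift k \<omega>) x} \<in> sets lam" by measurable
  then show ?thesis by (simp add: sets_lam)
qed

lemma Tower_eq: "\<omega> \<in> fibres T \<Longrightarrow> Tower T \<omega> = (\<Union>l. {x \<in> \<Lambda>. l < R (shift (- int l) \<omega>) x} \<times> {l})"
  using Tower_iff[of \<omega>] by auto

lemma Tower_sets: "\<omega> \<in> fibres T \<Longrightarrow> Tower T \<omega> \<in> sets (refm T \<Otimes>\<^sub>M count_space UNIV)"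
  unfolding Tower_eq by (intro sets.countable_UN') (auto intro!: pair_measureI level_set)

lemma space_tmeas: "\<omega> \<in> fibres T \<Longrightarrow> space (tmeas T \<omega>) = Tower T \<omega>"
  unfolding tmeas_def using sets.sets_into_space[OF Tower_sets] by (auto simp: space_restrict_space)

lemma sets_tmeas:
  "\<omega> \<in> fibres T \<Longrightarrow> B \<in> sets (tmeas T \<omega>) \<longleftrightarrow> B \<subseteq> Tower T \<omega> \<and> B \<in> sets (refm T \<Otimes>\<^sub>M count_space UNIV)"
  unfolding tmeas_def by (subst sets_restrict_space_iff) (auto intro: Tower_sets)

lemma level_in_tmeas:
  assumes "\<omega> \<in> fibres T" "B \<in> sets lam" "\<And>x. x \<in> B \<Longrightarrow> l < R (shift (- int l) \<omega>) x"
  shows "B \<times> {l} \<in> sets (tmeas T \<omega>)"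
proof -
  have "B \<times> {l} \<subseteq> Tower T \<omega>" using assms(2,3) Tower_iff[OF assms(1)] by (auto simp: sets_lam)
  moreover have "B \<times> {l} \<in> sets (refm T \<Otimes>\<^sub>M count_space UNIV)"
    using assms(2) by (intro pair_measureI) (auto simp: sets_lam)
  ultimately show ?thesis unfolding sets_tmeas[OF assms(1)] by blast
qed

lemma section_in_lam:
  assumes "\<omega> \<in> fibres T" "B \<in> sets (tmeas T \<omega>)"
  shows "{x. (x, l) \<in> B} \<in> sets lam"
proof -
  have B: "B \<subseteq> Tower T \<omega>" "B \<in> sets (refm T \<Otimes>\<^sub>M count_space UNIV)"
    using assms(2) unfolding sets_tmeas[OF assms(1)] by simp_all
  have "(\<lambda>x. (x, l)) -` B \<in> sets (refm T)" by (rule sets_Pair2[OF B(2)])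
  moreover have "{x. (x, l) \<in> B} \<subseteq> \<Lambda>" using B(1) Tower_iff[OF assms(1)] by auto
  ultimately show ?thesis unfolding sets_lam by (simp add: vimage_def)
qed

lemma in_tmeas_iff:
  assumes "\<omega> \<in> fibres T" "B \<subseteq> Tower T \<omega>" "\<And>l. {x. (x, l) \<in> B} \<in> sets lam"
  shows "B \<in> sets (tmeas T \<omega>)"
proof -
  have "B = (\<Union>l. {x. (x, l) \<in> B} \<times> {l})" by auto
  also have "\<dots> \<in> sets (tmeas T \<omega>)"
  proof (intro sets.countable_UN' image_subsetI)
    fix l
    show "{x. (x, l) \<in> B} \<times> {l} \<in> sets (tmeas T \<omega>)"
      by (rule level_in_tmeas[OF assms(1,3)]) (use assms(2) in \<open>auto simp: Tower_iff[OF assms(1)]\<close>)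
  qed simp
  finally show ?thesis .
qed

lemma tmap_in_Tower:
  assumes "\<omega> \<in> fibres T" "z \<in> Tower T \<omega>"
  shows "tmap T \<omega> z \<in> Tower T (shift 1 \<omega>)"
proof -
  obtain x l where z: "z = (x, l)" by (cases z)
  have x: "x \<in> \<Lambda>" "l < R (shift (- int l) \<omega>) x" using assms z by (auto simp: Tower_iff)
  have g: "gmap (shift (- int l) \<omega>) x \<in> \<Lambda>"
    using measurable_space[OF gmap_meas, of "shift (- int l) \<omega>" x] assms x by simp
  show ?thesis
  proof (cases "Suc l < R (shift (- int l) \<omega>) x")
    case True
    then show ?thesis using assms x z by (simp add: tmap_up Tower_iff)
  next
    case False
    then have "R (shift (- int l) \<omega>) x = Suc l" using x by simp
    then show ?thesis using assms z g R_pos[of "shift 1 \<omega>", OF _ g] by (simp add: tmap_return Tower_iff)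
  qed
qed

lemma titer_in_Tower:
  assumes "\<omega> \<in> fibres T" "z \<in> Tower T \<omega>"
  shows "titer T n \<omega> z \<in> Tower T (shift (int n) \<omega>)"
proof (induction n)
  case (Suc n)
  then show ?case using tmap_in_Tower[of "shift (int n) \<omega>"] assms by (simp add: add.commute)
qed (use assms in simp)

lemma tmap_measurable:
  assumes "\<omega> \<in> fibres T"
  shows "tmap T \<omega> \<in> measurable (tmeas T \<omega>) (tmeas T (shift 1 \<omega>))"
proof (rule measurableI)
  fix z assume "z \<in> space (tmeas T \<omega>)"
  then show "tmap T \<omega> z \<in> space (tmeas T (shift 1 \<omega>))"
    using assms tmap_in_Tower by (simp add: space_tmeas)
next
  fix B assume B: "B \<in> sets (tmeas T (shift 1 \<omega>))"
  have sec: "{x. (x, l) \<in> B} \<in> sets lam" for l using assms B by (intro section_in_lam) auto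
  show "tmap T \<omega> -` B \<inter> space (tmeas T \<omega>) \<in> sets (tmeas T \<omega>)"
  proof (rule in_tmeas_iff[OF assms])
    fix l
    let ?\<omega> = "shift (- int l) \<omega>"
    have [measurable]: "R ?\<omega> \<in> measurable lam (count_space UNIV)" "gmap ?\<omega> \<in> measurable lam lam"
      using assms by (auto intro: R_meas gmap_meas)
    have "{x. (x, l) \<in> tmap T \<omega> -` B \<inter> space (tmeas T \<omega>)} =
      {x \<in> space lam. Suc l < R ?\<omega> x} \<inter> {x. (x, Suc l) \<in> B} \<union>
      {x \<in> space lam. R ?\<omega> x = Suc l} \<inter> (gmap ?\<omega> -` {x. (x, 0) \<in> B} \<inter> space lam)"
    proof (intro set_eqI)
      fix x
      consider "Suc l < R ?\<omega> x" | "R ?\<omega> x = Suc l" | "R ?\<omega> x \<le> l" by linarith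
      then show "x \<in> {x. (x, l) \<in> tmap T \<omega> -` B \<inter> space (tmeas T \<omega>)} \<longleftrightarrow> x \<in>
        {x \<in> space lam. Suc l < R ?\<omega> x} \<inter> {x. (x, Suc l) \<in> B} \<union>
        {x \<in> space lam. R ?\<omega> x = Suc l} \<inter> (gmap ?\<omega> -` {x. (x, 0) \<in> B} \<inter> space lam)"
        using assms by cases (auto simp: space_tmeas Tower_iff tmap_up tmap_return)
    qed
    also have "\<dots> \<in> sets lam"
      by (intro sets.Un sets.Int sec measurable_sets[OF _ sec]) measurable
    finally show "{x. (x, l) \<in> tmap T \<omega> -` B \<inter> space (tmeas T \<omega>)} \<in> sets lam" .
  qed (use assms in \<open>auto simp: space_tmeas\<close>)
qed

lemma titer_measurable:
  assumes "\<omega> \<in> fibres T"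
  shows "titer T n \<omega> \<in> measurable (tmeas T \<omega>) (tmeas T (shift (int n) \<omega>))"
proof (induction n)
  case 0
  have "titer T 0 \<omega> = (\<lambda>z. z)" by auto
  then show ?case by simp
next
  case (Suc n)
  have "titer T (Suc n) \<omega> = (\<lambda>z. tmap T (shift (int n) \<omega>) (titer T n \<omega> z))" by auto
  moreover have "tmap T (shift (int n) \<omega>) \<in> measurable (tmeas T (shift (int n) \<omega>)) (tmeas T (shift (int (Suc n)) \<omega>))"
    using tmap_measurable[of "shift (int n) \<omega>"] assms by (simp add: add.commute)
  ultimately show ?case using measurable_compose[OF Suc] by simp
qed

text \<open>Converts a function on the tower into a state of the renewal equation at time 0; the
  value 0 off the tower makes the comparison inside cells valid at every level.\<close>

definition lev :: "(int \<Rightarrow> 'u) \<Rightarrow> ('x \<times> nat \<Rightarrow> ennreal) \<Rightarrow> nat \<Rightarrow> 'x \<Rightarrow> ennreal" where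
  "lev \<omega> f l x = (if (x, l) \<in> Tower T \<omega> then f (x, l) else 0)"

lemma lev_meas:
  assumes \<omega>: "\<omega> \<in> fibres T" and f: "f \<in> borel_measurable (tmeas T \<omega>)"
  shows "lev \<omega> f l \<in> borel_measurable lam"
proof (rule borel_measurableI_greater)
  fix c :: ennreal
  have "{z \<in> space (tmeas T \<omega>). c < f z} \<in> sets (tmeas T \<omega>)" using f by measurable
  then have "{x. (x, l) \<in> {z \<in> space (tmeas T \<omega>). c < f z}} \<in> sets lam" by (rule section_in_lam[OF \<omega>])
  moreover have "{x \<in> space lam. c < lev \<omega> f l x} = {x. (x, l) \<in> {z \<in> space (tmeas T \<omega>). c < f z}}"
  proof (intro set_eqI)
    fix x
    show "x \<in> {x \<in> space lam. c < lev \<omega> f l x} \<longleftrightarrow> x \<in> {x. (x, l) \<in> {z \<in> space (tmeas T \<omega>). c < f z}}"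
      using Tower_iff[OF \<omega>, of x l] by (cases "(x, l) \<in> Tower T \<omega>") (auto simp: lev_def space_tmeas[OF \<omega>])
  qed
  ultimately show "{x \<in> space lam. c < lev \<omega> f l x} \<in> sets lam" by simp
qed

text \<open>Fubini for the product with counting measure, restricted to the tower.\<close>

lemma nn_integral_tmeas:
  assumes \<omega>: "\<omega> \<in> fibres T" and f: "f \<in> borel_measurable (tmeas T \<omega>)"
  shows "(\<integral>\<^sup>+z. f z \<partial>tmeas T \<omega>) = (\<Sum>l. \<integral>\<^sup>+x. lev \<omega> f l x \<partial>lam)"
proof -
  interpret C: sigma_finite_measure "count_space (UNIV :: nat set)" by (rule count_nat_sigma_finite)
  let ?P = "refm T \<Otimes>\<^sub>M count_space (UNIV :: nat set)"
  let ?F = "\<lambda>z. f z * indicator (Tower T \<omega>) z"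
  have Ts: "Tower T \<omega> \<inter> space ?P \<in> sets ?P" using Tower_sets[OF \<omega>] by (rule sets.Int) (rule sets.top)
  have F: "?F \<in> borel_measurable ?P"
    using f unfolding tmeas_def by (subst (asm) borel_measurable_restrict_space_iff_ennreal[OF Ts])
  have "(\<integral>\<^sup>+z. f z \<partial>tmeas T \<omega>) = (\<integral>\<^sup>+z. ?F z \<partial>?P)"
    unfolding tmeas_def by (rule nn_integral_restrict_space[OF Ts])
  also have "\<dots> = (\<integral>\<^sup>+x. \<integral>\<^sup>+l. ?F (x, l) \<partial>count_space UNIV \<partial>refm T)"
    by (rule C.nn_integral_fst[OF F, symmetric])
  also have "\<dots> = (\<integral>\<^sup>+x. (\<Sum>l. ?F (x, l)) \<partial>refm T)"
    by (simp only: nn_integral_count_space_nat)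
  also have "\<dots> = (\<integral>\<^sup>+x. (\<Sum>l. lev \<omega> f l x) * indicator \<Lambda> x \<partial>refm T)"
  proof (rule nn_integral_cong)
    fix x
    have "(\<lambda>l. ?F (x, l)) = (\<lambda>l. lev \<omega> f l x * indicator \<Lambda> x)"
    proof
      fix l
      show "?F (x, l) = lev \<omega> f l x * indicator \<Lambda> x"
        using Tower_iff[OF \<omega>, of x l] by (cases "(x, l) \<in> Tower T \<omega>") (auto simp: lev_def)
    qed
    then show "(\<Sum>l. ?F (x, l)) = (\<Sum>l. lev \<omega> f l x) * indicator \<Lambda> x"
      by (simp only: ennreal_suminf_multc)
  qed
  also have "\<dots> = (\<integral>\<^sup>+x. (\<Sum>l. lev \<omega> f l x) \<partial>lam)"
    by (rule nn_integral_restrict_space[symmetric]) (simp add: Int_absorb2[OF \<Lambda>_space])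
  also have "\<dots> = (\<Sum>l. \<integral>\<^sup>+x. lev \<omega> f l x \<partial>lam)"
    by (rule nn_integral_suminf) (rule lev_meas[OF \<omega> f])
  finally show ?thesis .
qed

text \<open>A cylinder of depth \<open>n + 1\<close> consists of the points of one cell, on one
  level, that return into a given cylinder of depth \<open>n\<close>.\<close>

lemma sep_cover:
  assumes "\<omega> \<in> fibres T"
  shows "\<exists>\<Q>. countable \<Q> \<and> \<Q> \<subseteq> sets (tmeas T \<omega>) \<and> \<Union>\<Q> = Tower T \<omega> \<and>
     (\<forall>Q\<in>\<Q>. \<forall>z\<in>Q. \<forall>w\<in>Q. enat n \<le> sep T (\<omega>, z) (\<omega>, w))"
  using assms
proof (induction n arbitrary: \<omega>)
  case 0
  then show ?case
    using sets.top[of "tmeas T \<omega>"] by (intro exI[of _ "{Tower T \<omega>}"]) (auto simp: space_tmeas zero_enat_def[symmetric])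
next
  case (Suc n)
  note \<omega> = Suc.prems
  have "\<forall>k. \<exists>\<Q>. countable \<Q> \<and> \<Q> \<subseteq> sets (tmeas T (shift k \<omega>)) \<and> \<Union>\<Q> = Tower T (shift k \<omega>) \<and>
     (\<forall>Q\<in>\<Q>. \<forall>z\<in>Q. \<forall>w\<in>Q. enat n \<le> sep T (shift k \<omega>, z) (shift k \<omega>, w))"
    using Suc.IH[OF fibres_shift[THEN iffD2, OF \<omega>]] by (rule allI)
  from choice[OF this] obtain \<Q> where Q: "\<forall>k. countable (\<Q> k) \<and> \<Q> k \<subseteq> sets (tmeas T (shift k \<omega>)) \<and>
     \<Union>(\<Q> k) = Tower T (shift k \<omega>) \<and>
     (\<forall>Q\<in>\<Q> k. \<forall>z\<in>Q. \<forall>w\<in>Q. enat n \<le> sep T (shift k \<omega>, z) (shift k \<omega>, w))" ..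
  then have cQ: "\<And>k. countable (\<Q> k)" and sQ: "\<And>k Q. Q \<in> \<Q> k \<Longrightarrow> Q \<in> sets (tmeas T (shift k \<omega>))"
    and uQ: "\<And>k. \<Union>(\<Q> k) = Tower T (shift k \<omega>)"
    and dQ: "\<And>k Q z w. Q \<in> \<Q> k \<Longrightarrow> z \<in> Q \<Longrightarrow> w \<in> Q \<Longrightarrow> enat n \<le> sep T (shift k \<omega>, z) (shift k \<omega>, w)"
    by blast+
  \<comment> \<open>The return time \<open>j\<close> is fixed as well, so that the fibre
    \<open>shift (int j - int l) \<omega>\<close> in which the points land is known.\<close>
  define S where "S l A j Q = ({x \<in> A. l < R (shift (- int l) \<omega>) x \<and> R (shift (- int l) \<omega>) x = j} \<inter>
     (gmap (shift (- int l) \<omega>) -` {y. (y, 0::nat) \<in> Q} \<inter> space lam)) \<times> {l}" for l A j Q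
  let ?\<S> = "\<Union>l. \<Union>j. \<Union>A\<in>cells (shift (- int l) \<omega>). S l A j ` \<Q> (int j - int l)"
  show ?case
  proof (intro exI[of _ ?\<S>] conjI)
    show "countable ?\<S>" using cells_countable cQ \<omega> by (intro countable_UN countable_image) auto
    show "?\<S> \<subseteq> sets (tmeas T \<omega>)"
    proof
      fix X assume "X \<in> ?\<S>"
      then obtain l j A Q where X: "X = S l A j Q" and A: "A \<in> cells (shift (- int l) \<omega>)"
        and Q: "Q \<in> \<Q> (int j - int l)" unfolding UN_iff image_iff by blast
      have [measurable]: "R (shift (- int l) \<omega>) \<in> measurable lam (count_space UNIV)"
        "gmap (shift (- int l) \<omega>) \<in> measurable lam lam" "A \<in> sets lam"
        using \<omega> A by (auto intro: R_meas gmap_meas cells_sets_lam[of "shift (- int l) \<omega>"])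
      have 1: "{x \<in> A. l < R (shift (- int l) \<omega>) x \<and> R (shift (- int l) \<omega>) x = j} \<in> sets lam" by measurable
      have 2: "gmap (shift (- int l) \<omega>) -` {y. (y, 0) \<in> Q} \<inter> space lam \<in> sets lam"
        by (rule measurable_sets[OF _ section_in_lam[OF _ sQ[OF Q]]]) (use \<omega> in simp_all)
      show "X \<in> sets (tmeas T \<omega>)" unfolding X S_def
        by (rule level_in_tmeas[OF \<omega> sets.Int[OF 1 2]]) blast
    qed
    then have "X \<subseteq> Tower T \<omega>" if "X \<in> ?\<S>" for X
      using sets.sets_into_space[of X "tmeas T \<omega>"] subsetD[of ?\<S> "sets (tmeas T \<omega>)" X] that unfolding space_tmeas[OF \<omega>] by (simp only:)
    then have "\<Union>?\<S> \<subseteq> Tower T \<omega>" by (rule Union_least)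
    moreover have "Tower T \<omega> \<subseteq> \<Union>?\<S>"
    proof
      fix z assume z: "z \<in> Tower T \<omega>"
      obtain x l where xl: "z = (x, l)" by (cases z)
      let ?\<omega> = "shift (- int l) \<omega>"
      have x: "x \<in> \<Lambda>" "l < R ?\<omega> x" using z xl \<omega> by (auto simp: Tower_iff)
      obtain A where A: "A \<in> cells ?\<omega>" "x \<in> A" using cells_Union[of ?\<omega>] \<omega> x by auto
      have g: "gmap ?\<omega> x \<in> \<Lambda>" using measurable_space[OF gmap_meas, of ?\<omega> x] \<omega> x by simp
      then have "(gmap ?\<omega> x, 0) \<in> Tower T (shift (int (R ?\<omega> x) - int l) \<omega>)"
        using \<omega> R_pos[OF _ g] by (simp add: Tower_iff)
      then obtain Q where Q: "Q \<in> \<Q> (int (R ?\<omega> x) - int l)" "(gmap ?\<omega> x, 0) \<in> Q" using uQ by blast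
      have "z \<in> S l A (R ?\<omega> x) Q" unfolding S_def xl using A x Q by simp
      then show "z \<in> \<Union>?\<S>" using A Q by blast
    qed
    ultimately show "\<Union>?\<S> = Tower T \<omega>" by (rule antisym)
    show "\<forall>X\<in>?\<S>. \<forall>z\<in>X. \<forall>w\<in>X. enat (Suc n) \<le> sep T (\<omega>, z) (\<omega>, w)"
    proof (intro ballI)
      fix X z w assume "X \<in> ?\<S>" and zw: "z \<in> X" "w \<in> X"
      then obtain l j A Q where X: "X = S l A j Q" and A: "A \<in> cells (shift (- int l) \<omega>)"
        and Q: "Q \<in> \<Q> (int j - int l)" unfolding UN_iff image_iff by blast
      let ?\<omega> = "shift (- int l) \<omega>"
      obtain x y where xy: "z = (x, l)" "w = (y, l)" "x \<in> A" "y \<in> A" "l < R ?\<omega> x" "R ?\<omega> x = j" "R ?\<omega> y = j"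
        "(gmap ?\<omega> x, 0) \<in> Q" "(gmap ?\<omega> y, 0) \<in> Q"
        using zw unfolding X S_def by auto
      have \<omega>': "?\<omega> \<in> fibres T" "shift (int l) ?\<omega> = \<omega>" using \<omega> by auto
      have "same_cell T (\<omega>, z) (\<omega>, w)"
        using same_cell_eq[OF \<omega>'(1), of l x y] \<omega>'(2) A xy by auto
      moreover have "retmap T (\<omega>, z) = (shift (int j - int l) \<omega>, (gmap ?\<omega> x, 0))"
        using retmap_eq[of l ?\<omega> x] xy \<omega>' by simp
      moreover have "retmap T (\<omega>, w) = (shift (int j - int l) \<omega>, (gmap ?\<omega> y, 0))"
        using retmap_eq[of l ?\<omega> y] xy \<omega>' by simp
      moreover have "enat n \<le> sep T (shift (int j - int l) \<omega>, (gmap ?\<omega> x, 0)) (shift (int j - int l) \<omega>, (gmap ?\<omega> y, 0))"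
        using dQ[OF Q] xy by blast
      ultimately show "enat (Suc n) \<le> sep T (\<omega>, z) (\<omega>, w)"
        by (subst sep_unfold) (simp add: eSuc_enat[symmetric])
    qed
  qed
qed

text \<open>Members of \<open>FK T \<gamma> K\<close> are not assumed measurable; they are because every tower is covered by countably
  many measurable cylinders of any given depth.\<close>

lemma holder_measurable:
  fixes f :: "'x \<times> nat \<Rightarrow> real"
  assumes \<omega>: "\<omega> \<in> fibres T"
    and f: "\<And>z w. z \<in> Tower T \<omega> \<Longrightarrow> w \<in> Tower T \<omega> \<Longrightarrow> \<bar>f z - f w\<bar> \<le> C * epow \<gamma> (sep T (\<omega>, z) (\<omega>, w))"
    and C: "0 \<le> C"
  shows "f \<in> borel_measurable (tmeas T \<omega>)"
proof (rule borel_measurableI_greater)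
  fix c :: real
  have "\<forall>n. \<exists>\<Q>. countable \<Q> \<and> \<Q> \<subseteq> sets (tmeas T \<omega>) \<and> \<Union>\<Q> = Tower T \<omega> \<and>
     (\<forall>Q\<in>\<Q>. \<forall>z\<in>Q. \<forall>w\<in>Q. enat n \<le> sep T (\<omega>, z) (\<omega>, w))"
    using sep_cover[OF \<omega>] by (rule allI)
  from choice[OF this] obtain \<Q> where Q: "\<forall>n. countable (\<Q> n) \<and> \<Q> n \<subseteq> sets (tmeas T \<omega>) \<and>
     \<Union>(\<Q> n) = Tower T \<omega> \<and> (\<forall>Q\<in>\<Q> n. \<forall>z\<in>Q. \<forall>w\<in>Q. enat n \<le> sep T (\<omega>, z) (\<omega>, w))" ..
  then have cQ: "\<And>n. countable (\<Q> n)" and sQ: "\<And>n Q. Q \<in> \<Q> n \<Longrightarrow> Q \<in> sets (tmeas T \<omega>)"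
    and uQ: "\<And>n. \<Union>(\<Q> n) = Tower T \<omega>"
    and dQ: "\<And>n Q z w. Q \<in> \<Q> n \<Longrightarrow> z \<in> Q \<Longrightarrow> w \<in> Q \<Longrightarrow> enat n \<le> sep T (\<omega>, z) (\<omega>, w)"
    by blast+
  let ?\<S> = "\<Union>n. {Q \<in> \<Q> n. \<forall>z\<in>Q. c < f z}"
  have "{z \<in> space (tmeas T \<omega>). c < f z} = \<Union>?\<S>"
  proof (intro antisym subsetI)
    fix z assume z: "z \<in> {z \<in> space (tmeas T \<omega>). c < f z}"
    then have zT: "z \<in> Tower T \<omega>" using \<omega> by (simp add: space_tmeas)
    have "(\<lambda>n. C * \<gamma> ^ n) \<longlonglongrightarrow> C * 0"
      using \<gamma>_range by (intro tendsto_mult tendsto_const LIMSEQ_realpow_zero) auto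
    then have "\<forall>\<^sub>F n in sequentially. C * \<gamma> ^ n < f z - c"
      using z by (intro order_tendstoD(2)[where y="C * 0"]) auto
    then obtain n where n: "C * \<gamma> ^ n < f z - c" by (auto simp: eventually_sequentially)
    obtain Q where Q: "Q \<in> \<Q> n" "z \<in> Q" using uQ zT by blast
    have "c < f w" if w: "w \<in> Q" for w
    proof -
      have wT: "w \<in> Tower T \<omega>" using uQ Q w by blast
      have "\<bar>f z - f w\<bar> \<le> C * epow \<gamma> (sep T (\<omega>, z) (\<omega>, w))" using f[OF zT wT] .
      also have "\<dots> \<le> C * \<gamma> ^ n"
        using C \<gamma>_range dQ[OF Q(1) Q(2) w] by (intro mult_left_mono epow_le_power) auto
      finally show ?thesis using n by linarith
    qed
    then show "z \<in> \<Union>?\<S>" using Q by blast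
  next
    fix z assume "z \<in> \<Union>?\<S>"
    then obtain n Q where "Q \<in> \<Q> n" "\<forall>z\<in>Q. c < f z" "z \<in> Q" by blast
    then show "z \<in> {z \<in> space (tmeas T \<omega>). c < f z}"
      using uQ \<omega> by (auto simp: space_tmeas)
  qed
  also have "\<dots> \<in> sets (tmeas T \<omega>)"
    using cQ sQ by (intro sets.countable_Union) (auto intro!: countable_UN countable_subset[OF _ cQ])
  finally show "{z \<in> space (tmeas T \<omega>). c < f z} \<in> sets (tmeas T \<omega>)" .
qed

end

section \<open>Transfer operators and decay along a fixed orbit\<close>

definition correlation :: "('u, 'x) random_tower \<Rightarrow> ('u, 'x) family \<Rightarrow> ('u, 'x) family \<Rightarrow> ('u, 'x) family \<Rightarrow>
    nat \<Rightarrow> (int \<Rightarrow> 'u) \<Rightarrow> real" where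
  "correlation T h \<phi> \<psi> n \<omega> =
     (\<integral>z. \<phi> (shift (int n) \<omega>) (titer T n \<omega> z) * \<psi> \<omega> z \<partial>tmeas T \<omega>)
     - (\<integral>z. \<phi> (shift (int n) \<omega>) z \<partial>nu T h (shift (int n) \<omega>)) * (\<integral>z. \<psi> \<omega> z \<partial>tmeas T \<omega>)"

text \<open>A past correlation at \<omega> is a future correlation at the earlier point
  \<open>shift (- int n) \<omega>\<close>. Only the point at which the random constant is taken
  differs, hence the offset \<open>s\<close> in \<open>correlation_decay\<close>.\<close>

lemma correlation_past:
  "correlation T h \<phi> \<psi> n (shift (- int n) \<omega>) =
     (\<integral>z. \<phi> \<omega> (titer T n (shift (- int n) \<omega>) z) * \<psi> (shift (- int n) \<omega>) z \<partial>tmeas T (shift (- int n) \<omega>))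
     - (\<integral>z. \<phi> \<omega> z \<partial>nu T h \<omega>) * (\<integral>z. \<psi> (shift (- int n) \<omega>) z \<partial>tmeas T (shift (- int n) \<omega>))"
  by (simp add: correlation_def)

lemma measurable_times_indicator_level:
  assumes [measurable]: "b \<in> borel_measurable M" "r \<in> measurable M (count_space UNIV)"
  shows "(\<lambda>x. b x * indicator {x. r x = j} x :: ennreal) \<in> borel_measurable M"
  by measurable

context tower_jac begin

section \<open>The transfer operator of the return map\<close>

lemma space_cell: "\<omega> \<in> fibres T \<Longrightarrow> A \<in> cells \<omega> \<Longrightarrow> space (restrict_space lam A) = A"
  using cells_subset by (auto simp: space_restrict_space)

lemma cell_Int_space: "\<omega> \<in> fibres T \<Longrightarrow> A \<in> cells \<omega> \<Longrightarrow> A \<inter> space lam \<in> sets lam"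
  using cells_sets_lam by (intro sets.Int[OF _ sets.top])

lemma J_meas: "\<omega> \<in> fibres T \<Longrightarrow> A \<in> cells \<omega> \<Longrightarrow> J \<omega> A \<in> borel_measurable (restrict_space lam A)"
  using jac unfolding jacobian_def by blast

text \<open>The preimage under an inverse branch is the image under the branch, so this is the
  definition of the Jacobian read as an identity of measures.\<close>

lemma distr_ginv:
  assumes \<omega>: "\<omega> \<in> fibres T" and A: "A \<in> cells \<omega>"
  shows "distr lam (restrict_space lam A) (ginv \<omega> A) = density (restrict_space lam A) (\<lambda>x. ennreal (J \<omega> A x))"
proof (rule measure_eqI)
  fix B assume B: "B \<in> sets (distr lam (restrict_space lam A) (ginv \<omega> A))"
  then have B': "B \<in> sets (restrict_space lam A)" by simp
  then have BA: "B \<subseteq> A" using sets.sets_into_space[OF B'] space_cell[OF \<omega> A] by simp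
  have img: "ginv \<omega> A -` B \<inter> space lam = gmap \<omega> ` B"
  proof (intro antisym subsetI)
    fix y assume y: "y \<in> ginv \<omega> A -` B \<inter> space lam"
    then have "y = gmap \<omega> (ginv \<omega> A y)" using ginv(2)[OF \<omega> A] by simp
    then show "y \<in> gmap \<omega> ` B" using y by blast
  next
    fix y assume "y \<in> gmap \<omega> ` B"
    then obtain x where x: "x \<in> B" "y = gmap \<omega> x" by blast
    have "y \<in> \<Lambda>" using x BA bij_betw_imp_surj_on[OF gmap_bij[OF \<omega> A]] by blast
    moreover have "ginv \<omega> A y = x" unfolding x(2) using x(1) BA by (intro ginv_gmap[OF \<omega> A]) blast
    ultimately show "y \<in> ginv \<omega> A -` B \<inter> space lam" using x by simp
  qed
  have "emeasure (distr lam (restrict_space lam A) (ginv \<omega> A)) B = emeasure lam (gmap \<omega> ` B)"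
    unfolding emeasure_distr[OF ginv_meas[OF \<omega> A] B'] img ..
  also have "\<dots> = (\<integral>\<^sup>+x\<in>B. ennreal (J \<omega> A x) \<partial>restrict_space lam A)"
    using jac[OF \<omega> A] B' unfolding jacobian_def by blast
  also have "\<dots> = emeasure (density (restrict_space lam A) (\<lambda>x. ennreal (J \<omega> A x))) B"
    by (rule emeasure_density[symmetric]) (use J_meas[OF \<omega> A] B' in auto)
  finally show "emeasure (distr lam (restrict_space lam A) (ginv \<omega> A)) B = \<dots>" .
qed simp

lemma nn_integral_ginv:
  assumes \<omega>: "\<omega> \<in> fibres T" and A: "A \<in> cells \<omega>" and F: "F \<in> borel_measurable (restrict_space lam A)"
  shows "(\<integral>\<^sup>+y. F (ginv \<omega> A y) \<partial>lam) = (\<integral>\<^sup>+x. ennreal (J \<omega> A x) * F x \<partial>restrict_space lam A)"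
proof -
  have "(\<integral>\<^sup>+y. F (ginv \<omega> A y) \<partial>lam) = (\<integral>\<^sup>+x. F x \<partial>distr lam (restrict_space lam A) (ginv \<omega> A))"
    by (rule nn_integral_distr[symmetric]) (use ginv_meas[OF \<omega> A] F in auto)
  also have "\<dots> = (\<integral>\<^sup>+x. ennreal (J \<omega> A x) * F x \<partial>restrict_space lam A)"
    unfolding distr_ginv[OF \<omega> A] by (rule nn_integral_density) (use J_meas[OF \<omega> A] F in auto)
  finally show ?thesis .
qed

lemma nn_integral_cells:
  assumes \<omega>: "\<omega> \<in> fibres T" and h: "h \<in> borel_measurable lam"
  shows "(\<integral>\<^sup>+x. h x \<partial>lam) = (\<integral>\<^sup>+A. (\<integral>\<^sup>+x. h x \<partial>restrict_space lam A) \<partial>count_space (cells \<omega>))"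
proof -
  have "(\<integral>\<^sup>+x. h x \<partial>lam) = (\<integral>\<^sup>+x. \<integral>\<^sup>+A. h x * indicator A x \<partial>count_space (cells \<omega>) \<partial>lam)"
  proof (rule nn_integral_cong)
    fix x assume "x \<in> space lam"
    then obtain A where A: "A \<in> cells \<omega>" "x \<in> A" using cells_Union[OF \<omega>] by auto
    have "(\<integral>\<^sup>+B. h x * indicator B x \<partial>count_space (cells \<omega>)) = (\<integral>\<^sup>+B. h x * indicator {A} B \<partial>count_space (cells \<omega>))"
    proof (rule nn_integral_cong)
      fix B assume "B \<in> space (count_space (cells \<omega>))"
      then have B: "B \<in> cells \<omega>" by simp
      have "x \<in> B \<longleftrightarrow> B = A"
        using cells_unique[OF \<omega> A(1) B A(2)] A(2) by blast
      then show "h x * indicator B x = h x * indicator {A} B" by (cases "B = A") simp_all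
    qed
    also have "\<dots> = h x" using A(1) by (subst nn_integral_cmult_indicator) simp_all
    finally show "h x = (\<integral>\<^sup>+B. h x * indicator B x \<partial>count_space (cells \<omega>))" by simp
  qed
  also have "\<dots> = (\<integral>\<^sup>+A. \<integral>\<^sup>+x. h x * indicator A x \<partial>lam \<partial>count_space (cells \<omega>))"
    by (rule nn_integral_count_space_nn_integral[OF cells_countable[OF \<omega>]])
       (use h cells_sets_lam[OF \<omega>] in auto)
  also have "\<dots> = (\<integral>\<^sup>+A. (\<integral>\<^sup>+x. h x \<partial>restrict_space lam A) \<partial>count_space (cells \<omega>))"
    by (intro nn_integral_cong) (simp add: nn_integral_restrict_space[OF cell_Int_space[OF \<omega>]])
  finally show ?thesis .
qed

text \<open>The Perron-Frobenius operator. As every branch is onto, each \<open>y\<close> has one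
  preimage in each cell, and the sum over cells is written as an integral over counting
  measure.\<close>

definition transfer :: "(int \<Rightarrow> 'u) \<Rightarrow> ('x \<Rightarrow> ennreal) \<Rightarrow> 'x \<Rightarrow> ennreal" where
  "transfer \<omega> b y = (\<integral>\<^sup>+A. b (ginv \<omega> A y) / ennreal (J \<omega> A (ginv \<omega> A y)) \<partial>count_space (cells \<omega>))"

lemma branch_meas:
  assumes "\<omega> \<in> fibres T" "A \<in> cells \<omega>" and b: "b \<in> borel_measurable lam"
  shows "(\<lambda>x. b x / ennreal (J \<omega> A x)) \<in> borel_measurable (restrict_space lam A)"
  using measurable_restrict_space1[OF b] J_meas[OF assms(1,2)] by measurable

lemma transfer_meas:
  assumes \<omega>: "\<omega> \<in> fibres T" and b: "b \<in> borel_measurable lam"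
  shows "transfer \<omega> b \<in> borel_measurable lam"
proof -
  interpret C: sigma_finite_measure "count_space (cells \<omega>)"
    by (rule sigma_finite_measure_count_space_countable[OF cells_countable[OF \<omega>]])
  let ?h = "\<lambda>A y. b (ginv \<omega> A y) / ennreal (J \<omega> A (ginv \<omega> A y))"
  have "(\<lambda>z. ?h (fst z) (snd z)) \<in> borel_measurable (count_space (cells \<omega>) \<Otimes>\<^sub>M lam)"
  proof (rule measurable_pair_measure_countable1[OF cells_countable[OF \<omega>]])
    fix A assume A: "A \<in> cells \<omega>"
    show "(\<lambda>y. ?h (fst (A, y)) (snd (A, y))) \<in> borel_measurable lam"
      using measurable_compose[OF ginv_meas[OF \<omega> A] branch_meas[OF \<omega> A b]] by simp
  qed
  then have "(\<lambda>z. ?h (snd z) (fst z)) \<in> borel_measurable (lam \<Otimes>\<^sub>M count_space (cells \<omega>))"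
    by (subst measurable_pair_swap_iff) (simp add: case_prod_beta')
  then have "(\<lambda>y. \<integral>\<^sup>+A. ?h A y \<partial>count_space (cells \<omega>)) \<in> borel_measurable lam"
    by (intro C.borel_measurable_nn_integral) (simp add: case_prod_beta')
  then show ?thesis unfolding transfer_def[abs_def] .
qed

text \<open>Change of variables on each branch, where the Jacobian cancels the denominator, followed
  by summation over the cells.\<close>

lemma transfer_dual:
  assumes \<omega>: "\<omega> \<in> fibres T" and f: "f \<in> borel_measurable lam" and b: "b \<in> borel_measurable lam"
  shows "(\<integral>\<^sup>+y. f y * transfer \<omega> b y \<partial>lam) = (\<integral>\<^sup>+x. f (gmap \<omega> x) * b x \<partial>lam)"
proof -
  let ?h = "\<lambda>A y. b (ginv \<omega> A y) / ennreal (J \<omega> A (ginv \<omega> A y))"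
  have hm: "?h A \<in> borel_measurable lam" if "A \<in> cells \<omega>" for A
    using measurable_compose[OF ginv_meas[OF \<omega> that] branch_meas[OF \<omega> that b]] by simp
  have "(\<integral>\<^sup>+y. f y * transfer \<omega> b y \<partial>lam) = (\<integral>\<^sup>+y. \<integral>\<^sup>+A. f y * ?h A y \<partial>count_space (cells \<omega>) \<partial>lam)"
    unfolding transfer_def by (intro nn_integral_cong nn_integral_cmult[symmetric]) simp
  also have "\<dots> = (\<integral>\<^sup>+A. \<integral>\<^sup>+y. f y * ?h A y \<partial>lam \<partial>count_space (cells \<omega>))"
    by (rule nn_integral_count_space_nn_integral[OF cells_countable[OF \<omega>]])
       (intro borel_measurable_times_ennreal f hm)
  also have "\<dots> = (\<integral>\<^sup>+A. (\<integral>\<^sup>+x. f (gmap \<omega> x) * b x \<partial>restrict_space lam A) \<partial>count_space (cells \<omega>))"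
  proof (rule nn_integral_cong)
    fix A assume "A \<in> space (count_space (cells \<omega>))"
    then have A: "A \<in> cells \<omega>" by simp
    let ?F = "\<lambda>x. f (gmap \<omega> x) * (b x / ennreal (J \<omega> A x))"
    have F: "?F \<in> borel_measurable (restrict_space lam A)"
      by (intro borel_measurable_times_ennreal branch_meas[OF \<omega> A b] measurable_compose[OF gmap_cell_meas[OF \<omega> A] f])
    have "(\<integral>\<^sup>+y. f y * ?h A y \<partial>lam) = (\<integral>\<^sup>+y. ?F (ginv \<omega> A y) \<partial>lam)"
      by (intro nn_integral_cong) (simp add: ginv(2)[OF \<omega> A])
    also have "\<dots> = (\<integral>\<^sup>+x. ennreal (J \<omega> A x) * ?F x \<partial>restrict_space lam A)"
      by (rule nn_integral_ginv[OF \<omega> A F])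
    also have "\<dots> = (\<integral>\<^sup>+x. f (gmap \<omega> x) * b x \<partial>restrict_space lam A)"
    proof (rule nn_integral_cong)
      fix x assume "x \<in> space (restrict_space lam A)"
      then have "0 < J \<omega> A x" using J_pos[OF \<omega> A] space_cell[OF \<omega> A] by simp
      then have e: "ennreal (J \<omega> A x) * (b x / ennreal (J \<omega> A x)) = b x"
        unfolding ennreal_times_divide mult.commute[of "ennreal (J \<omega> A x)" "b x"]
        by (intro mult_divide_eq_ennreal) auto
      have "ennreal (J \<omega> A x) * ?F x = f (gmap \<omega> x) * (ennreal (J \<omega> A x) * (b x / ennreal (J \<omega> A x)))"
        by (rule mult.left_commute)
      then show "ennreal (J \<omega> A x) * ?F x = f (gmap \<omega> x) * b x" by (simp only: e)
    qed
    finally show "(\<integral>\<^sup>+y. f y * ?h A y \<partial>lam) = (\<integral>\<^sup>+x. f (gmap \<omega> x) * b x \<partial>restrict_space lam A)" .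
  qed
  also have "\<dots> = (\<integral>\<^sup>+x. f (gmap \<omega> x) * b x \<partial>lam)"
    by (rule nn_integral_cells[OF \<omega>, symmetric])
       (intro borel_measurable_times_ennreal b measurable_compose[OF gmap_meas[OF \<omega>] f])
  finally show ?thesis .
qed

definition same_base :: "(int \<Rightarrow> 'u) \<Rightarrow> 'x \<Rightarrow> 'x \<Rightarrow> bool" where
  "same_base \<omega> x y \<longleftrightarrow> (\<exists>A\<in>cells \<omega>. x \<in> A \<and> y \<in> A)"

text \<open>The preimages of \<open>y\<close> and \<open>y'\<close> in one cell separate one return
  later, which turns \<open>H\<close> into \<open>\<gamma> * H\<close>; the Jacobians contribute
  \<open>D\<close> through \<open>1 + D * s \<le> exp (D * s)\<close>. Both bounds are the same for
  all cells.\<close>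

lemma transfer_regular:
  assumes \<omega>: "\<omega> \<in> fibres T" and H: "0 \<le> H"
    and b: "\<And>x x'. x \<in> \<Lambda> \<Longrightarrow> x' \<in> \<Lambda> \<Longrightarrow> same_base \<omega> x x' \<Longrightarrow> b x \<le> ennreal (exp (H * bsep \<omega> x x')) * b x'"
    and y: "y \<in> \<Lambda>" "y' \<in> \<Lambda>"
  shows "transfer \<omega> (\<lambda>x. b x * indicator {x. R \<omega> x = j} x) y \<le>
     ennreal (exp ((\<gamma> * H + D) * bsep (shift (int j) \<omega>) y y')) * transfer \<omega> (\<lambda>x. b x * indicator {x. R \<omega> x = j} x) y'"
proof -
  let ?c = "ennreal (exp ((\<gamma> * H + D) * bsep (shift (int j) \<omega>) y y'))"
  have "transfer \<omega> (\<lambda>x. b x * indicator {x. R \<omega> x = j} x) y \<le>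
    (\<integral>\<^sup>+A. ?c * (b (ginv \<omega> A y') * indicator {x. R \<omega> x = j} (ginv \<omega> A y') / ennreal (J \<omega> A (ginv \<omega> A y'))) \<partial>count_space (cells \<omega>))"
    unfolding transfer_def
  proof (rule nn_integral_mono)
    fix A assume "A \<in> space (count_space (cells \<omega>))"
    then have A: "A \<in> cells \<omega>" by simp
    define x where "x = ginv \<omega> A y"
    define x' where "x' = ginv \<omega> A y'"
    have x: "x \<in> A" "gmap \<omega> x = y" "x' \<in> A" "gmap \<omega> x' = y'"
      unfolding x_def x'_def using ginv[OF \<omega> A] y by auto
    have xL: "x \<in> \<Lambda>" "x' \<in> \<Lambda>" using x cells_subset[OF \<omega> A] by auto
    have Req: "R \<omega> x = R \<omega> x'" using R_const[OF \<omega> A x(1,3)] .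
    show "b x * indicator {x. R \<omega> x = j} x / ennreal (J \<omega> A x) \<le>
      ?c * (b x' * indicator {x. R \<omega> x = j} x' / ennreal (J \<omega> A x'))"
    proof (cases "R \<omega> x = j")
      case True
      define s where "s = bsep (shift (int j) \<omega>) y y'"
      have s: "0 \<le> s" unfolding s_def by (rule bsep_range)
      have "bsep \<omega> x x' = \<gamma> * s"
        using bsep_cell[OF \<omega> A x(1,3)] x True by (simp add: s_def)
      moreover have "same_base \<omega> x x'" unfolding same_base_def using A x by blast
      ultimately have 1: "b x \<le> ennreal (exp (H * (\<gamma> * s))) * b x'" using b[OF xL] by simp
      have Jx: "0 < J \<omega> A x" "0 < J \<omega> A x'" using J_pos[OF \<omega> A] x by auto
      \<comment> \<open>The Jacobians stand in the denominator, so the distortion bound is used with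
        \<open>x'\<close> and \<open>x\<close> exchanged.\<close>
      have "J \<omega> A x' / J \<omega> A x \<le> 1 + D * bsep (shift (int j) \<omega>) y' y"
        using J_dist[OF \<omega> A x(3,1)] x True Req by simp
      also have "bsep (shift (int j) \<omega>) y' y = s" unfolding s_def by (rule bsep_sym)
      also have "1 + D * s \<le> exp (D * s)" by (rule exp_ge_add_one_self)
      finally have "1 / J \<omega> A x \<le> exp (D * s) * (1 / J \<omega> A x')" using Jx by (simp add: field_simps)
      then have 2: "inverse (ennreal (J \<omega> A x)) \<le> ennreal (exp (D * s)) * inverse (ennreal (J \<omega> A x'))"
        using Jx by (simp add: inverse_ennreal ennreal_mult[symmetric] ennreal_leI inverse_eq_divide)
      have "b x / ennreal (J \<omega> A x) \<le> (ennreal (exp (H * (\<gamma> * s))) * b x') * (ennreal (exp (D * s)) * inverse (ennreal (J \<omega> A x')))"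
        unfolding divide_ennreal_def by (rule mult_mono[OF 1 2]) auto
      also have "\<dots> = ennreal (exp (H * (\<gamma> * s)) * exp (D * s)) * (b x' / ennreal (J \<omega> A x'))"
        unfolding divide_ennreal_def by (simp add: ennreal_mult mult_ac)
      also have "exp (H * (\<gamma> * s)) * exp (D * s) = exp ((\<gamma> * H + D) * s)"
        by (simp add: exp_add[symmetric] algebra_simps)
      finally show ?thesis using True Req by (simp add: s_def)
    qed simp
  qed
  also have "\<dots> = ?c * transfer \<omega> (\<lambda>x. b x * indicator {x. R \<omega> x = j} x) y'"
    unfolding transfer_def by (rule nn_integral_cmult) simp
  finally show ?thesis .
qed

definition Lop :: "(int \<Rightarrow> 'u) \<Rightarrow> int \<Rightarrow> nat \<Rightarrow> ('x \<Rightarrow> ennreal) \<Rightarrow> 'x \<Rightarrow> ennreal" where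
  "Lop \<omega> k j b = transfer (shift k \<omega>) (\<lambda>x. b x * indicator {x. R (shift k \<omega>) x = j} x)"

lemma renewal_towerI:
  assumes \<omega>: "\<omega> \<in> fibres T"
    and mass: "\<And>k. (\<Sum>l. emeasure (refm T) {x \<in> \<Lambda>. l < R (shift (k - int l) \<omega>) x}) \<le> ennreal Mt"
    and n0: "\<And>n. n0 \<le> n \<Longrightarrow> \<exists>xs. set xs \<subseteq> I \<and> sum_list xs = n" and i0: "i0 \<in> I"
    and I: "\<And>i k. i \<in> I \<Longrightarrow> ennreal \<epsilon> \<le> emeasure (refm T) {x \<in> \<Lambda>. R (shift k \<omega>) x = i}"
    and p: "0 < e" "e < 1" "0 \<le> Hc" "\<gamma> * Hc + D \<le> (1 - e) * Hc" "0 < \<epsilon>" "0 \<le> Mt"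
  shows "renewal_tower lam (\<lambda>k. R (shift k \<omega>)) (\<lambda>k. gmap (shift k \<omega>)) (\<lambda>k. bsep (shift k \<omega>))
    (\<lambda>k. same_base (shift k \<omega>)) (Lop \<omega>) \<gamma> D Mt Hc e \<epsilon> I n0 i0"
proof -
  have \<omega>k: "shift k \<omega> \<in> fibres T" for k using \<omega> by simp
  have Rm: "R (shift k \<omega>) \<in> measurable lam (count_space UNIV)" for k by (rule R_meas[OF \<omega>k])
  have indm: "(\<lambda>x. b x * indicator {x. R (shift k \<omega>) x = j} x :: ennreal) \<in> borel_measurable lam"
    if "b \<in> borel_measurable lam" for b k j by (rule measurable_times_indicator_level[OF that Rm])
  show ?thesis
    unfolding renewal_tower_def renewal_tower_axioms_def
  proof (intro conjI allI impI)
    show "prob_space lam" by (rule prob_space_lam)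
    show "R (shift k \<omega>) \<in> measurable lam (count_space UNIV)" for k by (rule Rm)
    show "gmap (shift k \<omega>) \<in> measurable lam lam" for k by (rule gmap_meas[OF \<omega>k])
    show "0 < R (shift k \<omega>) x" if "x \<in> space lam" for x k using that R_pos[OF \<omega>k] by simp
    show "0 \<le> bsep (shift k \<omega>) x y" "bsep (shift k \<omega>) x y \<le> 1" for k x y by (rule bsep_range)+
    show "Lop \<omega> k j b \<in> borel_measurable lam" if "b \<in> borel_measurable lam" for b k j
      unfolding Lop_def by (rule transfer_meas[OF \<omega>k indm[OF that]])
    show "(\<integral>\<^sup>+y. f y * Lop \<omega> k j b y \<partial>lam) =
      (\<integral>\<^sup>+x. f (gmap (shift k \<omega>) x) * b x * indicator {x. R (shift k \<omega>) x = j} x \<partial>lam)"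
      if "f \<in> borel_measurable lam" "b \<in> borel_measurable lam" for f b k j
      unfolding Lop_def transfer_dual[OF \<omega>k that(1) indm[OF that(2)]] by (simp add: mult.assoc)
    show "Lop \<omega> k j b y \<le> ennreal (exp ((\<gamma> * H + D) * bsep (shift (k + int j) \<omega>) y y')) * Lop \<omega> k j b y'"
      if "0 \<le> H" "\<forall>x x'. x \<in> space lam \<longrightarrow> x' \<in> space lam \<longrightarrow> same_base (shift k \<omega>) x x' \<longrightarrow>
          b x \<le> ennreal (exp (H * bsep (shift k \<omega>) x x')) * b x'"
        "y \<in> space lam" "y' \<in> space lam" for H b k j y y'
      using transfer_regular[OF \<omega>k that(1), of k b y y' j] that(2-) by (simp add: Lop_def add.commute)
    show "(\<Sum>l. emeasure lam {x \<in> space lam. l < R (shift (k - int l) \<omega>) x}) \<le> ennreal Mt" for k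
      using mass[of k] by (simp add: emeasure_lam)
    show "\<exists>xs. set xs \<subseteq> I \<and> sum_list xs = n" if "n0 \<le> n" for n using n0 that .
    show "i0 \<in> I" by (rule i0)
    show "ennreal \<epsilon> \<le> emeasure lam {x \<in> space lam. R (shift k \<omega>) x = i}" if "i \<in> I" for i k
      using I[OF that, of k] by (simp add: emeasure_lam)
  qed (use p in auto)
qed

section \<open>From the renewal equation back to the tower\<close>

lemma titer_Suc_front: "titer T (Suc n) \<omega> z = titer T n (shift 1 \<omega>) (tmap T \<omega> z)"
  using titer_add[of T 1 n \<omega> z] by simp

text \<open>The conditions concern the whole two-sided orbit, because the tower at one time draws
  its levels from arbitrarily early fibres. The first sum is the mass of the tower at time
  \<open>k\<close>.\<close>

definition mixing_fibre :: "real \<Rightarrow> nat set \<Rightarrow> real \<Rightarrow> (int \<Rightarrow> 'u) \<Rightarrow> bool" where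
  "mixing_fibre Mt I \<epsilon> \<omega> \<longleftrightarrow> \<omega> \<in> fibres T \<and>
    (\<forall>k. (\<Sum>l. emeasure (refm T) {x \<in> \<Lambda>. l < R (shift (k - int l) \<omega>) x}) \<le> ennreal Mt) \<and>
    (\<forall>i\<in>I. \<forall>k. ennreal \<epsilon> \<le> emeasure (refm T) {x \<in> \<Lambda>. R (shift k \<omega>) x = i})"

definition fibre_tail :: "(int \<Rightarrow> 'u) \<Rightarrow> int \<Rightarrow> nat \<Rightarrow> ennreal" where
  "fibre_tail \<omega> t n = (\<Sum>l. emeasure (refm T) {x \<in> \<Lambda>. l + n < R (shift (t - int (l + n)) \<omega>) x})"

definition level_regular :: "real \<Rightarrow> (int \<Rightarrow> 'u) \<Rightarrow> ('x \<times> nat \<Rightarrow> ennreal) \<Rightarrow> bool" where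
  "level_regular Hc \<omega> \<rho> \<longleftrightarrow> (\<forall>l. \<forall>A\<in>cells (shift (- int l) \<omega>). \<forall>x\<in>A. \<forall>y\<in>A. l < R (shift (- int l) \<omega>) x \<longrightarrow>
     \<rho> (x, l) \<le> ennreal (exp (Hc * bsep (shift (- int l) \<omega>) x y)) * \<rho> (y, l))"

text \<open>\<open>W.contraction\<close> for the states \<open>lev \<omega> \<rho>\<close> and
  \<open>lev \<omega> \<rho>'\<close>; what remains is to identify \<open>koopn\<close> with
  composition by \<open>titer\<close>, and \<open>levint\<close> with the integral over the
  tower.\<close>

lemma fibre_contraction:
  assumes mix: "mixing_fibre Mt I \<epsilon> \<omega>"
    and n0: "\<And>n. n0 \<le> n \<Longrightarrow> \<exists>xs. set xs \<subseteq> I \<and> sum_list xs = n" and i0: "i0 \<in> I"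
    and p: "0 < e" "e < 1" "0 \<le> Hc" "\<gamma> * Hc + D \<le> (1 - e) * Hc" "0 < \<epsilon>" "0 \<le> Mt"
    and \<rho>: "\<rho> \<in> borel_measurable (tmeas T \<omega>)" "level_regular Hc \<omega> \<rho>"
      "\<And>z. z \<in> Tower T \<omega> \<Longrightarrow> \<rho> z \<le> ennreal B" "(\<integral>\<^sup>+z. \<rho> z \<partial>tmeas T \<omega>) = ennreal \<mu>"
    and \<rho>': "\<rho>' \<in> borel_measurable (tmeas T \<omega>)" "level_regular Hc \<omega> \<rho>'"
      "\<And>z. z \<in> Tower T \<omega> \<Longrightarrow> \<rho>' z \<le> ennreal B" "(\<integral>\<^sup>+z. \<rho>' z \<partial>tmeas T \<omega>) = ennreal \<mu>"
    and \<mu>: "0 \<le> \<mu>" "exp ((1 - e) * Hc) * \<mu> \<le> B"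
    and S: "0 \<le> S" "q * (k + n0) \<le> n" "i0 \<le> k"
      "\<And>j. j < q \<Longrightarrow> fibre_tail \<omega> (int (j * (k + n0) + k)) k \<le> ennreal S"
    and f: "f \<in> borel_measurable (tmeas T (shift (int n) \<omega>))"
      "\<And>z. z \<in> Tower T (shift (int n) \<omega>) \<Longrightarrow> f z \<le> ennreal P" "0 \<le> P"
  shows "(\<integral>\<^sup>+z. f (titer T n \<omega> z) * \<rho> z \<partial>tmeas T \<omega>) \<le> (\<integral>\<^sup>+z. f (titer T n \<omega> z) * \<rho>' z \<partial>tmeas T \<omega>)
    + ennreal (P * (B * S + (1 - couple_rate Mt Hc e \<epsilon> n0 i0) ^ q * max 0 (\<mu> - B * S)))"
proof -
  have \<omega>: "\<omega> \<in> fibres T"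
    and mass: "\<And>k. (\<Sum>l. emeasure (refm T) {x \<in> \<Lambda>. l < R (shift (k - int l) \<omega>) x}) \<le> ennreal Mt"
    and I: "\<And>i k. i \<in> I \<Longrightarrow> ennreal \<epsilon> \<le> emeasure (refm T) {x \<in> \<Lambda>. R (shift k \<omega>) x = i}"
    using mix unfolding mixing_fibre_def by simp_all
  interpret W: renewal_tower lam "\<lambda>k. R (shift k \<omega>)" "\<lambda>k. gmap (shift k \<omega>)" "\<lambda>k. bsep (shift k \<omega>)"
    "\<lambda>k. same_base (shift k \<omega>)" "Lop \<omega>" \<gamma> D Mt Hc e \<epsilon> I n0 i0
    by (rule renewal_towerI[OF \<omega> mass n0 i0 I p])
  have adm: "W.admissible 0 B (lev \<omega> r)"
    if r: "r \<in> borel_measurable (tmeas T \<omega>)" "level_regular Hc \<omega> r" "\<And>z. z \<in> Tower T \<omega> \<Longrightarrow> r z \<le> ennreal B" for r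
    unfolding W.admissible_def
  proof (intro allI conjI ballI)
    fix l
    show "lev \<omega> r l \<in> borel_measurable lam" by (rule lev_meas[OF \<omega> r(1)])
    show "lev \<omega> r l x \<le> ennreal B" for x using r(3) by (simp add: lev_def)
    show "W.cellreg (0 - int l) (lev \<omega> r l)"
      unfolding W.cellreg_def
    proof (intro ballI impI)
      fix x y assume xy: "x \<in> space lam" "y \<in> space lam" "same_base (shift (0 - int l) \<omega>) x y"
      then obtain A where A: "A \<in> cells (shift (- int l) \<omega>)" "x \<in> A" "y \<in> A"
        unfolding same_base_def by auto
      have Req: "R (shift (- int l) \<omega>) x = R (shift (- int l) \<omega>) y"
        by (rule R_const[OF _ A]) (use \<omega> in simp)
      show "lev \<omega> r l x \<le> ennreal (exp (Hc * bsep (shift (0 - int l) \<omega>) x y)) * lev \<omega> r l y"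
      proof (cases "l < R (shift (- int l) \<omega>) x")
        case True
        then have "(x, l) \<in> Tower T \<omega>" "(y, l) \<in> Tower T \<omega>" using xy Req by (simp_all add: Tower_iff[OF \<omega>])
        then show ?thesis using r(2) A True unfolding level_regular_def by (simp add: lev_def)
      next
        case False
        then have "(x, l) \<notin> Tower T \<omega>" by (simp add: Tower_iff[OF \<omega>])
        then show ?thesis by (simp add: lev_def)
      qed
    qed
  qed
  \<comment> \<open>Stated on the tower only: elsewhere \<open>koop\<close> follows its second
    branch blindly, which the integrals never see.\<close>
  have koopn: "W.koopn t m (lev (shift (t + int m) \<omega>) f) l x = f (titer T m (shift t \<omega>) (x, l))"
    if "(x, l) \<in> Tower T (shift t \<omega>)" for t m l x
    using that
  proof (induction m arbitrary: t l x)
    case 0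
    then show ?case by (simp add: lev_def)
  next
    case (Suc m)
    have x: "x \<in> \<Lambda>" "l < R (shift (t - int l) \<omega>) x" using Suc.prems \<omega> by (simp_all add: Tower_iff add.commute)
    have T': "tmap T (shift t \<omega>) (x, l) \<in> Tower T (shift (t + 1) \<omega>)"
      using tmap_in_Tower[OF _ Suc.prems] \<omega> by (simp add: add.commute)
    have e: "t + int (Suc m) = t + 1 + int m" by simp
    show ?case
    proof (cases "Suc l < R (shift (t - int l) \<omega>) x")
      case True
      then have tm: "tmap T (shift t \<omega>) (x, l) = (x, Suc l)" by (intro tmap_up) (simp add: add.commute)
      show ?thesis unfolding W.koopn.simps W.koop_def e titer_Suc_front tm
        using True Suc.IH[of x "Suc l" "t + 1"] T' tm by (simp add: add.commute)
    next
      case False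
      then have "R (shift (t - int l) \<omega>) x = Suc l" using x by simp
      then have tm: "tmap T (shift t \<omega>) (x, l) = (gmap (shift (t - int l) \<omega>) x, 0)"
        using tmap_return[of l "shift t \<omega>" x] by (simp add: add.commute)
      show ?thesis unfolding W.koopn.simps W.koop_def e titer_Suc_front tm
        using False Suc.IH[of "gmap (shift (t - int l) \<omega>) x" 0 "t + 1"] T' tm by (simp add: add.commute)
    qed
  qed
  have levint: "W.levint 0 (lev \<omega> r) \<phi> = (\<integral>\<^sup>+z. F z * r z \<partial>tmeas T \<omega>)"
    if r: "r \<in> borel_measurable (tmeas T \<omega>)" and F: "F \<in> borel_measurable (tmeas T \<omega>)"
      and \<phi>: "\<And>x l. (x, l) \<in> Tower T \<omega> \<Longrightarrow> \<phi> l x = F (x, l)" for r F \<phi>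
  proof -
    have "(\<integral>\<^sup>+z. F z * r z \<partial>tmeas T \<omega>) = (\<Sum>l. \<integral>\<^sup>+x. lev \<omega> (\<lambda>z. F z * r z) l x \<partial>lam)"
      by (rule nn_integral_tmeas[OF \<omega>]) (intro borel_measurable_times_ennreal r F)
    also have "\<dots> = W.levint 0 (lev \<omega> r) \<phi>"
      unfolding W.levint_def
    proof (intro arg_cong[where f=suminf] ext nn_integral_cong)
      fix l x assume x: "x \<in> space lam"
      show "lev \<omega> (\<lambda>z. F z * r z) l x = \<phi> l x * lev \<omega> r l x * indicator {x. l < R (shift (0 - int l) \<omega>) x} x"
        using Tower_iff[OF \<omega>, of x l] x \<phi>[of x l] by (cases "(x, l) \<in> Tower T \<omega>") (simp_all add: lev_def)
    qed
    finally show ?thesis by simp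
  qed
  have fm: "(\<lambda>z. f (titer T n \<omega> z)) \<in> borel_measurable (tmeas T \<omega>)"
    by (rule measurable_compose[OF titer_measurable[OF \<omega>] f(1)])
  let ?\<psi> = "lev (shift (int n) \<omega>) f"
  have int: "W.levint 0 (lev \<omega> r) (W.koopn 0 n ?\<psi>) = (\<integral>\<^sup>+z. f (titer T n \<omega> z) * r z \<partial>tmeas T \<omega>)"
    if r: "r \<in> borel_measurable (tmeas T \<omega>)" for r
    using koopn[of _ _ 0 n] by (intro levint[OF r fm]) simp
  have mass': "W.mass 0 (lev \<omega> r) = (\<integral>\<^sup>+z. r z \<partial>tmeas T \<omega>)" if r: "r \<in> borel_measurable (tmeas T \<omega>)" for r
    using levint[OF r, of "\<lambda>_. 1" "\<lambda>_ _. 1"] by simp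
  have tl: "W.tail t m = fibre_tail \<omega> t m" for t m
    unfolding W.tail_def fibre_tail_def by (simp add: emeasure_lam)
  have "W.levint 0 (lev \<omega> \<rho>) (W.koopn 0 n ?\<psi>) \<le> W.levint 0 (lev \<omega> \<rho>') (W.koopn 0 n ?\<psi>)
     + ennreal (P * (B * S + (1 - W.\<theta>) ^ q * max 0 (\<mu> - B * S)))"
  proof (rule W.contraction[OF adm[OF \<rho>(1-3)] adm[OF \<rho>'(1-3)] _ _ \<mu> S(1-3)])
    show "W.mass 0 (lev \<omega> \<rho>) = ennreal \<mu>" "W.mass 0 (lev \<omega> \<rho>') = ennreal \<mu>"
      using mass'[OF \<rho>(1)] mass'[OF \<rho>'(1)] \<rho>(4) \<rho>'(4) by simp_all
    show "W.tail (0 + int (j * (k + n0) + k)) k \<le> ennreal S" if "j < q" for j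
      unfolding tl using S(4)[OF that] by simp
    show "?\<psi> l \<in> borel_measurable lam" for l
      by (rule lev_meas[OF _ f(1)]) (use \<omega> in simp)
    show "?\<psi> l x \<le> ennreal P" for l x using f(2) by (simp add: lev_def)
    show "0 \<le> P" by (rule f(3))
  qed
  then show ?thesis unfolding int[OF \<rho>(1)] int[OF \<rho>'(1)] W.\<theta>_eq_couple_rate .
qed

text \<open>A mixing fibre is needed as a witness: that the rate is at most 1 rests on \<epsilon>
  being below the measure of a subset of the base.\<close>

lemma couple_rate_range:
  assumes mix: "mixing_fibre Mt I \<epsilon> \<omega>"
    and n0: "\<And>n. n0 \<le> n \<Longrightarrow> \<exists>xs. set xs \<subseteq> I \<and> sum_list xs = n" and i0: "i0 \<in> I"
    and p: "0 < e" "e < 1" "0 \<le> Hc" "\<gamma> * Hc + D \<le> (1 - e) * Hc" "0 < \<epsilon>" "0 \<le> Mt"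
  shows "0 < couple_rate Mt Hc e \<epsilon> n0 i0" "couple_rate Mt Hc e \<epsilon> n0 i0 \<le> 1"
proof -
  have \<omega>: "\<omega> \<in> fibres T"
    and mass: "\<And>k. (\<Sum>l. emeasure (refm T) {x \<in> \<Lambda>. l < R (shift (k - int l) \<omega>) x}) \<le> ennreal Mt"
    and I: "\<And>i k. i \<in> I \<Longrightarrow> ennreal \<epsilon> \<le> emeasure (refm T) {x \<in> \<Lambda>. R (shift k \<omega>) x = i}"
    using mix unfolding mixing_fibre_def by simp_all
  interpret W: renewal_tower lam "\<lambda>k. R (shift k \<omega>)" "\<lambda>k. gmap (shift k \<omega>)" "\<lambda>k. bsep (shift k \<omega>)"
    "\<lambda>k. same_base (shift k \<omega>)" "Lop \<omega>" \<gamma> D Mt Hc e \<epsilon> I n0 i0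
    by (rule renewal_towerI[OF \<omega> mass n0 i0 I p])
  show "0 < couple_rate Mt Hc e \<epsilon> n0 i0" "couple_rate Mt Hc e \<epsilon> n0 i0 \<le> 1"
    using W.\<theta>_pos W.\<theta>_le_1 unfolding W.\<theta>_eq_couple_rate by simp_all
qed

section \<open>Real densities and observables of either sign\<close>

lemma emeasure_tower_eq:
  assumes \<omega>: "\<omega> \<in> fibres T"
  shows "emeasure (tmeas T \<omega>) (space (tmeas T \<omega>)) = (\<Sum>l. emeasure (refm T) {x \<in> \<Lambda>. l < R (shift (0 - int l) \<omega>) x})"
proof -
  have "emeasure (tmeas T \<omega>) (space (tmeas T \<omega>)) = (\<integral>\<^sup>+z. 1 \<partial>tmeas T \<omega>)" by simp
  also have "\<dots> = (\<Sum>l. \<integral>\<^sup>+x. lev \<omega> (\<lambda>_. 1) l x \<partial>lam)"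
    by (rule nn_integral_tmeas[OF \<omega>]) simp
  also have "\<dots> = (\<Sum>l. emeasure (refm T) {x \<in> \<Lambda>. l < R (shift (0 - int l) \<omega>) x})"
  proof (intro arg_cong[where f=suminf] ext)
    fix l
    let ?A = "{x \<in> \<Lambda>. l < R (shift (0 - int l) \<omega>) x}"
    have A: "?A \<in> sets lam" using level_set[OF \<omega>, of l "0 - int l"] by (simp add: sets_lam)
    have "(\<integral>\<^sup>+x. lev \<omega> (\<lambda>_. 1) l x \<partial>lam) = (\<integral>\<^sup>+x. indicator ?A x \<partial>lam)"
    proof (rule nn_integral_cong)
      fix x
      show "lev \<omega> (\<lambda>_. 1) l x = indicator ?A x"
        using Tower_iff[OF \<omega>, of x l] by (cases "(x, l) \<in> Tower T \<omega>") (simp_all add: lev_def)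
    qed
    also have "\<dots> = emeasure lam ?A" using A by (rule nn_integral_indicator)
    also have "\<dots> = emeasure (refm T) ?A" by (rule emeasure_lam) simp
    finally show "(\<integral>\<^sup>+x. lev \<omega> (\<lambda>_. 1) l x \<partial>lam) = emeasure (refm T) ?A" .
  qed
  finally show ?thesis .
qed

lemma emeasure_tower_le:
  assumes mix: "mixing_fibre Mt I \<epsilon> \<omega>"
  shows "emeasure (tmeas T \<omega>) (space (tmeas T \<omega>)) \<le> ennreal Mt"
proof -
  have \<omega>: "\<omega> \<in> fibres T" and m: "(\<Sum>l. emeasure (refm T) {x \<in> \<Lambda>. l < R (shift (0 - int l) \<omega>) x}) \<le> ennreal Mt"
    using mix unfolding mixing_fibre_def by blast+
  show ?thesis using m unfolding emeasure_tower_eq[OF \<omega>] .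
qed

definition lreg :: "real \<Rightarrow> (int \<Rightarrow> 'u) \<Rightarrow> ('x \<times> nat \<Rightarrow> real) \<Rightarrow> bool" where
  "lreg Hc \<omega> \<rho> \<longleftrightarrow> (\<forall>l. \<forall>A\<in>cells (shift (- int l) \<omega>). \<forall>x\<in>A. \<forall>y\<in>A. l < R (shift (- int l) \<omega>) x \<longrightarrow>
     \<rho> (x, l) \<le> exp (Hc * bsep (shift (- int l) \<omega>) x y) * \<rho> (y, l))"

text \<open>Regular densities form a cone, from which the two densities to be coupled are
  assembled.\<close>

lemma lreg_add: "lreg Hc \<omega> f \<Longrightarrow> lreg Hc \<omega> g \<Longrightarrow> lreg Hc \<omega> (\<lambda>z. f z + g z)"
  unfolding lreg_def distrib_left by (intro allI ballI impI add_mono) blast+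

lemma lreg_cmult:
  assumes "lreg Hc \<omega> f" "0 \<le> c" shows "lreg Hc \<omega> (\<lambda>z. c * f z)"
  unfolding lreg_def
proof (intro allI ballI impI)
  fix l A x y assume "A \<in> cells (shift (- int l) \<omega>)" "x \<in> A" "y \<in> A" "l < R (shift (- int l) \<omega>) x"
  then have "f (x, l) \<le> exp (Hc * bsep (shift (- int l) \<omega>) x y) * f (y, l)"
    using assms(1) unfolding lreg_def by blast
  then have "c * f (x, l) \<le> c * (exp (Hc * bsep (shift (- int l) \<omega>) x y) * f (y, l))"
    using assms(2) by (rule mult_left_mono)
  then show "c * f (x, l) \<le> exp (Hc * bsep (shift (- int l) \<omega>) x y) * (c * f (y, l))"
    by (simp only: mult.left_commute)
qed

lemma lreg_const: "0 \<le> Hc \<Longrightarrow> 0 \<le> c \<Longrightarrow> lreg Hc \<omega> (\<lambda>_. c)"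
  unfolding lreg_def using bsep_range mult_right_mono[of 1 "exp _" c] by auto

lemma level_regularI:
  assumes "lreg Hc \<omega> f" "\<omega> \<in> fibres T" "\<And>z. z \<in> Tower T \<omega> \<Longrightarrow> 0 \<le> f z"
  shows "level_regular Hc \<omega> (\<lambda>z. ennreal (f z))"
  unfolding level_regular_def
proof (intro allI ballI impI)
  fix l A x y assume a: "A \<in> cells (shift (- int l) \<omega>)" "x \<in> A" "y \<in> A" "l < R (shift (- int l) \<omega>) x"
  have "R (shift (- int l) \<omega>) y = R (shift (- int l) \<omega>) x" by (rule R_const[OF _ a(1,3,2)]) (use assms in simp)
  moreover have "y \<in> \<Lambda>" using cells_subset[OF _ a(1)] a(3) assms by auto
  ultimately have "(y, l) \<in> Tower T \<omega>" using a(4) by (simp add: Tower_iff[OF assms(2)])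
  then have "0 \<le> f (y, l)" by (rule assms(3))
  moreover have "f (x, l) \<le> exp (Hc * bsep (shift (- int l) \<omega>) x y) * f (y, l)"
    using assms(1) a unfolding lreg_def by blast
  ultimately show "ennreal (f (x, l)) \<le> ennreal (exp (Hc * bsep (shift (- int l) \<omega>) x y)) * ennreal (f (y, l))"
    by (simp add: ennreal_mult[symmetric] ennreal_leI)
qed

lemma tmeas_integrable:
  fixes f :: "'x \<times> nat \<Rightarrow> real"
  assumes mix: "mixing_fibre Mt I \<epsilon> \<omega>" and f: "f \<in> borel_measurable (tmeas T \<omega>)"
    and B: "\<And>z. z \<in> Tower T \<omega> \<Longrightarrow> \<bar>f z\<bar> \<le> B"
  shows "integrable (tmeas T \<omega>) f"
proof -
  have \<omega>: "\<omega> \<in> fibres T" using mix unfolding mixing_fibre_def by blast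
  interpret finite_measure "tmeas T \<omega>"
    using emeasure_tower_le[OF mix] by (intro finite_measureI) (auto simp: top_unique)
  show ?thesis using B by (intro integrable_const_bound[where B=B] f AE_I2) (simp add: space_tmeas[OF \<omega>])
qed

lemma tmeas_integral_le:
  fixes f :: "'x \<times> nat \<Rightarrow> real"
  assumes mix: "mixing_fibre Mt I \<epsilon> \<omega>" and f: "f \<in> borel_measurable (tmeas T \<omega>)" and Mt: "0 \<le> Mt" and B0: "0 \<le> B"
    and B: "\<And>z. z \<in> Tower T \<omega> \<Longrightarrow> \<bar>f z\<bar> \<le> B"
  shows "\<bar>\<integral>z. f z \<partial>tmeas T \<omega>\<bar> \<le> B * Mt"
proof -
  have \<omega>: "\<omega> \<in> fibres T" using mix unfolding mixing_fibre_def by blast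
  have "\<bar>\<integral>z. f z \<partial>tmeas T \<omega>\<bar> \<le> (\<integral>z. \<bar>f z\<bar> \<partial>tmeas T \<omega>)" by (rule integral_abs_bound)
  also have "\<dots> \<le> (\<integral>z. B \<partial>tmeas T \<omega>)"
    using tmeas_integrable[OF mix f B] tmeas_integrable[OF mix, of "\<lambda>_. B" "\<bar>B\<bar>"] B
    by (intro integral_mono) (simp_all add: space_tmeas[OF \<omega>])
  also have "\<dots> = B * measure (tmeas T \<omega>) (space (tmeas T \<omega>))" by simp
  also have "\<dots> \<le> B * Mt"
    using emeasure_tower_le[OF mix] Mt B0 by (intro mult_left_mono) (auto simp: measure_def enn2real_leI)
  finally show ?thesis .
qed

text \<open>A signed \<open>f\<close> is replaced by \<open>f + P\<close>, with values between 0 and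
  \<open>2 * P\<close>. The shift adds the same \<open>P * \<mu>\<close> on both sides because the
  masses agree.\<close>

lemma fibre_contraction_real:
  assumes mix: "mixing_fibre Mt I \<epsilon> \<omega>"
    and n0: "\<And>n. n0 \<le> n \<Longrightarrow> \<exists>xs. set xs \<subseteq> I \<and> sum_list xs = n" and i0: "i0 \<in> I"
    and p: "0 < e" "e < 1" "0 \<le> Hc" "\<gamma> * Hc + D \<le> (1 - e) * Hc" "0 < \<epsilon>" "0 \<le> Mt"
    and \<rho>: "\<rho> \<in> borel_measurable (tmeas T \<omega>)" "lreg Hc \<omega> \<rho>"
      "\<And>z. z \<in> Tower T \<omega> \<Longrightarrow> 0 \<le> \<rho> z \<and> \<rho> z \<le> B" "(\<integral>z. \<rho> z \<partial>tmeas T \<omega>) = \<mu>"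
    and \<rho>': "\<rho>' \<in> borel_measurable (tmeas T \<omega>)" "lreg Hc \<omega> \<rho>'"
      "\<And>z. z \<in> Tower T \<omega> \<Longrightarrow> 0 \<le> \<rho>' z \<and> \<rho>' z \<le> B" "(\<integral>z. \<rho>' z \<partial>tmeas T \<omega>) = \<mu>"
    and \<mu>: "exp ((1 - e) * Hc) * \<mu> \<le> B"
    and S: "0 \<le> S" "q * (k + n0) \<le> n" "i0 \<le> k"
      "\<And>j. j < q \<Longrightarrow> fibre_tail \<omega> (int (j * (k + n0) + k)) k \<le> ennreal S"
    and f: "f \<in> borel_measurable (tmeas T (shift (int n) \<omega>))"
      "\<And>z. z \<in> Tower T (shift (int n) \<omega>) \<Longrightarrow> \<bar>f z\<bar> \<le> P" "0 \<le> P"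
  shows "(\<integral>z. f (titer T n \<omega> z) * \<rho> z \<partial>tmeas T \<omega>) \<le> (\<integral>z. f (titer T n \<omega> z) * \<rho>' z \<partial>tmeas T \<omega>)
    + 2 * P * (B * S + (1 - couple_rate Mt Hc e \<epsilon> n0 i0) ^ q * \<mu>)"
proof -
  have \<omega>: "\<omega> \<in> fibres T" using mix unfolding mixing_fibre_def by blast
  let ?F = "\<lambda>z. f (titer T n \<omega> z)"
  have Fm: "?F \<in> borel_measurable (tmeas T \<omega>)"
    by (rule measurable_compose[OF titer_measurable[OF \<omega>] f(1)])
  have Fb: "\<bar>?F z\<bar> \<le> P" if "z \<in> Tower T \<omega>" for z using f(2) titer_in_Tower[OF \<omega> that] by blast
  note \<theta> = couple_rate_range[OF mix n0 i0 p]
  have main: "(\<integral>\<^sup>+z. ennreal (?F z + P) * ennreal (r z) \<partial>tmeas T \<omega>) = ennreal ((\<integral>z. ?F z * r z \<partial>tmeas T \<omega>) + P * \<mu>)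
      \<and> (\<integral>\<^sup>+z. ennreal (r z) \<partial>tmeas T \<omega>) = ennreal \<mu> \<and> 0 \<le> (\<integral>z. ?F z * r z \<partial>tmeas T \<omega>) + P * \<mu> \<and> 0 \<le> \<mu>"
    if r: "r \<in> borel_measurable (tmeas T \<omega>)" "\<And>z. z \<in> Tower T \<omega> \<Longrightarrow> 0 \<le> r z \<and> r z \<le> B" "(\<integral>z. r z \<partial>tmeas T \<omega>) = \<mu>" for r
  proof -
    have ri: "integrable (tmeas T \<omega>) r" using r by (intro tmeas_integrable[OF mix, of r B]) auto
    have Fri: "integrable (tmeas T \<omega>) (\<lambda>z. ?F z * r z)"
    proof (rule tmeas_integrable[OF mix, of _ "P * B"])
      show "(\<lambda>z. ?F z * r z) \<in> borel_measurable (tmeas T \<omega>)" by (intro borel_measurable_times Fm r)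
      show "\<bar>?F z * r z\<bar> \<le> P * B" if "z \<in> Tower T \<omega>" for z
        unfolding abs_mult using Fb[OF that] r(2)[OF that] f(3) by (intro mult_mono) auto
    qed
    have nn: "0 \<le> (?F z + P) * r z" if "z \<in> space (tmeas T \<omega>)" for z
      using Fb[of z] r(2)[of z] that by (intro mult_nonneg_nonneg) (auto simp: space_tmeas[OF \<omega>])
    have int: "(\<integral>z. (?F z + P) * r z \<partial>tmeas T \<omega>) = (\<integral>z. ?F z * r z \<partial>tmeas T \<omega>) + P * \<mu>"
      unfolding distrib_right using ri Fri r(3) by simp
    have "(\<integral>\<^sup>+z. ennreal (?F z + P) * ennreal (r z) \<partial>tmeas T \<omega>) = (\<integral>\<^sup>+z. ennreal ((?F z + P) * r z) \<partial>tmeas T \<omega>)"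
    proof (rule nn_integral_cong)
      fix z assume "z \<in> space (tmeas T \<omega>)"
      then have z: "z \<in> Tower T \<omega>" by (simp add: space_tmeas[OF \<omega>])
      show "ennreal (?F z + P) * ennreal (r z) = ennreal ((?F z + P) * r z)"
        by (rule ennreal_mult[symmetric]) (use Fb[OF z] r(2)[OF z] in auto)
    qed
    also have "\<dots> = ennreal (\<integral>z. (?F z + P) * r z \<partial>tmeas T \<omega>)"
      using ri Fri nn by (intro nn_integral_eq_integral AE_I2) (simp_all add: distrib_right)
    finally have 1: "(\<integral>\<^sup>+z. ennreal (?F z + P) * ennreal (r z) \<partial>tmeas T \<omega>) = ennreal ((\<integral>z. ?F z * r z \<partial>tmeas T \<omega>) + P * \<mu>)"
      unfolding int .
    have 2: "(\<integral>\<^sup>+z. ennreal (r z) \<partial>tmeas T \<omega>) = ennreal \<mu>"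
      unfolding r(3)[symmetric] using ri r(2) by (intro nn_integral_eq_integral AE_I2) (simp_all add: space_tmeas[OF \<omega>])
    have 3: "0 \<le> (\<integral>z. (?F z + P) * r z \<partial>tmeas T \<omega>)" using nn by (rule Bochner_Integration.integral_nonneg)
    have 4: "0 \<le> \<mu>" unfolding r(3)[symmetric] using r(2) by (intro Bochner_Integration.integral_nonneg) (simp add: space_tmeas[OF \<omega>])
    show ?thesis using 1 2 3 4 unfolding int by blast
  qed
  note m = main[OF \<rho>(1,3,4)] and m' = main[OF \<rho>'(1,3,4)]
  let ?X = "2 * P * (B * S + (1 - couple_rate Mt Hc e \<epsilon> n0 i0) ^ q * max 0 (\<mu> - B * S))"
  have \<mu>0: "0 \<le> \<mu>" using m by blast
  have B0: "0 \<le> B" using \<mu>0 order_trans[OF _ \<mu>, of 0] by simp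
  have "(\<integral>\<^sup>+z. ennreal (?F z + P) * ennreal (\<rho> z) \<partial>tmeas T \<omega>) \<le> (\<integral>\<^sup>+z. ennreal (?F z + P) * ennreal (\<rho>' z) \<partial>tmeas T \<omega>) + ennreal ?X"
  proof (rule fibre_contraction[OF mix n0 i0 p, where f="\<lambda>z. ennreal (f z + P)" and \<rho>="\<lambda>z. ennreal (\<rho> z)" and \<rho>'="\<lambda>z. ennreal (\<rho>' z)"])
    show "(\<lambda>z. ennreal (\<rho> z)) \<in> borel_measurable (tmeas T \<omega>)" "(\<lambda>z. ennreal (\<rho>' z)) \<in> borel_measurable (tmeas T \<omega>)"
      using \<rho>(1) \<rho>'(1) by simp_all
    show "(\<lambda>z. ennreal (f z + P)) \<in> borel_measurable (tmeas T (shift (int n) \<omega>))" using f(1) by simp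
    show "level_regular Hc \<omega> (\<lambda>z. ennreal (\<rho> z))" using \<rho>(3) by (intro level_regularI[OF \<rho>(2) \<omega>]) blast
    show "level_regular Hc \<omega> (\<lambda>z. ennreal (\<rho>' z))" using \<rho>'(3) by (intro level_regularI[OF \<rho>'(2) \<omega>]) blast
    show "ennreal (\<rho> z) \<le> ennreal B" if "z \<in> Tower T \<omega>" for z using \<rho>(3)[OF that] by (intro ennreal_leI) blast
    show "ennreal (\<rho>' z) \<le> ennreal B" if "z \<in> Tower T \<omega>" for z using \<rho>'(3)[OF that] by (intro ennreal_leI) blast
    show "(\<integral>\<^sup>+z. ennreal (\<rho> z) \<partial>tmeas T \<omega>) = ennreal \<mu>" using m by blast
    show "(\<integral>\<^sup>+z. ennreal (\<rho>' z) \<partial>tmeas T \<omega>) = ennreal \<mu>" using m' by blast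
    show "ennreal (f z + P) \<le> ennreal (2 * P)" if "z \<in> Tower T (shift (int n) \<omega>)" for z
      using f(2)[OF that] by (intro ennreal_leI) auto
  qed (use \<mu> \<mu>0 S f(3) in auto)
  then have "ennreal ((\<integral>z. ?F z * \<rho> z \<partial>tmeas T \<omega>) + P * \<mu>) \<le> ennreal ((\<integral>z. ?F z * \<rho>' z \<partial>tmeas T \<omega>) + P * \<mu>) + ennreal ?X"
    using m m' by simp
  moreover have X0: "0 \<le> ?X" using f(3) B0 S(1) \<theta> by simp
  ultimately have "(\<integral>z. ?F z * \<rho> z \<partial>tmeas T \<omega>) + P * \<mu> \<le> (\<integral>z. ?F z * \<rho>' z \<partial>tmeas T \<omega>) + P * \<mu> + ?X"
    using m' by (subst (asm) ennreal_plus[symmetric]) (auto simp: ennreal_le_iff simp del: ennreal_plus)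
  then have "(\<integral>z. ?F z * \<rho> z \<partial>tmeas T \<omega>) \<le> (\<integral>z. ?F z * \<rho>' z \<partial>tmeas T \<omega>) + ?X" by simp
  also have "?X \<le> 2 * P * (B * S + (1 - couple_rate Mt Hc e \<epsilon> n0 i0) ^ q * \<mu>)"
    using f(3) \<theta> \<mu>0 B0 S(1) by (intro mult_left_mono add_left_mono) auto
  finally show ?thesis by simp
qed

lemma equivariant_iter:
  assumes \<omega>: "\<omega> \<in> fibres T"
    and h: "\<And>\<omega>. \<omega> \<in> fibres T \<Longrightarrow> h \<omega> \<in> borel_measurable (tmeas T \<omega>)"
    and eq: "\<And>i. distr (nu T h (shift (int i) \<omega>)) (tmeas T (shift (1 + int i) \<omega>)) (tmap T (shift (int i) \<omega>)) = nu T h (shift (1 + int i) \<omega>)"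
  shows "distr (nu T h \<omega>) (tmeas T (shift (int n) \<omega>)) (titer T n \<omega>) = nu T h (shift (int n) \<omega>)"
proof (induction n)
  case 0
  have "titer T 0 \<omega> = (\<lambda>z. z)" by auto
  moreover have "sets (tmeas T \<omega>) = sets (nu T h \<omega>)" by (simp add: nu_def)
  ultimately show ?case by (simp add: distr_id2)
next
  case (Suc n)
  have sn: "shift (int (Suc n)) \<omega> = shift (1 + int n) \<omega>" by simp
  have t: "titer T (Suc n) \<omega> = tmap T (shift (int n) \<omega>) \<circ> titer T n \<omega>" by auto
  have m1: "tmap T (shift (int n) \<omega>) \<in> measurable (tmeas T (shift (int n) \<omega>)) (tmeas T (shift (1 + int n) \<omega>))"
    using tmap_measurable[of "shift (int n) \<omega>"] \<omega> by simp
  have m2: "titer T n \<omega> \<in> measurable (nu T h \<omega>) (tmeas T (shift (int n) \<omega>))"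
    using titer_measurable[OF \<omega>, of n] by (simp add: nu_def)
  show ?case unfolding sn t distr_distr[OF m1 m2, symmetric] Suc.IH by (rule eq)
qed

lemma FK_D:
  assumes "\<phi> \<in> FK T \<gamma> K"
  obtains c c' where "0 < c" "0 < c'"
    "\<And>\<omega> z. \<omega> \<in> fibres T \<Longrightarrow> z \<in> Tower T \<omega> \<Longrightarrow> \<bar>\<phi> \<omega> z\<bar> \<le> c * K \<omega>"
    "\<And>\<omega> z w. \<omega> \<in> fibres T \<Longrightarrow> z \<in> Tower T \<omega> \<Longrightarrow> w \<in> Tower T \<omega> \<Longrightarrow>
      \<bar>\<phi> \<omega> z - \<phi> \<omega> w\<bar> \<le> c' * K \<omega> * epow \<gamma> (sep T (\<omega>, z) (\<omega>, w))"
  using assms unfolding FK_def LinfK_def by blast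

lemma FK_measurable:
  assumes "\<phi> \<in> FK T \<gamma> K" "\<omega> \<in> fibres T" "0 \<le> K \<omega>"
  shows "\<phi> \<omega> \<in> borel_measurable (tmeas T \<omega>)"
proof -
  obtain c c' where c: "0 < c'" "\<And>\<omega> z w. \<omega> \<in> fibres T \<Longrightarrow> z \<in> Tower T \<omega> \<Longrightarrow> w \<in> Tower T \<omega> \<Longrightarrow>
      \<bar>\<phi> \<omega> z - \<phi> \<omega> w\<bar> \<le> c' * K \<omega> * epow \<gamma> (sep T (\<omega>, z) (\<omega>, w))"
    using FK_D[OF assms(1)] by metis
  show ?thesis
    by (rule holder_measurable[OF assms(2), where C="c' * K \<omega>"]) (use c assms in auto)
qed

lemma cell_in_tcells:
  assumes \<omega>: "\<omega> \<in> fibres T" and A: "A \<in> cells (shift (- int l) \<omega>)" "x \<in> A" "l < R (shift (- int l) \<omega>) x"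
  shows "A \<times> {l} \<in> tcells T \<omega>"
proof -
  have "\<forall>y\<in>A. l < R (shift (- int l) \<omega>) y"
  proof
    fix y assume "y \<in> A"
    then show "l < R (shift (- int l) \<omega>) y" using R_const[OF _ A(1) _ A(2), of y] A(3) \<omega> by simp
  qed
  then show ?thesis unfolding tcells_eq[OF \<omega>] using A(1) by blast
qed

lemma epow_sep_level':
  assumes \<omega>: "\<omega> \<in> fibres T" and A: "A \<in> cells (shift (- int l) \<omega>)" "x \<in> A" "y \<in> A" "l < R (shift (- int l) \<omega>) x"
  shows "epow \<gamma> (sep T (\<omega>, (x, l)) (\<omega>, (y, l))) = bsep (shift (- int l) \<omega>) x y"
  using epow_sep_level[OF _ A] \<omega> by simp

lemma Fplus_nonneg:
  assumes "h \<in> Fplus T \<gamma>" "\<omega> \<in> fibres T" "z \<in> Tower T \<omega>"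
  shows "0 \<le> h \<omega> z"
proof -
  obtain x l where z: "z = (x, l)" by (cases z)
  have x: "x \<in> \<Lambda>" "l < R (shift (- int l) \<omega>) x" using assms(3) z by (simp_all add: Tower_iff[OF assms(2)])
  have "shift (- int l) \<omega> \<in> fibres T" using assms(2) by simp
  from cells_Union[OF this] x(1) obtain A where A: "A \<in> cells (shift (- int l) \<omega>)" "x \<in> A" by blast
  have "A \<times> {l} \<in> tcells T \<omega>" by (rule cell_in_tcells[OF assms(2) A x(2)])
  moreover have "z \<in> A \<times> {l}" using z A by simp
  moreover from assms(1,2) have "\<forall>I\<in>tcells T \<omega>. (\<forall>x\<in>I. h \<omega> x = 0) \<or> (\<forall>x\<in>I. 0 < h \<omega> x)"
    unfolding Fplus_def by blast
  ultimately show ?thesis by force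
qed

lemma Fplus_lreg:
  assumes "h \<in> Fplus T \<gamma>"
  obtains C where "0 < C" "\<And>\<omega> Hc. \<omega> \<in> fibres T \<Longrightarrow> C \<le> Hc \<Longrightarrow> lreg Hc \<omega> (h \<omega>)"
proof -
  obtain C where C: "0 < C" "\<forall>\<omega>\<in>fibres T. \<forall>I\<in>tcells T \<omega>.
      (\<forall>x\<in>I. h \<omega> x = 0) \<or>
      (\<forall>x\<in>I. 0 < h \<omega> x) \<and>
      (\<forall>x\<in>I. \<forall>y\<in>I. \<bar>ln (h \<omega> x / h \<omega> y)\<bar> \<le> C * epow \<gamma> (sep T (\<omega>, x) (\<omega>, y)))"
    using assms unfolding Fplus_def by blast
  show thesis
  proof (rule that[OF C(1)])
    fix \<omega> Hc assume \<omega>: "\<omega> \<in> fibres T" and Hc: "C \<le> Hc"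
    show "lreg Hc \<omega> (h \<omega>)"
      unfolding lreg_def
    proof (intro allI ballI impI)
      fix l A x y assume A: "A \<in> cells (shift (- int l) \<omega>)" "x \<in> A" "y \<in> A" "l < R (shift (- int l) \<omega>) x"
      let ?s = "bsep (shift (- int l) \<omega>) x y"
      have I: "A \<times> {l} \<in> tcells T \<omega>" by (rule cell_in_tcells[OF \<omega> A(1,2,4)])
      have xy: "(x, l) \<in> A \<times> {l}" "(y, l) \<in> A \<times> {l}" using A by simp_all
      consider "h \<omega> (x, l) = 0" "h \<omega> (y, l) = 0"
        | "0 < h \<omega> (x, l)" "0 < h \<omega> (y, l)" "\<bar>ln (h \<omega> (x, l) / h \<omega> (y, l))\<bar> \<le> C * epow \<gamma> (sep T (\<omega>, (x, l)) (\<omega>, (y, l)))"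
        using bspec[OF bspec[OF C(2) \<omega>] I] xy by blast
      then show "h \<omega> (x, l) \<le> exp (Hc * ?s) * h \<omega> (y, l)"
      proof cases
        case 2
        have "ln (h \<omega> (x, l) / h \<omega> (y, l)) \<le> C * ?s"
          using 2(3) unfolding epow_sep_level'[OF \<omega> A] by linarith
        also have "\<dots> \<le> Hc * ?s" using Hc bsep_range by (intro mult_right_mono) auto
        finally have "exp (ln (h \<omega> (x, l) / h \<omega> (y, l))) \<le> exp (Hc * ?s)" by simp
        then have "h \<omega> (x, l) / h \<omega> (y, l) \<le> exp (Hc * ?s)" using 2 by simp
        then show ?thesis using 2 by (simp add: divide_le_eq)
      qed simp
    qed
  qed
qed

text \<open>A Hoelder function that is bounded below by the scale \<open>K\<close> of its Hoelder
  constant is log-Hoelder: its oscillation is at most \<open>c' * s\<close> times its value, and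
  \<open>1 + c' * s \<le> exp (c' * s)\<close>.\<close>

lemma holder_shift_lreg:
  assumes \<omega>: "\<omega> \<in> fibres T" and K: "0 < K" and c: "0 \<le> c'" "c' \<le> Hc"
    and f: "\<And>z w. z \<in> Tower T \<omega> \<Longrightarrow> w \<in> Tower T \<omega> \<Longrightarrow> \<bar>f z - f w\<bar> \<le> c' * K * epow \<gamma> (sep T (\<omega>, z) (\<omega>, w))"
    and pos: "\<And>z. z \<in> Tower T \<omega> \<Longrightarrow> K \<le> f z"
  shows "lreg Hc \<omega> f"
  unfolding lreg_def
proof (intro allI ballI impI)
  fix l A x y assume A: "A \<in> cells (shift (- int l) \<omega>)" "x \<in> A" "y \<in> A" "l < R (shift (- int l) \<omega>) x"
  let ?s = "bsep (shift (- int l) \<omega>) x y"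
  have \<omega>': "shift (- int l) \<omega> \<in> fibres T" using \<omega> by simp
  have L: "x \<in> \<Lambda>" "y \<in> \<Lambda>" using cells_subset[OF \<omega>' A(1)] A by auto
  have Ry: "R (shift (- int l) \<omega>) y = R (shift (- int l) \<omega>) x" by (rule R_const[OF \<omega>' A(1,3,2)])
  have xy: "(x, l) \<in> Tower T \<omega>" "(y, l) \<in> Tower T \<omega>" using L A(4) Ry by (simp_all add: Tower_iff[OF \<omega>])
  have s: "0 \<le> ?s" by (rule bsep_range)
  have "f (x, l) \<le> f (y, l) + c' * K * ?s"
    using f[OF xy] unfolding epow_sep_level'[OF \<omega> A] by linarith
  also have "c' * K * ?s = (c' * ?s) * K" by simp
  also have "(c' * ?s) * K \<le> (c' * ?s) * f (y, l)" using pos[OF xy(2)] c s by (intro mult_left_mono) auto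
  also have "f (y, l) + (c' * ?s) * f (y, l) = (1 + c' * ?s) * f (y, l)" by (simp add: algebra_simps)
  also have "\<dots> \<le> exp (Hc * ?s) * f (y, l)"
  proof (rule mult_right_mono)
    have "1 + c' * ?s \<le> exp (c' * ?s)" by (rule exp_ge_add_one_self)
    also have "\<dots> \<le> exp (Hc * ?s)" using c s by (simp add: mult_right_mono)
    finally show "1 + c' * ?s \<le> exp (Hc * ?s)" .
    show "0 \<le> f (y, l)" using pos[OF xy(2)] K by simp
  qed
  finally show "f (x, l) \<le> exp (Hc * ?s) * f (y, l)" by simp
qed

text \<open>By equivariance the integral of \<phi> against \<nu> at time \<open>n\<close> equals
  that of \<phi> after \<open>n\<close> steps against \<open>h\<close> now. So the correlation tests
  \<psi> minus its mean times \<open>h\<close>, a function of integral 0, and this is a difference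
  of two couplable densities.\<close>

lemma correlation_bound:
  assumes \<phi>: "\<phi> \<in> FK T \<gamma> K" and \<psi>: "\<psi> \<in> FK T \<gamma> K" and h: "h \<in> FK T \<gamma> K" "h \<in> Fplus T \<gamma>"
    and hp: "\<And>\<omega>. \<omega> \<in> fibres T \<Longrightarrow> h \<omega> \<in> borel_measurable (tmeas T \<omega>) \<and> prob_space (nu T h \<omega>)"
    and K: "0 < \<kappa>" "\<And>\<omega>. \<kappa> \<le> K \<omega>"
    and n0: "\<And>n. n0 \<le> n \<Longrightarrow> \<exists>xs. set xs \<subseteq> I \<and> sum_list xs = n" and i0: "i0 \<in> I"
    and p: "0 < \<epsilon>" "0 \<le> Mt"
  shows "\<exists>A\<ge>0. \<exists>\<theta>. \<forall>\<omega>. mixing_fibre Mt I \<epsilon> \<omega> \<longrightarrow>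
    (\<forall>i. distr (nu T h (shift (int i) \<omega>)) (tmeas T (shift (1 + int i) \<omega>)) (tmap T (shift (int i) \<omega>)) = nu T h (shift (1 + int i) \<omega>)) \<longrightarrow>
    0 < \<theta> \<and> \<theta> \<le> 1 \<and>
    (\<forall>n q k S. 0 \<le> S \<longrightarrow> q * (k + n0) \<le> n \<longrightarrow> i0 \<le> k \<longrightarrow>
      (\<forall>j<q. fibre_tail \<omega> (int (j * (k + n0) + k)) k \<le> ennreal S) \<longrightarrow>
      \<bar>correlation T h \<phi> \<psi> n \<omega>\<bar>
      \<le> A * K (shift (int n) \<omega>) * K \<omega> ^ 2 * (S + (1 - \<theta>) ^ q))"
proof -
  obtain c\<phi> c\<phi>' where c\<phi>: "0 < c\<phi>" "\<And>\<omega> z. \<omega> \<in> fibres T \<Longrightarrow> z \<in> Tower T \<omega> \<Longrightarrow> \<bar>\<phi> \<omega> z\<bar> \<le> c\<phi> * K \<omega>"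
    by (rule FK_D[OF \<phi>]) blast
  obtain c\<psi> c\<psi>' where c\<psi>: "0 < c\<psi>" "0 < c\<psi>'" "\<And>\<omega> z. \<omega> \<in> fibres T \<Longrightarrow> z \<in> Tower T \<omega> \<Longrightarrow> \<bar>\<psi> \<omega> z\<bar> \<le> c\<psi> * K \<omega>"
     "\<And>\<omega> z w. \<omega> \<in> fibres T \<Longrightarrow> z \<in> Tower T \<omega> \<Longrightarrow> w \<in> Tower T \<omega> \<Longrightarrow>
      \<bar>\<psi> \<omega> z - \<psi> \<omega> w\<bar> \<le> c\<psi>' * K \<omega> * epow \<gamma> (sep T (\<omega>, z) (\<omega>, w))"
    by (rule FK_D[OF \<psi>]) blast
  obtain ch ch' where ch: "0 < ch" "\<And>\<omega> z. \<omega> \<in> fibres T \<Longrightarrow> z \<in> Tower T \<omega> \<Longrightarrow> \<bar>h \<omega> z\<bar> \<le> ch * K \<omega>"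
    by (rule FK_D[OF h(1)]) blast
  obtain C where C: "0 < C" "\<And>\<omega> Hc. \<omega> \<in> fibres T \<Longrightarrow> C \<le> Hc \<Longrightarrow> lreg Hc \<omega> (h \<omega>)"
    by (rule Fplus_lreg[OF h(2)]) blast
  \<comment> \<open>Half of the gap between \<gamma> and 1: then
    \<open>1 - e - \<gamma> = e\<close>, and the regularity condition reduces to
    \<open>D \<le> e * Hc\<close>.\<close>
  define e where "e = (1 - \<gamma>) / 2"
  define Hc where "Hc = max (max C c\<psi>') (D / e)"
  have e: "0 < e" "e < 1" unfolding e_def using \<gamma>_range by auto
  have Hc: "C \<le> Hc" "c\<psi>' \<le> Hc" "D / e \<le> Hc" "0 \<le> Hc" unfolding Hc_def using C(1) by auto
  have "D \<le> Hc * e" using Hc(3) e(1) by (simp add: divide_le_eq)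
  then have Hc': "\<gamma> * Hc + D \<le> (1 - e) * Hc"
    unfolding e_def by (simp add: algebra_simps add_divide_distrib diff_divide_distrib)
  \<comment> \<open>Large enough for \<open>\<psi> + c0 * K\<close> to be at least \<open>K\<close>,
    as \<open>holder_shift_lreg\<close> requires.\<close>
  define c0 where "c0 = c\<psi> + 1"
  define B0 where "B0 = (c\<psi> + c0) / \<kappa> + 2 * c\<psi> * Mt * ch"
  \<comment> \<open>\<open>B0\<close> bounds the two densities in units of \<open>K ^ 2\<close>; the
    additional factor leaves room for \<open>exp H\<close> times their mass.\<close>
  define B1 where "B1 = B0 * (1 + exp ((1 - e) * Hc) * Mt)"
  define A where "A = 2 * c\<phi> * B1"
  define \<theta> where "\<theta> = couple_rate Mt Hc e \<epsilon> n0 i0"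
  have B0: "0 \<le> B0" unfolding B0_def c0_def using c\<psi>(1) ch(1) K(1) p(2) by simp
  have B1: "0 \<le> B1" "B0 \<le> B1" unfolding B1_def using B0 p(2) mult_left_mono[of 1 "1 + exp ((1 - e) * Hc) * Mt" B0] by auto
  have A: "0 \<le> A" unfolding A_def using B1 c\<phi> by simp
  show ?thesis
  proof (rule exI[of _ A], intro conjI exI[of _ \<theta>] allI impI)
    show "0 \<le> A" by (rule A)
    fix \<omega> assume mix: "mixing_fibre Mt I \<epsilon> \<omega>"
      and eqv: "\<forall>i. distr (nu T h (shift (int i) \<omega>)) (tmeas T (shift (1 + int i) \<omega>)) (tmap T (shift (int i) \<omega>)) = nu T h (shift (1 + int i) \<omega>)"
    have \<omega>: "\<omega> \<in> fibres T" using mix unfolding mixing_fibre_def by blast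
    have \<theta>1: "0 < \<theta>" unfolding \<theta>_def by (rule couple_rate_range(1)[OF mix n0 i0 e Hc(4) Hc' p])
    have \<theta>2: "\<theta> \<le> 1" unfolding \<theta>_def by (rule couple_rate_range(2)[OF mix n0 i0 e Hc(4) Hc' p])
    note \<theta>r = \<theta>1 \<theta>2
    show "0 < \<theta>" by (rule \<theta>r(1))
    show "\<theta> \<le> 1" by (rule \<theta>r(2))
    fix n q k S assume S: "0 \<le> S" "q * (k + n0) \<le> n" "i0 \<le> k"
      "\<forall>j<q. fibre_tail \<omega> (int (j * (k + n0) + k)) k \<le> ennreal S"
    have K0: "0 < K \<omega>" "0 < K (shift (int n) \<omega>)" using K(1) K(2)[of \<omega>] K(2)[of "shift (int n) \<omega>"] by linarith+
    have \<omega>n: "shift (int n) \<omega> \<in> fibres T" using \<omega> by simp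
    let ?\<phi> = "\<phi> (shift (int n) \<omega>)"
    have \<phi>m: "?\<phi> \<in> borel_measurable (tmeas T (shift (int n) \<omega>))"
      by (rule FK_measurable[OF \<phi> \<omega>n]) (use K0 in simp)
    have \<psi>m: "\<psi> \<omega> \<in> borel_measurable (tmeas T \<omega>)" by (rule FK_measurable[OF \<psi> \<omega>]) (use K0 in simp)
    have hm: "h \<omega> \<in> borel_measurable (tmeas T \<omega>)" and hpr: "prob_space (nu T h \<omega>)" using hp[OF \<omega>] by simp_all
    let ?F = "\<lambda>z. ?\<phi> (titer T n \<omega> z)"
    have Fm: "?F \<in> borel_measurable (tmeas T \<omega>)" by (rule measurable_compose[OF titer_measurable[OF \<omega>] \<phi>m])
    have Fb: "\<bar>?F z\<bar> \<le> c\<phi> * K (shift (int n) \<omega>)" if "z \<in> Tower T \<omega>" for z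
      by (rule c\<phi>(2)[OF \<omega>n titer_in_Tower[OF \<omega> that]])
    have h0: "0 \<le> h \<omega> z" "h \<omega> z \<le> ch * K \<omega>" if "z \<in> Tower T \<omega>" for z
      using Fplus_nonneg[OF h(2) \<omega> that] ch(2)[OF \<omega> that] by linarith+
    have hAE: "AE z in tmeas T \<omega>. 0 \<le> h \<omega> z" using h0 by (intro AE_I2) (simp add: space_tmeas[OF \<omega>])
    have hi: "integrable (tmeas T \<omega>) (h \<omega>)" using ch(2)[OF \<omega>] by (intro tmeas_integrable[OF mix hm, of "ch * K \<omega>"]) auto
    have \<psi>i: "integrable (tmeas T \<omega>) (\<psi> \<omega>)" using c\<psi>(3)[OF \<omega>] by (intro tmeas_integrable[OF mix \<psi>m, of "c\<psi> * K \<omega>"]) auto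
    have ci: "integrable (tmeas T \<omega>) (\<lambda>_. c)" for c :: real by (rule tmeas_integrable[OF mix, of _ "\<bar>c\<bar>"]) simp_all
    have h1: "(\<integral>z. h \<omega> z \<partial>tmeas T \<omega>) = 1"
    proof -
      have "(\<integral>z. h \<omega> z \<partial>tmeas T \<omega>) = (\<integral>z. 1 \<partial>nu T h \<omega>)"
        unfolding nu_def by (subst integral_density[OF _ hm hAE]) simp_all
      also have "\<dots> = 1" using prob_space.prob_space[OF hpr] by simp
      finally show ?thesis .
    qed
    have nuint: "(\<integral>z. ?\<phi> z \<partial>nu T h (shift (int n) \<omega>)) = (\<integral>z. ?F z * h \<omega> z \<partial>tmeas T \<omega>)"
    proof -
      have eq: "distr (nu T h \<omega>) (tmeas T (shift (int n) \<omega>)) (titer T n \<omega>) = nu T h (shift (int n) \<omega>)"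
        by (rule equivariant_iter[OF \<omega>]) (use hp eqv in blast)+
      have "(\<integral>z. ?\<phi> z \<partial>nu T h (shift (int n) \<omega>)) = (\<integral>z. ?F z \<partial>nu T h \<omega>)"
        unfolding eq[symmetric] by (rule integral_distr[OF _ \<phi>m]) (use titer_measurable[OF \<omega>, of n] in \<open>simp add: nu_def\<close>)
      also have "\<dots> = (\<integral>z. h \<omega> z *\<^sub>R ?F z \<partial>tmeas T \<omega>)"
        unfolding nu_def by (rule integral_density[OF Fm hm hAE])
      finally show ?thesis by (simp add: mult.commute)
    qed
    define m where "m = (\<integral>z. \<psi> \<omega> z \<partial>tmeas T \<omega>)"
    \<comment> \<open>The absolute value makes both coefficients of \<open>h\<close>, namely
      \<open>c1\<close> and \<open>c1 + m\<close>, nonnegative.\<close>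
    define c1 where "c1 = \<bar>m\<bar>"
    have c1: "0 \<le> c1" "c1 \<le> c\<psi> * K \<omega> * Mt" "0 \<le> c1 + m" "c1 + m \<le> 2 * c1"
      unfolding c1_def m_def using tmeas_integral_le[OF mix \<psi>m p(2) _ c\<psi>(3)[OF \<omega>]] c\<psi>(1) K0 by auto
    \<comment> \<open>Two regular positive densities of the same mass, with difference \<open>\<psi> - m h\<close>.\<close>
    define \<rho> where "\<rho> z = (\<psi> \<omega> z + c0 * K \<omega>) + c1 * h \<omega> z" for z
    define \<rho>' where "\<rho>' z = c0 * K \<omega> + (c1 + m) * h \<omega> z" for z
    define B where "B = B1 * K \<omega> ^ 2"
    have c0K: "0 \<le> c0 * K \<omega>" unfolding c0_def using c\<psi>(1) K0 by simp
    \<comment> \<open>The terms linear in \<open>K\<close> are absorbed into the quadratic one that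
      comes from the mean times \<open>h\<close>.\<close>
    have KK: "K \<omega> \<le> K \<omega> ^ 2 / \<kappa>"
      using K(1) K(2)[of \<omega>] K0(1) by (simp add: le_divide_eq power2_eq_square)
    have bnd: "c\<psi> * K \<omega> + c0 * K \<omega> + 2 * c1 * (ch * K \<omega>) \<le> B0 * K \<omega> ^ 2"
    proof -
      have "(c\<psi> + c0) * K \<omega> \<le> (c\<psi> + c0) * (K \<omega> ^ 2 / \<kappa>)"
        using KK c\<psi>(1) by (intro mult_left_mono) (auto simp: c0_def)
      moreover have "2 * c1 * (ch * K \<omega>) \<le> 2 * (c\<psi> * K \<omega> * Mt) * (ch * K \<omega>)"
        using c1 ch(1) K0(1) by (intro mult_right_mono mult_left_mono) auto
      ultimately show ?thesis unfolding B0_def by (simp add: algebra_simps power2_eq_square)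
    qed
    have \<rho>m: "\<rho> \<in> borel_measurable (tmeas T \<omega>)" "\<rho>' \<in> borel_measurable (tmeas T \<omega>)"
      unfolding \<rho>_def[abs_def] \<rho>'_def[abs_def] using \<psi>m hm by simp_all
    have \<psi>pos: "K \<omega> \<le> \<psi> \<omega> z + c0 * K \<omega>" if "z \<in> Tower T \<omega>" for z
      using c\<psi>(3)[OF \<omega> that] unfolding c0_def by (simp add: algebra_simps abs_le_iff)
    have hl: "lreg Hc \<omega> (h \<omega>)" by (rule C(2)[OF \<omega> Hc(1)])
    have "lreg Hc \<omega> (\<lambda>z. \<psi> \<omega> z + c0 * K \<omega>)"
      by (rule holder_shift_lreg[OF \<omega> K0(1) _ Hc(2)]) (use c\<psi>(2) c\<psi>(4)[OF \<omega>] \<psi>pos in auto)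
    then have \<rho>l: "lreg Hc \<omega> \<rho>"
      unfolding \<rho>_def[abs_def] by (rule lreg_add[OF _ lreg_cmult[OF hl c1(1)]])
    have \<rho>l': "lreg Hc \<omega> \<rho>'"
      unfolding \<rho>'_def[abs_def] by (rule lreg_add[OF lreg_const[OF Hc(4) c0K] lreg_cmult[OF hl c1(3)]])
    have hb: "0 \<le> c1 * h \<omega> z" "c1 * h \<omega> z \<le> 2 * c1 * (ch * K \<omega>)" "0 \<le> (c1 + m) * h \<omega> z" "(c1 + m) * h \<omega> z \<le> 2 * c1 * (ch * K \<omega>)"
      if "z \<in> Tower T \<omega>" for z
    proof -
      show "0 \<le> c1 * h \<omega> z" "0 \<le> (c1 + m) * h \<omega> z" using h0[OF that] c1 by simp_all
      show "c1 * h \<omega> z \<le> 2 * c1 * (ch * K \<omega>)" using h0[OF that] c1(1) by (intro mult_mono) auto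
      show "(c1 + m) * h \<omega> z \<le> 2 * c1 * (ch * K \<omega>)" using h0[OF that] c1 by (intro mult_mono) auto
    qed
    have B0B: "B0 * K \<omega> ^ 2 \<le> B" unfolding B_def using B1 by (intro mult_right_mono) auto
    have \<psi>K: "0 \<le> c\<psi> * K \<omega>" using c\<psi>(1) K0 by simp
    have \<rho>b: "0 \<le> \<rho> z \<and> \<rho> z \<le> B0 * K \<omega> ^ 2" if "z \<in> Tower T \<omega>" for z
      unfolding \<rho>_def using \<psi>pos[OF that] K0(1) c\<psi>(3)[OF \<omega> that] hb[OF that] bnd by linarith
    have \<rho>b': "0 \<le> \<rho>' z \<and> \<rho>' z \<le> B0 * K \<omega> ^ 2" if "z \<in> Tower T \<omega>" for z
      unfolding \<rho>'_def using \<psi>K c0K hb[OF that] bnd by linarith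
    define \<mu> where "\<mu> = (\<integral>z. \<rho> z \<partial>tmeas T \<omega>)"
    have \<rho>i: "integrable (tmeas T \<omega>) \<rho>" "integrable (tmeas T \<omega>) \<rho>'"
      using \<rho>b \<rho>b' by (auto intro!: tmeas_integrable[OF mix \<rho>m(1), of "B0 * K \<omega> ^ 2"] tmeas_integrable[OF mix \<rho>m(2), of "B0 * K \<omega> ^ 2"])
    have \<mu>': "(\<integral>z. \<rho>' z \<partial>tmeas T \<omega>) = \<mu>"
      unfolding \<mu>_def \<rho>_def \<rho>'_def using \<psi>i hi ci h1 by (simp add: m_def algebra_simps)
    have \<mu>0: "0 \<le> \<mu>" unfolding \<mu>_def using \<rho>b by (intro Bochner_Integration.integral_nonneg) (simp add: space_tmeas[OF \<omega>])
    have \<mu>le: "\<mu> \<le> B0 * K \<omega> ^ 2 * Mt"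
      using tmeas_integral_le[OF mix \<rho>m(1) p(2), of "B0 * K \<omega> ^ 2"] \<rho>b B0 \<mu>0 unfolding \<mu>_def[symmetric] by auto
    have "exp ((1 - e) * Hc) * \<mu> \<le> exp ((1 - e) * Hc) * (B0 * K \<omega> ^ 2 * Mt)"
      using \<mu>le by (intro mult_left_mono) auto
    also have "\<dots> \<le> B" unfolding B_def B1_def using B0 by (simp add: algebra_simps)
    finally have \<mu>B: "exp ((1 - e) * Hc) * \<mu> \<le> B" .
    have "1 * \<mu> \<le> exp ((1 - e) * Hc) * \<mu>" using \<mu>0 e Hc by (intro mult_right_mono) auto
    then have \<mu>B': "\<mu> \<le> B" using \<mu>B by simp
    let ?P = "c\<phi> * K (shift (int n) \<omega>)"
    let ?E = "2 * ?P * (B * S + (1 - \<theta>) ^ q * \<mu>)"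
    have P0: "0 \<le> ?P" using c\<phi>(1) K0 by simp
    have \<rho>B: "0 \<le> \<rho> z \<and> \<rho> z \<le> B" if "z \<in> Tower T \<omega>" for z using \<rho>b[OF that] B0B by linarith
    have \<rho>B': "0 \<le> \<rho>' z \<and> \<rho>' z \<le> B" if "z \<in> Tower T \<omega>" for z using \<rho>b'[OF that] B0B by linarith
    note contr = fibre_contraction_real[OF mix n0 i0 e Hc(4) Hc' p _ _ _ _ _ _ _ _ \<mu>B S(1-3) S(4)[rule_format] \<phi>m c\<phi>(2)[OF \<omega>n] P0, folded \<theta>_def]
    have 1: "(\<integral>z. ?F z * \<rho> z \<partial>tmeas T \<omega>) \<le> (\<integral>z. ?F z * \<rho>' z \<partial>tmeas T \<omega>) + ?E"
      by (rule contr[OF _ \<rho>m(1) \<rho>l \<rho>B \<mu>_def[symmetric] \<rho>m(2) \<rho>l' \<rho>B' \<mu>'])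
    have 2: "(\<integral>z. ?F z * \<rho>' z \<partial>tmeas T \<omega>) \<le> (\<integral>z. ?F z * \<rho> z \<partial>tmeas T \<omega>) + ?E"
      by (rule contr[OF _ \<rho>m(2) \<rho>l' \<rho>B' \<mu>' \<rho>m(1) \<rho>l \<rho>B \<mu>_def[symmetric]])
    have Fi: "integrable (tmeas T \<omega>) (\<lambda>z. ?F z * r z)" if r: "r \<in> borel_measurable (tmeas T \<omega>)" "\<And>z. z \<in> Tower T \<omega> \<Longrightarrow> \<bar>r z\<bar> \<le> b" for r b
    proof (rule tmeas_integrable[OF mix, of _ "?P * b"])
      show "(\<lambda>z. ?F z * r z) \<in> borel_measurable (tmeas T \<omega>)" by (intro borel_measurable_times Fm r)
      show "\<bar>?F z * r z\<bar> \<le> ?P * b" if "z \<in> Tower T \<omega>" for z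
        unfolding abs_mult using Fb[OF that] r(2)[OF that] P0 by (intro mult_mono) auto
    qed
    have F1: "integrable (tmeas T \<omega>) (\<lambda>z. ?F z * \<psi> \<omega> z)" by (rule Fi[OF \<psi>m c\<psi>(3)[OF \<omega>]])
    have F2: "integrable (tmeas T \<omega>) (\<lambda>z. ?F z * h \<omega> z)" by (rule Fi[OF hm ch(2)[OF \<omega>]])
    have F3: "integrable (tmeas T \<omega>) (\<lambda>z. ?F z * c)" for c by (rule Fi[of _ "\<bar>c\<bar>"]) simp_all
    have I1: "(\<integral>z. ?F z * \<rho> z \<partial>tmeas T \<omega>) = (\<integral>z. ?F z * \<psi> \<omega> z \<partial>tmeas T \<omega>) + (\<integral>z. ?F z * (c0 * K \<omega>) \<partial>tmeas T \<omega>)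
       + c1 * (\<integral>z. ?F z * h \<omega> z \<partial>tmeas T \<omega>)"
    proof -
      have "(\<lambda>z. ?F z * \<rho> z) = (\<lambda>z. ?F z * \<psi> \<omega> z + ?F z * (c0 * K \<omega>) + c1 * (?F z * h \<omega> z))"
        unfolding \<rho>_def by (intro ext) (simp add: algebra_simps)
      then show ?thesis using F1 F2 F3[of "c0 * K \<omega>"] by simp
    qed
    have I2: "(\<integral>z. ?F z * \<rho>' z \<partial>tmeas T \<omega>) = (\<integral>z. ?F z * (c0 * K \<omega>) \<partial>tmeas T \<omega>)
       + (c1 + m) * (\<integral>z. ?F z * h \<omega> z \<partial>tmeas T \<omega>)"
    proof -
      have "(\<lambda>z. ?F z * \<rho>' z) = (\<lambda>z. ?F z * (c0 * K \<omega>) + (c1 + m) * (?F z * h \<omega> z))"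
        unfolding \<rho>'_def by (intro ext) (simp add: algebra_simps)
      then show ?thesis using F2 F3[of "c0 * K \<omega>"] by simp
    qed
    have diff: "(\<integral>z. ?F z * \<psi> \<omega> z \<partial>tmeas T \<omega>) - (\<integral>z. ?F z * h \<omega> z \<partial>tmeas T \<omega>) * m
      = (\<integral>z. ?F z * \<rho> z \<partial>tmeas T \<omega>) - (\<integral>z. ?F z * \<rho>' z \<partial>tmeas T \<omega>)"
      unfolding I1 I2 by (simp add: algebra_simps)
    have "\<bar>(\<integral>z. ?F z * \<psi> \<omega> z \<partial>tmeas T \<omega>) - (\<integral>z. ?F z * h \<omega> z \<partial>tmeas T \<omega>) * m\<bar> \<le> ?E"
      unfolding diff using 1 2 by linarith
    also have "?E \<le> 2 * ?P * (B * S + (1 - \<theta>) ^ q * B)"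
      using P0 \<mu>B' \<theta>r by (intro mult_left_mono add_left_mono) auto
    also have "\<dots> = A * K (shift (int n) \<omega>) * K \<omega> ^ 2 * (S + (1 - \<theta>) ^ q)"
      unfolding A_def B_def by (simp add: algebra_simps)
    finally show "\<bar>correlation T h \<phi> \<psi> n \<omega>\<bar> \<le> A * K (shift (int n) \<omega>) * K \<omega> ^ 2 * (S + (1 - \<theta>) ^ q)"
      unfolding correlation_def nuint m_def .
  qed
qed

text \<open>The fibre that feeds level \<open>l + k\<close> lies within \<open>2 * n + l + k\<close>
  of the origin of the orbit. So \<open>good_scale\<close> puts this level beyond the threshold
  \<open>n1\<close> of that fibre; the logarithm is then absorbed into \<open>\<beta>\<close> and
  the tail summed.\<close>

lemma fibre_tail_bound:
  assumes \<beta>: "0 < \<beta>" "\<beta> \<le> 1 / 8" and a: "1 - a + 2 * \<beta> \<le> 0" and b: "0 \<le> b" "0 \<le> C"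
    and Q: "\<And>k n. max 2 (n1 (shift k \<omega>)) \<le> n \<Longrightarrow>
      measure (refm T) {x \<in> \<Lambda>. n < R (shift k \<omega>) x} \<le> C * ln (real n) powr b / real n powr a"
    and Zb: "\<And>k. real (n1 (shift k \<omega>)) \<le> Z * (1 + \<bar>real_of_int k\<bar>) powr \<beta>"
    and n: "1 \<le> n" and Z: "Z \<le> real n powr \<beta>" "0 \<le> Z"
    and k: "2 \<le> k" "real n powr (1 - 2 * \<beta>) \<le> real k"
    and st: "\<bar>s\<bar> \<le> int n" "0 \<le> t" "t \<le> int n"
  shows "fibre_tail (shift s \<omega>) t k \<le>
    ennreal (C * ((b + 1) / \<beta>) powr b * (\<Sum>l. real (Suc l) powr (- 1 - \<beta>)) * real k powr (1 - a + 2 * \<beta>))"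
proof -
  let ?E = "C * ((b + 1) / \<beta>) powr b"
  have E: "0 \<le> ?E" using b by simp
  have "fibre_tail (shift s \<omega>) t k \<le> (\<Sum>l. ennreal (?E * real (l + k) powr (\<beta> - a)))"
    unfolding fibre_tail_def
  proof (intro suminf_le summableI)
    fix l
    define \<kappa> where "\<kappa> = t - int (l + k) + s"
    let ?A = "{x \<in> \<Lambda>. l + k < R (shift \<kappa> \<omega>) x}"
    have \<kappa>: "shift (t - int (l + k)) (shift s \<omega>) = shift \<kappa> \<omega>" unfolding \<kappa>_def by (rule shift_shift)
    have "n1 (shift \<kappa> \<omega>) \<le> l + k"
    proof (rule good_scale[OF \<beta> n Z _ _ _ Zb])
      show "2 \<le> l + k" using k by simp
      show "real n powr (1 - 2 * \<beta>) \<le> real (l + k)" using k by simp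
      show "\<bar>\<kappa>\<bar> \<le> 2 * int n + int (l + k)" unfolding \<kappa>_def using st by linarith
    qed
    then have "measure (refm T) ?A \<le> C * ln (real (l + k)) powr b / real (l + k) powr a"
      using k by (intro Q) simp
    also have "\<dots> \<le> C * (((b + 1) / \<beta>) powr b * real (l + k) powr \<beta>) / real (l + k) powr a"
      using k b \<beta> by (intro divide_right_mono mult_left_mono ln_powr_le_powr) auto
    also have "\<dots> = ?E * real (l + k) powr (\<beta> - a)" by (simp add: powr_diff)
    finally have "measure (refm T) ?A \<le> ?E * real (l + k) powr (\<beta> - a)" .
    moreover have "emeasure (refm T) ?A \<noteq> \<top>"
    proof -
      have "emeasure (refm T) ?A \<le> emeasure (refm T) \<Lambda>" by (intro emeasure_mono) auto
      then show ?thesis unfolding \<Lambda>_mass by (auto simp: top_unique)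
    qed
    ultimately show "emeasure (refm T) {x \<in> \<Lambda>. l + k < R (shift (t - int (l + k)) (shift s \<omega>)) x} \<le> ennreal (?E * real (l + k) powr (\<beta> - a))"
      unfolding \<kappa> by (simp add: emeasure_eq_ennreal_measure ennreal_leI)
  qed
  also have "\<dots> \<le> ennreal (?E * (\<Sum>l. real (Suc l) powr (- 1 - \<beta>)) * real k powr (1 - a + 2 * \<beta>))"
    by (rule power_tail_le[OF \<beta>(1) a _ E]) (use k in simp)
  finally show ?thesis .
qed

text \<open>Both ends \<open>s\<close> and \<open>s + n\<close> of the orbit segment stay within
  distance \<open>n\<close> of \<omega>, so \<open>Z\<close> at \<omega> controls \<open>K\<close>
  there. Taking \<open>s\<close> to be 0 or \<open>- n\<close> gives the future and the
  past.\<close>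

lemma correlation_decay:
  assumes \<phi>: "\<phi> \<in> FK T \<gamma> K" and \<psi>: "\<psi> \<in> FK T \<gamma> K" and h: "h \<in> FK T \<gamma> K" "h \<in> Fplus T \<gamma>"
    and hp: "\<And>\<omega>. \<omega> \<in> fibres T \<Longrightarrow> h \<omega> \<in> borel_measurable (tmeas T \<omega>) \<and> prob_space (nu T h \<omega>)"
    and K: "0 < \<kappa>" "\<And>\<omega>. \<kappa> \<le> K \<omega>"
    and n0: "\<And>n. n0 \<le> n \<Longrightarrow> \<exists>xs. set xs \<subseteq> I \<and> sum_list xs = n" and i0: "i0 \<in> I"
    and p: "0 < \<epsilon>" "0 \<le> Mt"
    and \<beta>: "0 < \<beta>" "\<beta> \<le> 1 / 8" "\<beta> * (6 + 2 * a) \<le> \<delta>" and a: "1 < a" "1 - a + 2 * \<beta> \<le> 0" "0 < \<delta>"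
    and b: "0 \<le> b" "0 \<le> C"
    and mix: "\<And>\<omega> s. \<omega> \<in> \<Omega>0 \<Longrightarrow> mixing_fibre Mt I \<epsilon> (shift s \<omega>)"
    and eqv: "\<And>\<omega> s. \<omega> \<in> \<Omega>0 \<Longrightarrow> distr (nu T h (shift s \<omega>)) (tmeas T (shift (1 + s) \<omega>)) (tmap T (shift s \<omega>)) = nu T h (shift (1 + s) \<omega>)"
    and Q: "\<And>\<omega> k n. \<omega> \<in> \<Omega>0 \<Longrightarrow> max 2 (n1 (shift k \<omega>)) \<le> n \<Longrightarrow>
      measure (refm T) {x \<in> \<Lambda>. n < R (shift k \<omega>) x} \<le> C * ln (real n) powr b / real n powr a"
    and Zn: "\<And>\<omega> k. \<omega> \<in> \<Omega>0 \<Longrightarrow> real (n1 (shift k \<omega>)) \<le> Z \<omega> * (1 + \<bar>real_of_int k\<bar>) powr \<beta>"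
    and ZK: "\<And>\<omega> k. \<omega> \<in> \<Omega>0 \<Longrightarrow> K (shift k \<omega>) \<le> Z \<omega> * (1 + \<bar>real_of_int k\<bar>) powr \<beta>"
    and Z1: "\<And>\<omega>. 1 \<le> Z \<omega>"
  shows "\<exists>c>0. \<forall>\<omega>\<in>\<Omega>0. \<forall>n\<ge>1. \<forall>s. \<bar>s\<bar> \<le> int n \<longrightarrow> \<bar>s + int n\<bar> \<le> int n \<longrightarrow>
     \<bar>correlation T h \<phi> \<psi> n (shift s \<omega>)\<bar>
      \<le> Z \<omega> powr (6 + (a - 1) / \<beta>) * c * real n powr (1 + \<delta> - a)"
proof (cases "\<Omega>0 = {}")
  case True
  then show ?thesis by (intro exI[of _ 1]) simp
next
  case False
  \<comment> \<open>Some point is needed to know that \<theta> lies between 0 and 1; the block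
    schedule is chosen before \<omega> is fixed.\<close>
  then obtain \<omega>0 where \<omega>0: "\<omega>0 \<in> \<Omega>0" by blast
  have "\<exists>A\<ge>0. \<exists>\<theta>. \<forall>\<omega>. mixing_fibre Mt I \<epsilon> \<omega> \<longrightarrow>
    (\<forall>i. distr (nu T h (shift (int i) \<omega>)) (tmeas T (shift (1 + int i) \<omega>)) (tmap T (shift (int i) \<omega>)) = nu T h (shift (1 + int i) \<omega>)) \<longrightarrow>
    0 < \<theta> \<and> \<theta> \<le> 1 \<and>
    (\<forall>n q k S. 0 \<le> S \<longrightarrow> q * (k + n0) \<le> n \<longrightarrow> i0 \<le> k \<longrightarrow>
      (\<forall>j<q. fibre_tail \<omega> (int (j * (k + n0) + k)) k \<le> ennreal S) \<longrightarrow>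
      \<bar>correlation T h \<phi> \<psi> n \<omega>\<bar> \<le> A * K (shift (int n) \<omega>) * K \<omega> ^ 2 * (S + (1 - \<theta>) ^ q))"
    by (rule correlation_bound[OF \<phi> \<psi> h hp K n0 i0 p])
  then obtain A \<theta> where A: "0 \<le> A" and bound: "\<forall>\<omega>. mixing_fibre Mt I \<epsilon> \<omega> \<longrightarrow>
    (\<forall>i. distr (nu T h (shift (int i) \<omega>)) (tmeas T (shift (1 + int i) \<omega>)) (tmap T (shift (int i) \<omega>)) = nu T h (shift (1 + int i) \<omega>)) \<longrightarrow>
    0 < \<theta> \<and> \<theta> \<le> 1 \<and>
    (\<forall>n q k S. 0 \<le> S \<longrightarrow> q * (k + n0) \<le> n \<longrightarrow> i0 \<le> k \<longrightarrow>
      (\<forall>j<q. fibre_tail \<omega> (int (j * (k + n0) + k)) k \<le> ennreal S) \<longrightarrow>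
      \<bar>correlation T h \<phi> \<psi> n \<omega>\<bar> \<le> A * K (shift (int n) \<omega>) * K \<omega> ^ 2 * (S + (1 - \<theta>) ^ q))"
    by (elim exE conjE)
  have bnd: "0 < \<theta> \<and> \<theta> \<le> 1 \<and>
    (\<forall>n q k S. 0 \<le> S \<longrightarrow> q * (k + n0) \<le> n \<longrightarrow> i0 \<le> k \<longrightarrow>
      (\<forall>j<q. fibre_tail (shift s \<omega>) (int (j * (k + n0) + k)) k \<le> ennreal S) \<longrightarrow>
      \<bar>correlation T h \<phi> \<psi> n (shift s \<omega>)\<bar> \<le> A * K (shift (int n) (shift s \<omega>)) * K (shift s \<omega>) ^ 2 * (S + (1 - \<theta>) ^ q))"
    if \<omega>: "\<omega> \<in> \<Omega>0" for \<omega> s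
  proof -
    have "\<forall>i. distr (nu T h (shift (int i) (shift s \<omega>))) (tmeas T (shift (1 + int i) (shift s \<omega>))) (tmap T (shift (int i) (shift s \<omega>))) = nu T h (shift (1 + int i) (shift s \<omega>))"
    proof
      fix i
      show "distr (nu T h (shift (int i) (shift s \<omega>))) (tmeas T (shift (1 + int i) (shift s \<omega>))) (tmap T (shift (int i) (shift s \<omega>))) = nu T h (shift (1 + int i) (shift s \<omega>))"
        using eqv[OF \<omega>, of "int i + s"] unfolding shift_shift by (simp only: add.assoc)
    qed
    with bound[rule_format, OF mix[OF \<omega>]] show ?thesis by blast
  qed
  have \<theta>: "0 < \<theta>" "\<theta> \<le> 1" using bnd[OF \<omega>0, of 0] by simp_all
  obtain N where N: "1 \<le> N" "\<And>n. N \<le> n \<Longrightarrow> \<exists>q k. q * (k + n0) \<le> n \<and> i0 \<le> k \<and> 2 \<le> k \<and>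
      real n powr (1 - 2 * \<beta>) \<le> real k \<and> (1 - \<theta>) ^ q \<le> real n powr (- a)"
    using block_schedule[OF \<beta>(1,2) \<theta>, of n0 i0 a] by blast
  define S0 where "S0 = C * ((b + 1) / \<beta>) powr b * (\<Sum>l. real (Suc l) powr (- 1 - \<beta>))"
  have s: "summable (\<lambda>l. real (Suc l) powr (- 1 - \<beta>))"
    using summable_real_powr_iff[of "- 1 - \<beta>"] \<beta> by (subst summable_Suc_iff) simp
  have S0: "0 \<le> S0" unfolding S0_def using b by (intro mult_nonneg_nonneg suminf_nonneg[OF s]) auto
  define c where "c = A * (8 + (1 + real N) powr (3 * \<beta>) * real N powr (a - 1)) + 8 * A * (S0 + 1) + 1"
  have c0: "0 \<le> A * (8 + (1 + real N) powr (3 * \<beta>) * real N powr (a - 1))" "0 \<le> 8 * A * (S0 + 1)"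
    using A S0 by (auto intro!: mult_nonneg_nonneg add_nonneg_nonneg)
  have cpos: "0 < c" unfolding c_def using c0 by linarith
  show ?thesis
  proof (rule exI[of _ c], intro conjI ballI allI impI cpos)
    fix \<omega> n s assume \<omega>: "\<omega> \<in> \<Omega>0" and n: "1 \<le> n" and s: "\<bar>s\<bar> \<le> int n" "\<bar>s + int n\<bar> \<le> int n"
    define Ke where "Ke = K (shift (int n) (shift s \<omega>))"
    define Ks where "Ks = K (shift s \<omega>)"
    have Kpos: "0 \<le> Ke" "0 \<le> Ks" unfolding Ke_def Ks_def using K(1) K(2)[of "shift (int n) (shift s \<omega>)"] K(2)[of "shift s \<omega>"] by linarith+
    have Kb: "K (shift j \<omega>) \<le> Z \<omega> * (1 + real n) powr \<beta>" if "\<bar>j\<bar> \<le> int n" for j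
    proof -
      have "(1 + \<bar>real_of_int j\<bar>) powr \<beta> \<le> (1 + real n) powr \<beta>"
        using that \<beta>(1) by (intro powr_mono2) linarith+
      then have "Z \<omega> * (1 + \<bar>real_of_int j\<bar>) powr \<beta> \<le> Z \<omega> * (1 + real n) powr \<beta>"
        using Z1[of \<omega>] by (intro mult_left_mono) auto
      then show ?thesis using ZK[OF \<omega>, of j] by linarith
    qed
    have Ksb: "Ks \<le> Z \<omega> * (1 + real n) powr \<beta>" unfolding Ks_def by (rule Kb[OF s(1)])
    have Keb: "Ke \<le> Z \<omega> * (1 + real n) powr \<beta>" unfolding Ke_def shift_shift by (rule Kb) (use s(2) in \<open>simp add: add.commute\<close>)
    have zr: "1 \<le> Z \<omega> powr (6 + (a - 1) / \<beta>)" using Z1[of \<omega>] a(1) \<beta>(1) by (intro ge_one_powr_ge_zero) auto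
    have bnd': "\<bar>correlation T h \<phi> \<psi> n (shift s \<omega>)\<bar> \<le> A * Ke * Ks ^ 2 * (S + (1 - \<theta>) ^ q)"
      if "0 \<le> S" "q * (k + n0) \<le> n" "i0 \<le> k"
        "\<And>j. j < q \<Longrightarrow> fibre_tail (shift s \<omega>) (int (j * (k + n0) + k)) k \<le> ennreal S" for q k S
      unfolding Ke_def Ks_def
      by (rule bnd[OF \<omega>, of s, THEN conjunct2, THEN conjunct2, rule_format, OF that]) assumption
    show "\<bar>correlation T h \<phi> \<psi> n (shift s \<omega>)\<bar> \<le> Z \<omega> powr (6 + (a - 1) / \<beta>) * c * real n powr (1 + \<delta> - a)"
    proof (cases "real n powr \<beta> < Z \<omega> \<or> n \<le> N")
      case True
      \<comment> \<open>Zero blocks: no tail condition has to be checked, and there is no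
        decay.\<close>
      have "\<bar>correlation T h \<phi> \<psi> n (shift s \<omega>)\<bar> \<le> A * Ke * Ks ^ 2 * (0 + (1 - \<theta>) ^ 0)"
        by (rule bnd'[where k=i0]) simp_all
      also have "\<dots> = A * Ke * Ks ^ 2" by simp
      also have "\<dots> \<le> Z \<omega> powr (6 + (a - 1) / \<beta>) * (A * (8 + (1 + real N) powr (3 * \<beta>) * real N powr (a - 1))) * real n powr (1 + \<delta> - a)"
        by (rule trivial_regime[OF \<beta>(1) _ a(1,3) A Kpos(1) Keb Kpos(2) Ksb n Z1 True N(1)]) (use \<beta> in simp)
      also have "\<dots> \<le> Z \<omega> powr (6 + (a - 1) / \<beta>) * c * real n powr (1 + \<delta> - a)"
        unfolding c_def using c0 by (intro mult_right_mono mult_left_mono) auto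
      finally show ?thesis .
    next
      case False
      then have reg: "Z \<omega> \<le> real n powr \<beta>" "N \<le> n" by auto
      from N(2)[OF reg(2)] obtain q k where qk: "q * (k + n0) \<le> n" "i0 \<le> k" "2 \<le> k"
        "real n powr (1 - 2 * \<beta>) \<le> real k" "(1 - \<theta>) ^ q \<le> real n powr (- a)" by blast
      have Z0: "0 \<le> Z \<omega>" using Z1[of \<omega>] by linarith
      have "\<bar>correlation T h \<phi> \<psi> n (shift s \<omega>)\<bar> \<le> A * Ke * Ks ^ 2 * (S0 * real k powr (1 - a + 2 * \<beta>) + (1 - \<theta>) ^ q)"
      proof (rule bnd'[OF _ qk(1,2)])
        show "0 \<le> S0 * real k powr (1 - a + 2 * \<beta>)" using S0 by simp
        fix j assume j: "j < q"
        \<comment> \<open>The window of block \<open>j\<close> ends before time \<open>n\<close>, so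
          the tail is taken at a time that \<open>fibre_tail_bound\<close> covers.\<close>
        have "(j + 1) * (k + n0) \<le> q * (k + n0)" using j by (intro mult_right_mono) auto
        then have "j * (k + n0) + k \<le> n" using qk(1) by simp
        then have t: "int (j * (k + n0) + k) \<le> int n" by (simp only: of_nat_le_iff)
        show "fibre_tail (shift s \<omega>) (int (j * (k + n0) + k)) k \<le> ennreal (S0 * real k powr (1 - a + 2 * \<beta>))"
          unfolding S0_def
          by (rule fibre_tail_bound[OF \<beta>(1,2) a(2) b Q[OF \<omega>] Zn[OF \<omega>] n reg(1) Z0 qk(3,4) s(1) _ t]) simp_all
      qed
      also have "\<dots> \<le> 8 * A * (S0 + 1) * real n powr (1 + \<delta> - a)"
        by (rule main_regime[OF \<beta> a(1,2) A S0 Kpos(1) Keb Kpos(2) Ksb n Z1 reg(1) qk(4) _ qk(5)]) (use \<theta> in simp)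
      also have "\<dots> \<le> c * real n powr (1 + \<delta> - a)"
        unfolding c_def using c0 by (intro mult_right_mono) auto
      also have "\<dots> \<le> (Z \<omega> powr (6 + (a - 1) / \<beta>) * c) * real n powr (1 + \<delta> - a)"
        using mult_right_mono[OF zr, of c] cpos by (intro mult_right_mono) auto
      finally show ?thesis .
    qed
  qed
qed

end

section \<open>Quenched decay of correlations\<close>

lemma space_\<Omega>P: "random_tower_setting T \<Longrightarrow> space (\<Omega>P T) = UNIV"
proof -
  assume "random_tower_setting T"
  then have "sets (noise T) = sets borel" by (simp add: random_tower_setting_def)
  then have "space (noise T) = UNIV" using sets_eq_imp_space_eq by fastforce
  then show ?thesis by (simp add: \<Omega>P_def space_PiM)
qed

lemma prob_space_\<Omega>P: "random_tower_setting T \<Longrightarrow> prob_space (\<Omega>P T)"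
  unfolding \<Omega>P_def by (rule prob_space_PiM) (simp add: random_tower_setting_def)

lemma shift_eq_restrict: "shift k = (\<lambda>\<omega>. \<lambda>n\<in>UNIV. \<omega> (n + k))"
  by (intro ext) (simp add: shift_def)

lemma shift_measurable: "shift k \<in> measurable (\<Omega>P T) (\<Omega>P T)"
  unfolding \<Omega>P_def shift_eq_restrict by (rule measurable_restrict) simp

lemma distr_shift: "random_tower_setting T \<Longrightarrow> distr (\<Omega>P T) (\<Omega>P T) (shift k) = \<Omega>P T"
  unfolding \<Omega>P_def shift_eq_restrict
  using distr_PiM_reindex[of UNIV "\<lambda>_. noise T" "\<lambda>n. n + k" UNIV]
  by (simp add: random_tower_setting_def inj_on_def)

text \<open>The shift preserves the measure, and there are only countably many shifts.\<close>

lemma AE_all_shifts: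
  assumes "random_tower_setting T" "AE \<omega> in \<Omega>P T. P \<omega>"
  shows "AE \<omega> in \<Omega>P T. \<forall>k. P (shift k \<omega>)"
  unfolding AE_all_countable
proof
  fix k
  have "AE \<omega> in distr (\<Omega>P T) (\<Omega>P T) (shift k). P \<omega>" using assms(2) unfolding distr_shift[OF assms(1)] .
  then show "AE \<omega> in \<Omega>P T. P (shift k \<omega>)" by (rule AE_distrD[OF shift_measurable])
qed

theorem theorem4p2:
  fixes T :: "('u::topological_space, 'x) random_tower"
    and \<gamma> a u v \<delta> :: real
    and K :: "(int \<Rightarrow> 'u) \<Rightarrow> real"
    and h :: "('u, 'x) family"
  assumes "random_tower_setting T"
    and "full_branches T"
    and "bounded_distortion T \<gamma>"
    and "generating T"
    and "quenched_tail T a u v"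
    and "aperiodic T"
    and "bounded_towers T"
    and "annealed_tail T a"
    and "tail_variable T u v K"
    and "exact_equivariant_density T \<gamma> K h"
    and "0 < \<delta>"
  shows "\<exists>\<Omega>0 C.
    \<Omega>0 \<in> sets (\<Omega>P T) \<and> \<Omega>0 \<subseteq> fibres T \<and> measure (\<Omega>P T) \<Omega>0 = 1 \<and>
    C \<in> borel_measurable (restrict_space (\<Omega>P T) \<Omega>0) \<and> (\<forall>\<omega>\<in>\<Omega>0. 0 < C \<omega>) \<and>
    (\<forall>\<phi>\<in>FK T \<gamma> K. \<forall>\<psi>\<in>FK T \<gamma> K. \<exists>C\<phi>\<psi>>0. \<forall>\<omega>\<in>\<Omega>0. \<forall>n\<ge>1.
       \<bar>(\<integral>z. \<phi> (shift (int n) \<omega>) (titer T n \<omega> z) * \<psi> \<omega> z \<partial>tmeas T \<omega>)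
          - (\<integral>z. \<phi> (shift (int n) \<omega>) z \<partial>nu T h (shift (int n) \<omega>)) * (\<integral>z. \<psi> \<omega> z \<partial>tmeas T \<omega>)\<bar>
         \<le> C \<omega> * C\<phi>\<psi> * real n powr (1 + \<delta> - a) \<and>
       \<bar>(\<integral>z. \<phi> \<omega> (titer T n (shift (- int n) \<omega>) z) * \<psi> (shift (- int n) \<omega>) z
             \<partial>tmeas T (shift (- int n) \<omega>))
          - (\<integral>z. \<phi> \<omega> z \<partial>nu T h \<omega>)
            * (\<integral>z. \<psi> (shift (- int n) \<omega>) z \<partial>tmeas T (shift (- int n) \<omega>))\<bar>
         \<le> C \<omega> * C\<phi>\<psi> * real n powr (1 + \<delta> - a)) \<and>
    (\<exists>C'>0. \<exists>u'>0. \<exists>v'. 0 < v' \<and> v' < 1 \<and>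
       (\<forall>n::nat. 1 \<le> n \<longrightarrow>
          measure (\<Omega>P T) {\<omega> \<in> \<Omega>0. real n < C \<omega>} \<le> C' * exp (- u' * real n powr v')))"
proof -
  note setting = assms(1)
  interpret tower T \<gamma> by unfold_locales (rule assms)+
  obtain D J where "tower_jac T \<gamma> D J" using tower_jac_exists by blast
  then interpret tower_jac T \<gamma> D J .
  interpret P: prob_space "\<Omega>P T" by (rule prob_space_\<Omega>P[OF setting])
  note space\<Omega> = space_\<Omega>P[OF setting]

  obtain C b \<Omega>1 n1 where a: "1 < a" and u: "0 < u" "0 < v" and C: "0 < C" and b: "0 \<le> b"
    and \<Omega>1: "\<Omega>1 \<in> sets (\<Omega>P T)" "\<Omega>1 \<subseteq> fibres T" "measure (\<Omega>P T) \<Omega>1 = 1"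
    and n1m: "n1 \<in> measurable (restrict_space (\<Omega>P T) \<Omega>1) (count_space (UNIV :: nat set))"
    and n1q: "\<forall>\<omega>\<in>\<Omega>1. \<forall>n\<ge>max 2 (n1 \<omega>).
           measure (refm T) {x \<in> base T. n < rtime T \<omega> x} \<le> C * ln (real n) powr b / real n powr a"
    and n1t: "\<forall>n\<ge>1. measure (\<Omega>P T) {\<omega> \<in> \<Omega>1. n < n1 \<omega>} \<le> C * exp (- u * real n powr v)"
    using assms(5) unfolding quenched_tail_def by (elim conjE exE)

  obtain N :: nat and t :: "nat \<Rightarrow> nat" and \<epsilon>s :: "nat \<Rightarrow> real" where gcd: "Gcd (t ` {1..N}) = 1"
    and \<epsilon>s: "\<forall>i\<in>{1..N}. 0 < \<epsilon>s i"
    and per: "AE \<omega> in \<Omega>P T. \<forall>i\<in>{1..N}. \<epsilon>s i < measure (refm T) {x \<in> base T. rtime T \<omega> x = t i}"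
    using assms(6) unfolding aperiodic_def by (elim conjE exE)
  define I where "I = t ` {1..N}"
  have N1: "{1..N} \<noteq> {}"
  proof
    assume "{1..N} = {}"
    then show False using gcd by (simp only: image_empty Gcd_empty)
  qed
  then obtain i0 where i0: "i0 \<in> I" unfolding I_def by blast
  define \<epsilon> where "\<epsilon> = Min (\<epsilon>s ` {1..N})"
  have \<epsilon>: "0 < \<epsilon>" unfolding \<epsilon>_def using \<epsilon>s N1 by (subst Min_gr_iff) auto
  have \<epsilon>_le: "\<epsilon> \<le> \<epsilon>s i" if "i \<in> {1..N}" for i unfolding \<epsilon>_def using that by (intro Min_le) auto
  obtain n0 where n0: "\<And>n. n0 \<le> n \<Longrightarrow> \<exists>xs. set xs \<subseteq> I \<and> sum_list xs = n"
  proof -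
    define S where "S = {m. \<exists>xs. set xs \<subseteq> I \<and> sum_list xs = m}"
    have "\<exists>n0. \<forall>n\<ge>n0. n \<in> S \<or> n = 0"
    proof (rule numerical_semigroup_cofinite)
      fix x y assume "x \<in> S" "y \<in> S"
      then obtain xs ys where "set xs \<subseteq> I" "sum_list xs = x" "set ys \<subseteq> I" "sum_list ys = y"
        unfolding S_def by blast
      then show "x + y \<in> S" unfolding S_def by (intro CollectI exI[of _ "xs @ ys"]) simp
    next
      have "I \<subseteq> S"
      proof
        fix i assume "i \<in> I"
        then show "i \<in> S" unfolding S_def by (intro CollectI exI[of _ "[i]"]) simp
      qed
      then have "Gcd S dvd Gcd I" by (intro Gcd_greatest Gcd_dvd) blast
      then show "Gcd S = 1" using gcd unfolding I_def by simp
    qed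
    \<comment> \<open>The empty list settles the exceptional case 0 of the semigroup lemma.\<close>
    moreover have "0 \<in> S" unfolding S_def by (intro CollectI exI[of _ "[]"]) simp
    ultimately obtain n0 where "\<forall>n\<ge>n0. n \<in> S" by metis
    then show thesis using that unfolding S_def by blast
  qed

  obtain Mt where Mt: "0 < Mt" "\<forall>\<omega>\<in>fibres T. emeasure (tmeas T \<omega>) (Tower T \<omega>) \<le> ennreal Mt"
    using assms(7) unfolding bounded_towers_def by (elim conjE exE)

  have Km: "K \<in> borel_measurable (\<Omega>P T)" and K0: "\<And>\<omega>. 0 \<le> K \<omega>" and Kinf: "0 < (INF \<omega>. K \<omega>)"
    and Kt: "\<And>n::nat. 1 \<le> n \<Longrightarrow> measure (\<Omega>P T) {\<omega> \<in> space (\<Omega>P T). real n < K \<omega>} \<le> exp (- u * real n powr v)"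
    using assms(9) unfolding tail_variable_def space\<Omega> by auto
  define \<kappa> where "\<kappa> = (INF \<omega>. K \<omega>)"
  have \<kappa>: "0 < \<kappa>" "\<And>\<omega>. \<kappa> \<le> K \<omega>"
    unfolding \<kappa>_def using Kinf K0 by (auto intro!: cINF_lower bdd_belowI[of _ 0])

  have h: "h \<in> FK T \<gamma> K" "h \<in> Fplus T \<gamma>"
    and hp: "\<And>\<omega>. \<omega> \<in> fibres T \<Longrightarrow> h \<omega> \<in> borel_measurable (tmeas T \<omega>) \<and> prob_space (nu T h \<omega>)"
    and eqv: "AE \<omega> in \<Omega>P T. distr (nu T h \<omega>) (tmeas T (shift 1 \<omega>)) (tmap T \<omega>) = nu T h (shift 1 \<omega>)"
    using assms(10) unfolding exact_equivariant_density_def equivariant_def by auto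

  \<comment> \<open>The three bounds serve \<open>good_scale\<close>, the exponent count of
    \<open>main_regime\<close>, and the sign of \<open>1 - a + 2 * \<beta>\<close>.\<close>
  define \<beta> where "\<beta> = min (1 / 8) (min (\<delta> / (6 + 2 * a)) ((a - 1) / 2))"
  have \<beta>: "0 < \<beta>" "\<beta> \<le> 1 / 8" "\<beta> \<le> \<delta> / (6 + 2 * a)" "\<beta> \<le> (a - 1) / 2"
  proof -
    show "0 < \<beta>" unfolding \<beta>_def using a assms(11) by simp
    show "\<beta> \<le> 1 / 8" "\<beta> \<le> \<delta> / (6 + 2 * a)" "\<beta> \<le> (a - 1) / 2"
      unfolding \<beta>_def by (simp_all only: min.cobounded1 min.coboundedI2 min.cobounded2)
  qed
  have \<beta>3: "\<beta> * (6 + 2 * a) \<le> \<delta>" using \<beta>(3) a by (simp add: le_divide_eq)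
  have a2: "1 - a + 2 * \<beta> \<le> 0" using \<beta>(4) by simp

  \<comment> \<open>The value 0 off \<open>\<Omega>1\<close> makes the function measurable
    everywhere and leaves its tail unchanged.\<close>
  define n1' where "n1' \<omega> = (if \<omega> \<in> \<Omega>1 then n1 \<omega> else 0)" for \<omega>
  define W where "W \<omega> = max (K \<omega>) (real (n1' \<omega>))" for \<omega>
  have n1'm: "n1' \<in> measurable (\<Omega>P T) (count_space UNIV)"
    unfolding n1'_def[abs_def] using n1m \<Omega>1(1)
    by (subst (asm) measurable_restrict_space_iff[of \<Omega>1 "\<Omega>P T" 0]) auto
  have Wm: "W \<in> borel_measurable (\<Omega>P T)" unfolding W_def[abs_def] using Km n1'm by measurable
  have W0: "0 \<le> W \<omega>" for \<omega> unfolding W_def using K0[of \<omega>] by simp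
  have Wt: "measure (\<Omega>P T) {\<omega> \<in> space (\<Omega>P T). real n < W \<omega>} \<le> (1 + C) * exp (- u * real n powr v)"
    if n: "1 \<le> n" for n :: nat
  proof -
    have s1: "{\<omega> \<in> space (\<Omega>P T). real n < K \<omega>} \<in> sets (\<Omega>P T)" using Km by measurable
    have s2: "{\<omega> \<in> space (\<Omega>P T). n < n1' \<omega>} \<in> sets (\<Omega>P T)" using n1'm by measurable
    have e: "{\<omega> \<in> space (\<Omega>P T). n < n1' \<omega>} = {\<omega> \<in> \<Omega>1. n < n1 \<omega>}"
      unfolding n1'_def using sets.sets_into_space[OF \<Omega>1(1)] by auto
    have "{\<omega> \<in> space (\<Omega>P T). real n < W \<omega>} = {\<omega> \<in> space (\<Omega>P T). real n < K \<omega>} \<union> {\<omega> \<in> space (\<Omega>P T). n < n1' \<omega>}"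
      unfolding W_def by auto
    then have "measure (\<Omega>P T) {\<omega> \<in> space (\<Omega>P T). real n < W \<omega>} \<le>
      measure (\<Omega>P T) {\<omega> \<in> space (\<Omega>P T). real n < K \<omega>} + measure (\<Omega>P T) {\<omega> \<in> space (\<Omega>P T). n < n1' \<omega>}"
      using measure_Un_le[OF s1 s2] by simp
    also have "\<dots> \<le> exp (- u * real n powr v) + C * exp (- u * real n powr v)"
      unfolding e by (intro add_mono Kt[OF n] n1t[rule_format, OF n])
    finally show ?thesis by (simp add: algebra_simps)
  qed
  obtain Z \<Omega>' where \<Omega>': "\<Omega>' \<in> sets (\<Omega>P T)" "measure (\<Omega>P T) \<Omega>' = 1"
    and Zm: "Z \<in> borel_measurable (\<Omega>P T)" and Z1: "\<And>\<omega>. 1 \<le> Z \<omega>"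
    and ZW: "\<And>\<omega> k. \<omega> \<in> \<Omega>' \<Longrightarrow> W (shift k \<omega>) \<le> Z \<omega> * (1 + \<bar>real_of_int k\<bar>) powr \<beta>"
    and Zt: "\<exists>C'>0. \<exists>u'>0. \<forall>t\<ge>1. measure (\<Omega>P T) {\<omega> \<in> \<Omega>'. t < Z \<omega>} \<le> C' * exp (- u' * t powr v)"
  proof -
    have C1: "0 \<le> 1 + C" using C by simp
    show thesis
      using P.stretched_exp_orbit_sup[where sh=shift, OF shift_measurable distr_shift[OF setting] Wm W0 u C1 \<beta>(1) Wt] that
      by blast
  qed

  define good where "good \<omega> \<longleftrightarrow> \<omega> \<in> \<Omega>1 \<and>
     (\<forall>i\<in>{1..N}. \<epsilon>s i < measure (refm T) {x \<in> base T. rtime T \<omega> x = t i}) \<and>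
     distr (nu T h \<omega>) (tmeas T (shift 1 \<omega>)) (tmap T \<omega>) = nu T h (shift 1 \<omega>)" for \<omega>
  have "AE \<omega> in \<Omega>P T. \<omega> \<in> \<Omega>1" using \<Omega>1 P.AE_in_set_eq_1 by simp
  then have "AE \<omega> in \<Omega>P T. good \<omega>"
    using per eqv by eventually_elim (simp add: good_def)
  then have "AE \<omega> in \<Omega>P T. (\<forall>k. good (shift k \<omega>)) \<and> \<omega> \<in> \<Omega>'"
    using AE_all_shifts[OF setting] \<Omega>' P.AE_in_set_eq_1 by simp
  then obtain N0 where N0: "{\<omega> \<in> space (\<Omega>P T). \<not> ((\<forall>k. good (shift k \<omega>)) \<and> \<omega> \<in> \<Omega>')} \<subseteq> N0"
      "emeasure (\<Omega>P T) N0 = 0" "N0 \<in> sets (\<Omega>P T)"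
    by (rule AE_E)
  \<comment> \<open>Removing a measurable null set gives a measurable set, without examining the
    measurability of the conditions in \<open>good\<close>.\<close>
  define \<Omega>0 where "\<Omega>0 = space (\<Omega>P T) - N0"
  have \<Omega>0s: "\<Omega>0 \<in> sets (\<Omega>P T)" unfolding \<Omega>0_def using N0(3) by (rule sets.compl_sets)
  have \<Omega>0p: "measure (\<Omega>P T) \<Omega>0 = 1"
    unfolding \<Omega>0_def using P.prob_compl[OF N0(3)] N0(2) by (simp add: measure_def)
  have \<Omega>0g: "good (shift k \<omega>)" "\<omega> \<in> \<Omega>'" if "\<omega> \<in> \<Omega>0" for \<omega> k
    using that N0(1) unfolding \<Omega>0_def by auto
  have \<Omega>0f: "\<Omega>0 \<subseteq> fibres T"
    using \<Omega>0g(1)[of _ 0] \<Omega>1(2) unfolding good_def by auto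
  have mix: "mixing_fibre Mt I \<epsilon> (shift s \<omega>)" if \<omega>: "\<omega> \<in> \<Omega>0" for \<omega> s
    unfolding mixing_fibre_def
  proof (intro conjI ballI allI)
    have f: "\<omega> \<in> fibres T" using \<omega> \<Omega>0f by blast
    then show "shift s \<omega> \<in> fibres T" by simp
    show "(\<Sum>l. emeasure (refm T) {x \<in> \<Lambda>. l < R (shift (k - int l) (shift s \<omega>)) x}) \<le> ennreal Mt" for k
    proof -
      have fk: "shift (k + s) \<omega> \<in> fibres T" using f by simp
      have e: "0 - int l + (k + s) = k - int l + s" for l by simp
      have "emeasure (tmeas T (shift (k + s) \<omega>)) (space (tmeas T (shift (k + s) \<omega>))) \<le> ennreal Mt"
        using Mt(2) fk unfolding space_tmeas[OF fk] by blast
      then show ?thesis unfolding emeasure_tower_eq[OF fk] shift_shift e .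
    qed
    fix i k assume "i \<in> I"
    then obtain j where j: "j \<in> {1..N}" "i = t j" unfolding I_def by blast
    have "\<epsilon>s j < measure (refm T) {x \<in> \<Lambda>. R (shift (k + s) \<omega>) x = t j}"
      using \<Omega>0g(1)[OF \<omega>, of "k + s"] j(1) unfolding good_def by blast
    then have "\<epsilon> \<le> measure (refm T) {x \<in> \<Lambda>. R (shift k (shift s \<omega>)) x = i}"
      using \<epsilon>_le[OF j(1)] unfolding j(2) shift_shift by linarith
    \<comment> \<open>Holds for infinite \<open>y\<close> too, so finiteness of the measure need not
      be shown.\<close>
    moreover have "ennreal (enn2real y) \<le> y" for y :: ennreal by (cases y) auto
    ultimately show "ennreal \<epsilon> \<le> emeasure (refm T) {x \<in> \<Lambda>. R (shift k (shift s \<omega>)) x = i}"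
      unfolding measure_def by (blast intro: order_trans ennreal_leI)
  qed
  have eqv0: "distr (nu T h (shift s \<omega>)) (tmeas T (shift (1 + s) \<omega>)) (tmap T (shift s \<omega>)) = nu T h (shift (1 + s) \<omega>)"
    if "\<omega> \<in> \<Omega>0" for \<omega> s
    using \<Omega>0g(1)[OF that, of s] unfolding good_def by simp
  have Q0: "measure (refm T) {x \<in> \<Lambda>. n < R (shift k \<omega>) x} \<le> C * ln (real n) powr b / real n powr a"
    if "\<omega> \<in> \<Omega>0" "max 2 (n1' (shift k \<omega>)) \<le> n" for \<omega> k n
    using \<Omega>0g(1)[OF that(1), of k] n1q that(2) unfolding good_def n1'_def by simp
  have Zn0: "real (n1' (shift k \<omega>)) \<le> Z \<omega> * (1 + \<bar>real_of_int k\<bar>) powr \<beta>" if "\<omega> \<in> \<Omega>0" for \<omega> k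
    using ZW[OF \<Omega>0g(2)[OF that], of k] unfolding W_def by simp
  have ZK0: "K (shift k \<omega>) \<le> Z \<omega> * (1 + \<bar>real_of_int k\<bar>) powr \<beta>" if "\<omega> \<in> \<Omega>0" for \<omega> k
    using ZW[OF \<Omega>0g(2)[OF that], of k] unfolding W_def by simp

  define r where "r = 6 + (a - 1) / \<beta>"
  have r: "6 \<le> r" unfolding r_def using a \<beta>(1) by simp
  \<comment> \<open>The power of \<open>Z\<close> that the trivial regime needs; it does not depend
    on the observables.\<close>
  define C\<omega> where "C\<omega> \<omega> = Z \<omega> powr r" for \<omega>
  have "C\<omega> \<in> borel_measurable (restrict_space (\<Omega>P T) \<Omega>0)"
    unfolding C\<omega>_def[abs_def] by (rule measurable_restrict_space1) (use Zm in measurable)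
  moreover have "\<forall>\<omega>\<in>\<Omega>0. 0 < C\<omega> \<omega>" unfolding C\<omega>_def using Z1 by (auto simp: less_le_trans[OF zero_less_one] intro!: powr_gt_zero[THEN iffD2] less_imp_neq[symmetric])
  moreover have "\<forall>\<phi>\<in>FK T \<gamma> K. \<forall>\<psi>\<in>FK T \<gamma> K. \<exists>C\<phi>\<psi>>0. \<forall>\<omega>\<in>\<Omega>0. \<forall>n\<ge>1.
       \<bar>correlation T h \<phi> \<psi> n \<omega>\<bar> \<le> C\<omega> \<omega> * C\<phi>\<psi> * real n powr (1 + \<delta> - a) \<and>
       \<bar>correlation T h \<phi> \<psi> n (shift (- int n) \<omega>)\<bar> \<le> C\<omega> \<omega> * C\<phi>\<psi> * real n powr (1 + \<delta> - a)"
  proof (intro ballI)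
    fix \<phi> \<psi> assume fk: "\<phi> \<in> FK T \<gamma> K" "\<psi> \<in> FK T \<gamma> K"
    obtain c where c: "0 < c" and bound: "\<forall>\<omega>\<in>\<Omega>0. \<forall>n\<ge>1. \<forall>s. \<bar>s\<bar> \<le> int n \<longrightarrow> \<bar>s + int n\<bar> \<le> int n \<longrightarrow>
     \<bar>correlation T h \<phi> \<psi> n (shift s \<omega>)\<bar> \<le> Z \<omega> powr (6 + (a - 1) / \<beta>) * c * real n powr (1 + \<delta> - a)"
      using correlation_decay[where ?n1.0=n1' and Z=Z and ?\<Omega>0.0=\<Omega>0, OF fk h hp \<kappa> n0 i0 \<epsilon> less_imp_le[OF Mt(1)]
          \<beta>(1,2) \<beta>3 a a2 assms(11) b less_imp_le[OF C] mix eqv0 Q0 Zn0 ZK0 Z1] by blast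
    show "\<exists>C\<phi>\<psi>>0. \<forall>\<omega>\<in>\<Omega>0. \<forall>n\<ge>1.
       \<bar>correlation T h \<phi> \<psi> n \<omega>\<bar> \<le> C\<omega> \<omega> * C\<phi>\<psi> * real n powr (1 + \<delta> - a) \<and>
       \<bar>correlation T h \<phi> \<psi> n (shift (- int n) \<omega>)\<bar> \<le> C\<omega> \<omega> * C\<phi>\<psi> * real n powr (1 + \<delta> - a)"
    proof (rule exI[of _ c], intro conjI ballI allI impI c)
      fix \<omega> n assume \<omega>: "\<omega> \<in> \<Omega>0" and n: "(1::nat) \<le> n"
      note B = bound[rule_format, OF \<omega> n, folded r_def, folded C\<omega>_def]
      show "\<bar>correlation T h \<phi> \<psi> n \<omega>\<bar> \<le> C\<omega> \<omega> * c * real n powr (1 + \<delta> - a)"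
        using B[of 0] by simp
      show "\<bar>correlation T h \<phi> \<psi> n (shift (- int n) \<omega>)\<bar> \<le> C\<omega> \<omega> * c * real n powr (1 + \<delta> - a)"
        using B[of "- int n"] by simp
    qed
  qed
  moreover have "\<exists>C'>0. \<exists>u'>0. \<exists>v'. 0 < v' \<and> v' < 1 \<and>
       (\<forall>n::nat. 1 \<le> n \<longrightarrow>
          measure (\<Omega>P T) {\<omega> \<in> \<Omega>0. real n < C\<omega> \<omega>} \<le> C' * exp (- u' * real n powr v'))"
  proof -
    from Zt obtain C' u' where C': "0 < C'" "0 < u'"
      and tl: "\<And>t. 1 \<le> t \<Longrightarrow> measure (\<Omega>P T) {\<omega> \<in> \<Omega>'. t < Z \<omega>} \<le> C' * exp (- u' * t powr v)" by blast
    \<comment> \<open>The power \<open>r\<close> turns the exponent \<open>v\<close> of the tail of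
      \<open>Z\<close> into \<open>v / r\<close>; the cap 1/2 makes \<open>v'\<close> smaller than
      1.\<close>
    define v' where "v' = min (v / r) (1 / 2)"
    have v': "0 < v'" "v' < 1" "v' \<le> v / r" unfolding v'_def using u r by auto
    have "measure (\<Omega>P T) {\<omega> \<in> \<Omega>0. real n < C\<omega> \<omega>} \<le> C' * exp (- u' * real n powr v')" if n: "1 \<le> n" for n :: nat
    proof -
      have sub: "{\<omega> \<in> \<Omega>0. real n < C\<omega> \<omega>} \<subseteq> {\<omega> \<in> \<Omega>'. real n powr (1 / r) < Z \<omega>}"
      proof
        fix \<omega> assume \<omega>: "\<omega> \<in> {\<omega> \<in> \<Omega>0. real n < C\<omega> \<omega>}"
        then have "real n powr (1 / r) < (Z \<omega> powr r) powr (1 / r)"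
          unfolding C\<omega>_def using r by (intro powr_less_mono2) auto
        also have "\<dots> = Z \<omega>" using r Z1[of \<omega>] by (simp add: powr_powr)
        finally show "\<omega> \<in> {\<omega> \<in> \<Omega>'. real n powr (1 / r) < Z \<omega>}" using \<omega> \<Omega>0g(2) by blast
      qed
      have ms: "{\<omega> \<in> \<Omega>'. real n powr (1 / r) < Z \<omega>} \<in> sets (\<Omega>P T)"
      proof -
        have "{\<omega> \<in> \<Omega>'. real n powr (1 / r) < Z \<omega>} = \<Omega>' \<inter> {\<omega> \<in> space (\<Omega>P T). real n powr (1 / r) < Z \<omega>}"
          unfolding space\<Omega> by auto
        also have "\<dots> \<in> sets (\<Omega>P T)" by (rule sets.Int[OF \<Omega>'(1)]) (use Zm in measurable)
        finally show ?thesis .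
      qed
      have "measure (\<Omega>P T) {\<omega> \<in> \<Omega>0. real n < C\<omega> \<omega>} \<le> measure (\<Omega>P T) {\<omega> \<in> \<Omega>'. real n powr (1 / r) < Z \<omega>}"
        by (rule P.finite_measure_mono[OF sub ms])
      also have "\<dots> \<le> C' * exp (- u' * (real n powr (1 / r)) powr v)"
        by (rule tl) (use n r in \<open>simp add: ge_one_powr_ge_zero\<close>)
      also have "\<dots> \<le> C' * exp (- u' * real n powr v')"
      proof -
        have "real n powr v' \<le> (real n powr (1 / r)) powr v"
          unfolding powr_powr using n v'(3) by (intro powr_mono) auto
        then have "u' * real n powr v' \<le> u' * (real n powr (1 / r)) powr v" using C' by (intro mult_left_mono) auto
        then show ?thesis using C' by (intro mult_left_mono) auto
      qed
      finally show ?thesis .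
    qed
    then show ?thesis using C' v'(1,2) by blast
  qed
  ultimately show ?thesis unfolding correlation_past unfolding correlation_def using \<Omega>0s \<Omega>0f \<Omega>0p by (intro exI[of _ \<Omega>0] exI[of _ C\<omega>] conjI)
qed

end
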